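(* Let $0<\delta<1$ and let $\phi_h(u)=\max\{1-u,0\}$ be the hinge loss. Suppose some pointwise minimizer $f_\rho^{\phi_h}$ lies in $Lip^{(r,c_0)}$ for some $r>0,c_0>0$, and $\rho$ satisfies the Tsybakov noise condition with exponent $q\in[0,\infty)$. Let $\sigma=m^{-\frac{q+1}{(q+2)r+(q+1)d}}$ and $\lambda=m^{-1}$. Then for every $0<\nu<\frac{(q+1)r}{(q+2)r+(q+1)d}$, with probability at least $1-\delta$, $$\mathcal R(\mathrm{sign}(f_{D,\sigma,\lambda}))-\mathcal R(f_c)\le\hat C_1\,m^{-\frac{(q+1)r}{(q+2)r+(q+1)d}+\nu}\log\frac4\delta,$$ where $\hat C_1$ is a constant independent of $\delta$ and $m$.
   Context: Setting: $X=[0,1]^d$, $Y=\{-1,1\}$, $\rho$ a Borel probability measure on $Z=X\times Y$ with marginal $\rho_X$; $\eta(x)=\mathbf P[y=1|x]$; sample $D=\{(x_i,y_i)\}_{i=1}^m$ i.i.d. from $\rho$; $\mathcal R(\mathcal C)=\mathbf P[\mathcal C(x)\ne y]$; Bayes rule $f_c(x)=1$ if $\eta(x)\ge1/2$, else $-1$. $f_\rho^{\phi_h}(x)$ denotes a minimizer over $t\in\mathbf R$ of $\int_Y\phi_h(yt)d\rho(y|x)$. Tsybakov noise condition with exponent $q\in[0,\infty]$: there is $\hat c_q>0$ with $\rho_X(\{x:|2\eta(x)-1|\le\hat c_qt\})\le t^q$ for all $t>0$. $G_\sigma(x,x')=\exp(-\|x-x'\|_2^2/\sigma^2)$ with RKHS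 $(\mathcal H_\sigma,\|\cdot\|_\sigma)$; $f_{D,\sigma,\lambda}=\arg\min_{f\in\mathcal H_\sigma}\{\frac1m\sum_i\phi_h(y_if(x_i))+\lambda\|f\|_\sigma^2\}$. $Lip^{(r,c_0)}$ ($r=u+v$, $u\in\mathbf N_0$, $0<v\le1$) is the set of functions on $X$ whose partial derivatives of total order $u$ exist and satisfy $|\partial^\alpha f(x)-\partial^\alpha f(x')|\le c_0\|x-x'\|_2^v$. *)

theory Defs
  imports "HOL-Probability.Probability"
begin

definition hinge :: "real \<Rightarrow> real" where
  "hinge u = max (1 - u) 0"

definition unit_cube :: "(real^'d) set" where
  "unit_cube = cbox 0 One"

definition gauss_kernel :: "real \<Rightarrow> real^'d \<Rightarrow> real^'d \<Rightarrow> real" where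
  "gauss_kernel \<sigma> x x' = exp (- ((norm (x - x'))\<^sup>2) / \<sigma>\<^sup>2)"

text \<open>RKHS of a kernel K on a domain S (Aronszajn's construction): finite kernel
  combinations sum_{i<n} c_i K(p_i, .), with p_i in S, completed with respect to the
  pre-Hilbert norm; elements are the pointwise limits on S of Cauchy sequences of
  such combinations (extended by 0 outside S).\<close>
type_synonym 'a kcomb = "(nat \<Rightarrow> real) \<times> (nat \<Rightarrow> 'a) \<times> nat"

definition kc_eval :: "('a \<Rightarrow> 'a \<Rightarrow> real) \<Rightarrow> 'a kcomb \<Rightarrow> 'a \<Rightarrow> real" where
  "kc_eval K a x = (\<Sum>i<snd (snd a). fst a i * K (fst (snd a) i) x)"

definition kc_inner :: "('a \<Rightarrow> 'a \<Rightarrow> real) \<Rightarrow> 'a kcomb \<Rightarrow> 'a kcomb \<Rightarrow> real" where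
  "kc_inner K a b = (\<Sum>i<snd (snd a). \<Sum>j<snd (snd b).
       fst a i * fst b j * K (fst (snd a) i) (fst (snd b) j))"

definition rkhs_approx :: "('a \<Rightarrow> 'a \<Rightarrow> real) \<Rightarrow> 'a set \<Rightarrow> ('a \<Rightarrow> real) \<Rightarrow> (nat \<Rightarrow> 'a kcomb) \<Rightarrow> bool" where
  "rkhs_approx K S f g \<longleftrightarrow>
     (\<forall>k. \<forall>i < snd (snd (g k)). fst (snd (g k)) i \<in> S) \<and>
     (\<forall>\<epsilon>>0. \<exists>N. \<forall>k\<ge>N. \<forall>l\<ge>N.
        kc_inner K (g k) (g k) - 2 * kc_inner K (g k) (g l) + kc_inner K (g l) (g l) < \<epsilon>) \<and>
     (\<forall>x\<in>S. (\<lambda>k. kc_eval K (g k) x) \<longlonglongrightarrow> f x)"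

definition rkhs :: "('a \<Rightarrow> 'a \<Rightarrow> real) \<Rightarrow> 'a set \<Rightarrow> ('a \<Rightarrow> real) set" where
  "rkhs K S = {f. (\<forall>x. x \<notin> S \<longrightarrow> f x = 0) \<and> (\<exists>g. rkhs_approx K S f g)}"

definition rkhs_sqnorm :: "('a \<Rightarrow> 'a \<Rightarrow> real) \<Rightarrow> 'a set \<Rightarrow> ('a \<Rightarrow> real) \<Rightarrow> real" where
  "rkhs_sqnorm K S f = (THE L. \<exists>g. rkhs_approx K S f g \<and> (\<lambda>k. kc_inner K (g k) (g k)) \<longlonglongrightarrow> L)"

definition H_gauss :: "real \<Rightarrow> (real^'d \<Rightarrow> real) set" where
  "H_gauss \<sigma> = rkhs (gauss_kernel \<sigma>) unit_cube"

definition gauss_sqnorm :: "real \<Rightarrow> (real^'d \<Rightarrow> real) \<Rightarrow> real" where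
  "gauss_sqnorm \<sigma> f = rkhs_sqnorm (gauss_kernel \<sigma>) unit_cube f"

text \<open>Regularized empirical hinge risk and the SVM solution f_{D,sigma,lambda}
  (the minimizer over H_sigma, which exists and is unique).\<close>
definition svm_objective :: "real \<Rightarrow> real \<Rightarrow> nat \<Rightarrow> (nat \<Rightarrow> (real^'d) \<times> real) \<Rightarrow> (real^'d \<Rightarrow> real) \<Rightarrow> real" where
  "svm_objective \<sigma> lam m D f =
     (1 / real m) * (\<Sum>i<m. hinge (snd (D i) * f (fst (D i)))) + lam * gauss_sqnorm \<sigma> f"

definition svm_sol :: "real \<Rightarrow> real \<Rightarrow> nat \<Rightarrow> (nat \<Rightarrow> (real^'d) \<times> real) \<Rightarrow> (real^'d \<Rightarrow> real)" where
  "svm_sol \<sigma> lam m D = (SOME f. f \<in> H_gauss \<sigma> \<and>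
      (\<forall>g\<in>H_gauss \<sigma>. svm_objective \<sigma> lam m D f \<le> svm_objective \<sigma> lam m D g))"

definition sign_clf :: "('a \<Rightarrow> real) \<Rightarrow> 'a \<Rightarrow> real" where
  "sign_clf f x = (if f x \<ge> 0 then 1 else -1)"

definition risk :: "('a \<times> real) measure \<Rightarrow> ('a \<Rightarrow> real) \<Rightarrow> real" where
  "risk \<rho> C = measure \<rho> {z \<in> space \<rho>. C (fst z) \<noteq> snd z}"

definition bayes_rule :: "('a \<Rightarrow> real) \<Rightarrow> 'a \<Rightarrow> real" where
  "bayes_rule \<eta> x = (if \<eta> x \<ge> 1/2 then 1 else -1)"

text \<open>Conditional hinge risk: integral over Y of phi_h(y t) d rho(y|x).\<close>
definition cond_hinge_risk :: "('a \<Rightarrow> real) \<Rightarrow> 'a \<Rightarrow> real \<Rightarrow> real" where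
  "cond_hinge_risk \<eta> x t = \<eta> x * hinge t + (1 - \<eta> x) * hinge (- t)"

text \<open>Lip^(r,c0): with r = u + v, u in N_0, 0 < v \<le> 1 (so u = ceil r - 1),
  all iterated partial derivatives of order up to u exist on X
  (one-sided at the boundary) and those of total order u are v-Hoelder with constant c0.
  Df beta is the iterated partial derivative along the coordinate list beta.\<close>
definition lip_class :: "real \<Rightarrow> real \<Rightarrow> (real^'d \<Rightarrow> real) \<Rightarrow> bool" where
  "lip_class r c0 f \<longleftrightarrow>
    (let u = nat (\<lceil>r\<rceil> - 1); v = r - real u in
     \<exists>Df :: 'd list \<Rightarrow> real^'d \<Rightarrow> real.
       (\<forall>x\<in>unit_cube. Df [] x = f x) \<and>
       (\<forall>\<beta> i x. length \<beta> < u \<and> x \<in> unit_cube \<longrightarrow>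
          ((\<lambda>t. Df \<beta> (x + t *\<^sub>R axis i 1)) has_real_derivative Df (i # \<beta>) x)
            (at 0 within {t. x + t *\<^sub>R axis i 1 \<in> unit_cube})) \<and>
       (\<forall>\<beta>. length \<beta> = u \<longrightarrow> (\<forall>x\<in>unit_cube. \<forall>x'\<in>unit_cube.
          \<bar>Df \<beta> x - Df \<beta> x'\<bar> \<le> c0 * norm (x - x') powr v)))"

end

theory Submission
  imports Defs
begin

text \<open>The smoothness of the minimizer \<open>f\<rho>\<close> matters only through uniform continuity: it is at
  least 1 where \<open>\<eta> > 1/2\<close> and at most \<open>-1\<close> where \<open>\<eta> < 1/2\<close>, so these two
  regions lie at a positive distance \<open>\<gamma>\<close>, while on \<open>\<eta> = 1/2\<close> every value in
  \<open>[-1, 1]\<close> is optimal. Convolving a \<open>\<plusminus>1\<close> labelling of space with a Gaussian window of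
  width \<open>\<sigma>\<close> gives an element of the RKHS of squared norm \<open>O(\<sigma>\<^sup>-\<^sup>d)\<close> whose excess hinge risk is
  of order \<open>exp (-\<gamma>\<^sup>2 / (4 \<sigma>\<^sup>2))\<close>, hence below every power of \<open>\<sigma>\<close>.

  Since \<open>\<lambda> = 1/m\<close>, the SVM solution has squared norm at most \<open>m\<close>. Re-centring the
  exponential series of the kernel at the points of a grid of mesh slightly below \<open>\<sigma>\<close> shows that
  the ball of that radius has a uniform \<open>6/m\<close>-net with logarithmic cardinality
  \<open>O(\<sigma>\<^sup>-\<^sup>d m\<^sup>\<nu>)\<close>, so no chaining is needed: an exponential moment bound and a union bound over
  the net suffice. For functions clipped to \<open>[-1, 1]\<close> the hinge loss is linear and the Tsybakov condition
  bounds the second moment of the loss difference by \<open>2 / (ch t)\<close> times its mean plus \<open>4 t\<^sup>q\<close>, for every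
  \<open>t > 0\<close>; the choice \<open>t = m\<^sup>-\<^sup>r\<^sup>/\<^sup>Q\<close> with \<open>Q = (q + 2) r + (q + 1) d\<close> balances the two
  contributions and yields the rate.\<close>

section \<open>Reproducing kernel Hilbert spaces of positive semidefinite kernels\<close>

text \<open>An element of the RKHS is given only as a pointwise limit of kernel combinations, its
  norm by a definite description and the SVM solution by a choice. So the work is done on finite
  combinations and carried to limits, once the norm is known not to depend on the approximating
  sequence and a minimizer is known to exist. One variational argument serves twice: for that
  existence, and for a Riesz representation that places a given function in the RKHS.

  The event of the theorem does not mention the solution: it is built from the deviations of one
  comparison function and of finitely many net elements, which makes it measurable; on it the
  solution is bounded deterministically.

  The exponents come from matching three terms. With \<open>\<theta>\<close> proportional to
  \<open>t\<close>, the estimation error is \<open>(1 / \<sigma>) ^ d / (t * m)\<close> up to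
  \<open>m powr \<nu>\<close>, and the noise condition contributes \<open>t powr (q + 1)\<close>.
  Both equal the target rate, and so does \<open>\<sigma> powr r\<close>. The true approximation
  error is far smaller; it is merely bounded by \<open>\<sigma> powr r\<close>.\<close>

definition kc_app :: "('a \<Rightarrow> real) \<Rightarrow> 'a kcomb \<Rightarrow> real" where
  "kc_app \<phi> a = (\<Sum>i<snd (snd a). fst a i * \<phi> (fst (snd a) i))"

text \<open>Concatenation of the two term lists. Combinations representing the same function are not
  identified, so linear algebra holds only after applying \<open>kc_app\<close>.\<close>

definition kc_lin :: "real \<Rightarrow> 'a kcomb \<Rightarrow> real \<Rightarrow> 'a kcomb \<Rightarrow> 'a kcomb" where
  "kc_lin \<alpha> a \<beta> b = (let n = snd (snd a) in
     (\<lambda>i. if i < n then \<alpha> * fst a i else \<beta> * fst b (i - n),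
      \<lambda>i. if i < n then fst (snd a) i else fst (snd b) (i - n),
      n + snd (snd b)))"

definition kc_in :: "'a set \<Rightarrow> 'a kcomb \<Rightarrow> bool" where
  "kc_in S a \<longleftrightarrow> (\<forall>i < snd (snd a). fst (snd a) i \<in> S)"

definition kc_single :: "'a \<Rightarrow> 'a kcomb" where
  "kc_single x = (\<lambda>_. 1, \<lambda>_. x, 1)"

definition kc_zero :: "'a kcomb" where
  "kc_zero = (\<lambda>_. 0, \<lambda>_. undefined, 0)"

text \<open>A combination is a finitely supported signed measure and \<open>kc_app\<close> pairs it
  with a function. Evaluation is one pairing and the inner product an iterated one, so both inherit
  linearity from \<open>kc_app_lin\<close>.\<close>

lemma kc_eval_app: "kc_eval K a x = kc_app (\<lambda>p. K p x) a"
  by (simp add: kc_eval_def kc_app_def)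

lemma kc_inner_app: "kc_inner K a b = kc_app (\<lambda>p. kc_app (K p) b) a"
  by (simp add: kc_inner_def kc_app_def sum_distrib_left mult.assoc)

lemma kc_app_lin: "kc_app \<phi> (kc_lin \<alpha> a \<beta> b) = \<alpha> * kc_app \<phi> a + \<beta> * kc_app \<phi> b"
proof -
  define n where "n = snd (snd a)"
  define k where "k = snd (snd b)"
  let ?c = "kc_lin \<alpha> a \<beta> b"
  have "kc_app \<phi> ?c = (\<Sum>i<n+k. fst ?c i * \<phi> (fst (snd ?c) i))"
    by (simp add: kc_app_def kc_lin_def n_def k_def Let_def)
  also have "\<dots> = (\<Sum>i<n. fst ?c i * \<phi> (fst (snd ?c) i)) + (\<Sum>i<k. fst ?c (i+n) * \<phi> (fst (snd ?c) (i+n)))"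
    by (induction k) (simp_all add: add_ac)
  also have "(\<Sum>i<n. fst ?c i * \<phi> (fst (snd ?c) i)) = \<alpha> * kc_app \<phi> a"
    by (simp add: kc_app_def kc_lin_def n_def Let_def sum_distrib_left mult.assoc)
  also have "(\<Sum>i<k. fst ?c (i+n) * \<phi> (fst (snd ?c) (i+n))) = \<beta> * kc_app \<phi> b"
    by (simp add: kc_app_def kc_lin_def n_def k_def Let_def sum_distrib_left mult.assoc)
  finally show ?thesis .
qed

lemma kc_app_add: "kc_app (\<lambda>p. \<phi> p + \<psi> p) a = kc_app \<phi> a + kc_app \<psi> a"
  by (simp add: kc_app_def algebra_simps sum.distrib)

lemma kc_app_cmult: "kc_app (\<lambda>p. c * \<phi> p) a = c * kc_app \<phi> a"
  by (simp add: kc_app_def algebra_simps sum_distrib_left)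

lemma kc_app_multc: "kc_app (\<lambda>p. \<phi> p * c) a = kc_app \<phi> a * c"
  by (simp add: kc_app_def algebra_simps sum_distrib_left)

lemma kc_app_sum: "kc_app (\<lambda>p. \<Sum>w\<in>W. \<phi> w p) a = (\<Sum>w\<in>W. kc_app (\<phi> w) a)"
  by (simp add: kc_app_def sum_distrib_left sum.swap[of _ W])

lemma kc_app_single [simp]: "kc_app \<phi> (kc_single x) = \<phi> x"
  by (simp add: kc_app_def kc_single_def)

lemma kc_app_zero [simp]: "kc_app \<phi> kc_zero = 0"
  by (simp add: kc_app_def kc_zero_def)

lemma kc_app_tendsto:
  assumes "kc_in S a" "\<And>x. x \<in> S \<Longrightarrow> (\<lambda>k. \<phi> k x) \<longlonglongrightarrow> \<psi> x"
  shows "(\<lambda>k. kc_app (\<phi> k) a) \<longlonglongrightarrow> kc_app \<psi> a"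
  unfolding kc_app_def using assms by (intro tendsto_sum tendsto_mult) (auto simp: kc_in_def)

lemma kc_in_lin: "kc_in S a \<Longrightarrow> kc_in S b \<Longrightarrow> kc_in S (kc_lin \<alpha> a \<beta> b)"
  by (auto simp: kc_in_def kc_lin_def Let_def)

lemma kc_in_single: "x \<in> S \<Longrightarrow> kc_in S (kc_single x)"
  by (simp add: kc_in_def kc_single_def)

lemma kc_in_zero: "kc_in S kc_zero"
  by (simp add: kc_in_def kc_zero_def)

lemma kc_eval_lin: "kc_eval K (kc_lin \<alpha> a \<beta> b) x = \<alpha> * kc_eval K a x + \<beta> * kc_eval K b x"
  by (simp add: kc_eval_app kc_app_lin)

lemma kc_inner_lin_left:
  "kc_inner K (kc_lin \<alpha> a \<beta> b) c = \<alpha> * kc_inner K a c + \<beta> * kc_inner K b c"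
  by (simp add: kc_inner_app kc_app_lin)

lemma kc_inner_lin_right:
  "kc_inner K c (kc_lin \<alpha> a \<beta> b) = \<alpha> * kc_inner K c a + \<beta> * kc_inner K c b"
  by (simp add: kc_inner_app kc_app_lin kc_app_add kc_app_cmult)

text \<open>Only semidefinite: a combination that is not formally zero may have norm zero, for
  instance through repeated points.\<close>

definition psd_kernel :: "('a \<Rightarrow> 'a \<Rightarrow> real) \<Rightarrow> bool" where
  "psd_kernel K \<longleftrightarrow> (\<forall>x y. K x y = K y x) \<and> (\<forall>a. 0 \<le> kc_inner K a a)"

definition kc_dist :: "('a \<Rightarrow> 'a \<Rightarrow> real) \<Rightarrow> 'a kcomb \<Rightarrow> 'a kcomb \<Rightarrow> real" where
  "kc_dist K a b = kc_inner K a a - 2 * kc_inner K a b + kc_inner K b b"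

locale psd =
  fixes K :: "'a \<Rightarrow> 'a \<Rightarrow> real"
  assumes psd: "psd_kernel K"
begin

lemma K_sym: "K x y = K y x"
  using psd by (auto simp: psd_kernel_def)

lemma inner_ge0: "0 \<le> kc_inner K a a"
  using psd unfolding psd_kernel_def by blast

lemma inner_sym: "kc_inner K a b = kc_inner K b a"
  unfolding kc_inner_def by (subst sum.swap) (simp add: K_sym mult_ac)

lemma inner_single: "kc_inner K a (kc_single x) = kc_eval K a x"
  by (simp add: kc_inner_app kc_eval_app)

lemma eval_single: "kc_eval K (kc_single x) y = K x y"
  by (simp add: kc_eval_app)

lemma inner_single_single: "kc_inner K (kc_single x) (kc_single y) = K x y"
  by (simp add: kc_inner_app)

lemma inner_lin_self:
  "kc_inner K (kc_lin \<alpha> a \<beta> b) (kc_lin \<alpha> a \<beta> b) =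
    \<alpha>\<^sup>2 * kc_inner K a a + 2 * \<alpha> * \<beta> * kc_inner K a b + \<beta>\<^sup>2 * kc_inner K b b"
  by (simp add: kc_inner_lin_left kc_inner_lin_right inner_sym[of b a] power2_eq_square algebra_simps)

lemma kc_dist_eq: "kc_dist K a b = kc_inner K (kc_lin 1 a (-1) b) (kc_lin 1 a (-1) b)"
  by (simp add: inner_lin_self kc_dist_def)

lemma kc_dist_ge0: "0 \<le> kc_dist K a b"
  by (simp add: kc_dist_eq inner_ge0)

lemma cauchy_schwarz: "(kc_inner K a b)\<^sup>2 \<le> kc_inner K a a * kc_inner K b b"
proof -
  define A where "A = kc_inner K a a"
  define B where "B = kc_inner K b b"
  define M where "M = kc_inner K a b"
  have q: "0 \<le> \<alpha>\<^sup>2 * A + 2 * \<alpha> * \<beta> * M + \<beta>\<^sup>2 * B" for \<alpha> \<beta>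
    using inner_ge0[of "kc_lin \<alpha> a \<beta> b"] unfolding inner_lin_self A_def B_def M_def .
  have B0: "0 \<le> B" unfolding B_def by (rule inner_ge0)
  have "M\<^sup>2 \<le> A * B"
  proof (cases "B = 0")
    case True
    have "M = 0"
    proof (rule ccontr)
      assume "M \<noteq> 0"
      \<comment> \<open>With \<open>B = 0\<close> the form is affine in its second argument; this
        argument makes its value -1.\<close>
      then have "0 \<le> A + 2 * (- (A + 1) / (2 * M)) * M"
        using q[of 1 "- (A + 1) / (2 * M)"] True by simp
      then show False using \<open>M \<noteq> 0\<close> by (simp add: field_simps)
    qed
    then show ?thesis using True by simp
  next
    case False
    then have "0 < B" using B0 by simp
    have "0 \<le> B * (A * B - M\<^sup>2)"
      using q[of B "-M"] by (simp add: power2_eq_square algebra_simps)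
    then show ?thesis using \<open>0 < B\<close> by (simp add: zero_le_mult_iff)
  qed
  then show ?thesis by (simp add: A_def B_def M_def)
qed

lemma cauchy_schwarz_abs: "\<bar>kc_inner K a b\<bar> \<le> sqrt (kc_inner K a a) * sqrt (kc_inner K b b)"
  using real_sqrt_le_mono[OF cauchy_schwarz[of a b]] by (simp add: real_sqrt_mult)

text \<open>Reproducing property: evaluation at \<open>x\<close> is the inner product with
  \<open>kc_single x\<close>, whose squared norm is \<open>K x x\<close>.\<close>

lemma eval_diff_le: "\<bar>kc_eval K a x - kc_eval K b x\<bar> \<le> sqrt (kc_dist K a b) * sqrt (K x x)"
  using cauchy_schwarz_abs[of "kc_lin 1 a (-1) b" "kc_single x"]
  by (simp add: kc_dist_eq inner_single eval_single kc_eval_lin)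

lemma norm_diff_le:
  "\<bar>sqrt (kc_inner K a a) - sqrt (kc_inner K b b)\<bar> \<le> sqrt (kc_dist K a b)"
proof -
  have "(sqrt (kc_inner K a a) - sqrt (kc_inner K b b))\<^sup>2 \<le> kc_dist K a b"
    using cauchy_schwarz_abs[of a b] inner_ge0[of a] inner_ge0[of b]
    by (simp add: kc_dist_def power2_diff)
  from real_sqrt_le_mono[OF this] show ?thesis by simp
qed

text \<open>The parallelogram identity; its last term is the quadratic gain that makes minimizing
  sequences Cauchy.\<close>

lemma midpoint:
  "kc_inner K (kc_lin (1/2) a (1/2) b) (kc_lin (1/2) a (1/2) b)
    = (kc_inner K a a + kc_inner K b b) / 2 - kc_dist K a b / 4"
  by (simp add: inner_lin_self kc_dist_def power2_eq_square field_simps)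

definition kc_Cauchy :: "(nat \<Rightarrow> 'a kcomb) \<Rightarrow> bool" where
  "kc_Cauchy g \<longleftrightarrow> (\<forall>\<epsilon>>0. \<exists>N. \<forall>k\<ge>N. \<forall>l\<ge>N. kc_dist K (g k) (g l) < \<epsilon>)"

lemma rkhs_approx_iff:
  "rkhs_approx K S f g \<longleftrightarrow> (\<forall>k. kc_in S (g k)) \<and> kc_Cauchy g \<and>
     (\<forall>x\<in>S. (\<lambda>k. kc_eval K (g k) x) \<longlonglongrightarrow> f x)"
  by (auto simp: rkhs_approx_def kc_in_def kc_Cauchy_def kc_dist_def)

lemma kc_Cauchy_sqrt:
  assumes "kc_Cauchy g" "0 < e"
  shows "\<exists>N. \<forall>k\<ge>N. \<forall>l\<ge>N. sqrt (kc_dist K (g k) (g l)) < e"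
proof -
  obtain N where "\<forall>k\<ge>N. \<forall>l\<ge>N. kc_dist K (g k) (g l) < e\<^sup>2"
    using assms by (auto simp: kc_Cauchy_def) (meson zero_less_power)
  then show ?thesis
    using assms(2) by (intro exI[of _ N]) (auto intro!: real_less_lsqrt)
qed

lemma kc_Cauchy_eval_convergent:
  assumes "kc_Cauchy g"
  shows "convergent (\<lambda>k. kc_eval K (g k) x)"
proof (rule Cauchy_convergent, rule CauchyI)
  fix e :: real assume "0 < e"
  define c where "c = sqrt (K x x) + 1"
  have c: "0 < c" "sqrt (K x x) \<le> c"
    using inner_ge0[of "kc_single x"] by (auto simp: c_def inner_single_single add_nonneg_pos)
  obtain N where N: "\<And>k l. k \<ge> N \<Longrightarrow> l \<ge> N \<Longrightarrow> sqrt (kc_dist K (g k) (g l)) < e / c"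
    using kc_Cauchy_sqrt[OF assms, of "e / c"] \<open>0 < e\<close> c by auto
  show "\<exists>M. \<forall>k\<ge>M. \<forall>l\<ge>M. norm (kc_eval K (g k) x - kc_eval K (g l) x) < e"
  proof (intro exI[of _ N] allI impI)
    fix k l assume "k \<ge> N" "l \<ge> N"
    have "norm (kc_eval K (g k) x - kc_eval K (g l) x) \<le> sqrt (kc_dist K (g k) (g l)) * sqrt (K x x)"
      using eval_diff_le by simp
    also have "\<dots> \<le> sqrt (kc_dist K (g k) (g l)) * c"
      using c kc_dist_ge0 by (intro mult_left_mono) auto
    also have "\<dots> < e" using N[OF \<open>k \<ge> N\<close> \<open>l \<ge> N\<close>] c by (simp add: field_simps)
    finally show "norm (kc_eval K (g k) x - kc_eval K (g l) x) < e" .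
  qed
qed

lemma kc_Cauchy_norm_convergent:
  assumes "kc_Cauchy g"
  shows "convergent (\<lambda>k. sqrt (kc_inner K (g k) (g k)))"
proof (rule Cauchy_convergent, rule CauchyI)
  fix e :: real assume "0 < e"
  then obtain N where "\<forall>k\<ge>N. \<forall>l\<ge>N. sqrt (kc_dist K (g k) (g l)) < e"
    using kc_Cauchy_sqrt[OF assms] by blast
  then show "\<exists>M. \<forall>k\<ge>M. \<forall>l\<ge>M.
      norm (sqrt (kc_inner K (g k) (g k)) - sqrt (kc_inner K (g l) (g l))) < e"
    using norm_diff_le by (metis le_less_trans real_norm_def)
qed

lemma kc_Cauchy_sqnorm_convergent:
  assumes "kc_Cauchy g"
  shows "convergent (\<lambda>k. kc_inner K (g k) (g k))"
proof -
  obtain L where "(\<lambda>k. sqrt (kc_inner K (g k) (g k))) \<longlonglongrightarrow> L"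
    using kc_Cauchy_norm_convergent[OF assms] by (auto simp: convergent_def)
  then have "(\<lambda>k. (sqrt (kc_inner K (g k) (g k)))\<^sup>2) \<longlonglongrightarrow> L\<^sup>2"
    by (rule tendsto_power)
  then show ?thesis using inner_ge0 by (auto simp: convergent_def)
qed

lemma kc_dist_self: "kc_dist K a a = 0"
  by (simp add: kc_dist_def)

text \<open>Triangle inequality after regrouping \<open>(a - b) - (c - d)\<close> as
  \<open>(a - c) - (b - d)\<close>.\<close>

lemma sqrt_kc_dist_lin:
  "sqrt (kc_dist K (kc_lin 1 a (-1) b) (kc_lin 1 c (-1) d)) \<le> sqrt (kc_dist K a c) + sqrt (kc_dist K b d)"
proof -
  define u where "u = kc_lin 1 a (-1) c"
  define v where "v = kc_lin 1 b (-1) d"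
  have "kc_dist K (kc_lin 1 a (-1) b) (kc_lin 1 c (-1) d) =
     kc_inner K u u - 2 * kc_inner K u v + kc_inner K v v"
    by (simp add: kc_dist_def u_def v_def kc_inner_lin_left kc_inner_lin_right
        inner_sym[of b a] inner_sym[of c a] inner_sym[of d a] inner_sym[of c b] inner_sym[of d b]
        inner_sym[of d c] algebra_simps)
  also have "\<dots> \<le> (sqrt (kc_inner K u u) + sqrt (kc_inner K v v))\<^sup>2"
    using cauchy_schwarz_abs[of u v] inner_ge0[of u] inner_ge0[of v] by (simp add: power2_sum)
  finally show ?thesis
    using inner_ge0[of u] inner_ge0[of v]
    by (simp add: kc_dist_eq u_def v_def real_le_lsqrt)
qed

text \<open>Pairing with a fixed combination only involves finitely many point evaluations.\<close>

lemma null_sequence_norm: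
  assumes "kc_Cauchy e" "\<And>k. kc_in S (e k)"
    and lim: "\<And>x. x \<in> S \<Longrightarrow> (\<lambda>k. kc_eval K (e k) x) \<longlonglongrightarrow> 0"
  shows "(\<lambda>k. sqrt (kc_inner K (e k) (e k))) \<longlonglongrightarrow> 0"
proof -
  obtain L where L: "(\<lambda>k. sqrt (kc_inner K (e k) (e k))) \<longlonglongrightarrow> L"
    using kc_Cauchy_norm_convergent[OF assms(1)] by (auto simp: convergent_def)
  have L0: "0 \<le> L" using LIMSEQ_le_const[OF L] inner_ge0 by auto
  \<comment> \<open>For fixed \<open>N\<close> the pairing of \<open>e k\<close> with
    \<open>e N\<close> tends to 0, while it differs from the squared norm of \<open>e k\<close> by
    at most the norm times \<open>\<epsilon>\<close>.\<close>
  have key: "L\<^sup>2 \<le> L * \<epsilon>" if "0 < \<epsilon>" for \<epsilon>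
  proof -
    obtain N where N: "\<And>k l. k \<ge> N \<Longrightarrow> l \<ge> N \<Longrightarrow> sqrt (kc_dist K (e k) (e l)) < \<epsilon>"
      using kc_Cauchy_sqrt[OF assms(1) \<open>0 < \<epsilon>\<close>] by auto
    have "(\<lambda>k. kc_app (\<lambda>x. kc_eval K (e k) x) (e N)) \<longlonglongrightarrow> kc_app (\<lambda>_. 0) (e N)"
      by (rule kc_app_tendsto[OF assms(2)]) (rule lim)
    moreover have "kc_app (\<lambda>x. kc_eval K (e k) x) (e N) = kc_inner K (e k) (e N)" for k
      unfolding inner_sym[of "e k" "e N"] kc_inner_app[of K "e N" "e k"]
      by (simp add: kc_eval_app K_sym)
    ultimately have 1: "(\<lambda>k. kc_inner K (e k) (e N)) \<longlonglongrightarrow> 0"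
      by (simp add: kc_app_def)
    have 2: "(\<lambda>k. (sqrt (kc_inner K (e k) (e k)))\<^sup>2 - sqrt (kc_inner K (e k) (e k)) * \<epsilon>) \<longlonglongrightarrow> L\<^sup>2 - L * \<epsilon>"
      by (intro tendsto_intros L)
    have "L\<^sup>2 - L * \<epsilon> \<le> 0"
    proof (rule LIMSEQ_le[OF 2 1], intro exI[of _ N] allI impI)
      fix k assume "N \<le> k"
      have "kc_inner K (e k) (e k) - kc_inner K (e k) (e N) = kc_inner K (e k) (kc_lin 1 (e k) (-1) (e N))"
        by (simp add: kc_inner_lin_right)
      also have "\<dots> \<le> sqrt (kc_inner K (e k) (e k)) * sqrt (kc_dist K (e k) (e N))"
        using cauchy_schwarz_abs[of "e k" "kc_lin 1 (e k) (-1) (e N)"] by (simp add: kc_dist_eq)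
      also have "\<dots> \<le> sqrt (kc_inner K (e k) (e k)) * \<epsilon>"
        using N[OF \<open>N \<le> k\<close> order_refl] inner_ge0 by (intro mult_left_mono) auto
      finally show "(sqrt (kc_inner K (e k) (e k)))\<^sup>2 - sqrt (kc_inner K (e k) (e k)) * \<epsilon> \<le> kc_inner K (e k) (e N)"
        using inner_ge0[of "e k"] by simp
    qed
    then show ?thesis by simp
  qed
  have "L = 0"
  proof (rule ccontr)
    assume "L \<noteq> 0"
    with L0 have "0 < L" by simp
    with key[of "L / 2"] show False by (simp add: power2_eq_square)
  qed
  with L show ?thesis by simp
qed

text \<open>Justifies the definite description in \<open>rkhs_sqnorm\<close>: the difference of two
  approximating sequences is Cauchy and tends to 0 pointwise, hence in norm.\<close>

lemma sqnorm_limit_unique: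
  assumes g: "rkhs_approx K S f g" and g': "rkhs_approx K S f g'"
    and L: "(\<lambda>k. kc_inner K (g k) (g k)) \<longlonglongrightarrow> L" and L': "(\<lambda>k. kc_inner K (g' k) (g' k)) \<longlonglongrightarrow> L'"
  shows "L = L'"
proof -
  define e where "e k = kc_lin 1 (g k) (-1) (g' k)" for k
  have "kc_Cauchy e"
    unfolding kc_Cauchy_def
  proof (intro allI impI)
    fix \<epsilon> :: real assume "0 < \<epsilon>"
    then have "0 < sqrt \<epsilon> / 2" by simp
    then obtain N N' where N: "\<And>k l. k \<ge> N \<Longrightarrow> l \<ge> N \<Longrightarrow> sqrt (kc_dist K (g k) (g l)) < sqrt \<epsilon> / 2"
        and N': "\<And>k l. k \<ge> N' \<Longrightarrow> l \<ge> N' \<Longrightarrow> sqrt (kc_dist K (g' k) (g' l)) < sqrt \<epsilon> / 2"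
      using kc_Cauchy_sqrt[of g] kc_Cauchy_sqrt[of g'] g g' unfolding rkhs_approx_iff by meson
    show "\<exists>N. \<forall>k\<ge>N. \<forall>l\<ge>N. kc_dist K (e k) (e l) < \<epsilon>"
    proof (intro exI[of _ "max N N'"] allI impI)
      fix k l assume kl: "max N N' \<le> k" "max N N' \<le> l"
      have "sqrt (kc_dist K (e k) (e l)) \<le> sqrt (kc_dist K (g k) (g l)) + sqrt (kc_dist K (g' k) (g' l))"
        unfolding e_def by (rule sqrt_kc_dist_lin)
      also have "\<dots> < sqrt \<epsilon>" using N[of k l] N'[of k l] kl by simp
      finally show "kc_dist K (e k) (e l) < \<epsilon>" by simp
    qed
  qed
  moreover have "kc_in S (e k)" for k
    using g g' by (auto simp: e_def rkhs_approx_iff intro: kc_in_lin)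
  moreover have "(\<lambda>k. kc_eval K (e k) x) \<longlonglongrightarrow> 0" if "x \<in> S" for x
  proof -
    have "(\<lambda>k. kc_eval K (g k) x - kc_eval K (g' k) x) \<longlonglongrightarrow> f x - f x"
      using g g' that by (intro tendsto_diff) (auto simp: rkhs_approx_iff)
    then show ?thesis by (simp add: e_def kc_eval_lin)
  qed
  ultimately have "(\<lambda>k. sqrt (kc_inner K (e k) (e k))) \<longlonglongrightarrow> 0"
    by (rule null_sequence_norm)
  then have "(\<lambda>k. sqrt (kc_dist K (g k) (g' k))) \<longlonglongrightarrow> 0"
    by (simp add: e_def kc_dist_eq)
  then have "(\<lambda>k. sqrt (kc_inner K (g k) (g k)) - sqrt (kc_inner K (g' k) (g' k))) \<longlonglongrightarrow> 0"
    by (rule Lim_null_comparison[rotated]) (simp add: norm_diff_le)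
  from LIMSEQ_unique[OF this tendsto_diff[OF tendsto_real_sqrt[OF L] tendsto_real_sqrt[OF L']]]
  have "sqrt L - sqrt L' = 0" by simp
  then show ?thesis by simp
qed

lemma sqnorm_tendsto:
  assumes g: "rkhs_approx K S f g"
  shows "(\<lambda>k. kc_inner K (g k) (g k)) \<longlonglongrightarrow> rkhs_sqnorm K S f"
proof -
  obtain L where L: "(\<lambda>k. kc_inner K (g k) (g k)) \<longlonglongrightarrow> L"
    using g kc_Cauchy_sqnorm_convergent[of g] by (auto simp: convergent_def rkhs_approx_iff)
  have "rkhs_sqnorm K S f = L"
    unfolding rkhs_sqnorm_def
  proof (rule the_equality)
    show "\<exists>g. rkhs_approx K S f g \<and> (\<lambda>k. kc_inner K (g k) (g k)) \<longlonglongrightarrow> L"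
      using g L by blast
  qed (use sqnorm_limit_unique[OF g _ L] in blast)
  with L show ?thesis by simp
qed

lemma sqnorm_ge0:
  assumes "f \<in> rkhs K S"
  shows "0 \<le> rkhs_sqnorm K S f"
proof -
  obtain g where "rkhs_approx K S f g" using assms by (auto simp: rkhs_def)
  from LIMSEQ_le_const[OF sqnorm_tendsto[OF this]] show ?thesis using inner_ge0 by blast
qed

lemma zero_in_rkhs: "(\<lambda>_. 0) \<in> rkhs K S" "rkhs_sqnorm K S (\<lambda>_. 0) = 0"
proof -
  have "rkhs_approx K S (\<lambda>_. 0) (\<lambda>_. kc_zero)"
    by (auto simp: rkhs_approx_iff kc_in_zero kc_Cauchy_def kc_dist_self kc_eval_app)
  then show "(\<lambda>_. 0) \<in> rkhs K S" "rkhs_sqnorm K S (\<lambda>_. 0) = 0"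
    using sqnorm_tendsto[of S "\<lambda>_. 0" "\<lambda>_. kc_zero"]
    by (auto simp: rkhs_def kc_inner_app LIMSEQ_const_iff)
qed

text \<open>Midpoint convexity with a quadratic gain forces minimizing sequences to be Cauchy.\<close>

lemma minimizing_sequence:
  fixes J :: "'a kcomb \<Rightarrow> real"
  assumes lower: "\<And>a. kc_in S a \<Longrightarrow> B \<le> J a" and \<mu>: "0 < \<mu>"
    and mid: "\<And>a b. kc_in S a \<Longrightarrow> kc_in S b \<Longrightarrow>
      J (kc_lin (1/2) a (1/2) b) \<le> (J a + J b) / 2 - \<mu> * kc_dist K a b"
  obtains g Jm where "\<And>k. kc_in S (g k)" "kc_Cauchy g" "(\<lambda>k. J (g k)) \<longlonglongrightarrow> Jm"
    "\<And>a. kc_in S a \<Longrightarrow> Jm \<le> J a"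
proof -
  define Jm where "Jm = Inf (J ` Collect (kc_in S))"
  have bdd: "bdd_below (J ` Collect (kc_in S))"
    using lower by (auto intro!: bdd_belowI[of _ B])
  have Jm: "Jm \<le> J a" if "kc_in S a" for a
    unfolding Jm_def using that bdd by (intro cInf_lower) auto
  have "\<exists>a. kc_in S a \<and> J a < Jm + 1 / real (Suc k)" for k
  proof -
    have "J ` Collect (kc_in S) \<noteq> {}" using kc_in_zero by blast
    moreover have "Inf (J ` Collect (kc_in S)) < Jm + 1 / real (Suc k)" by (simp add: Jm_def)
    ultimately obtain v where "v \<in> J ` Collect (kc_in S)" "v < Jm + 1 / real (Suc k)"
      using cInf_lessD by metis
    then show ?thesis by auto
  qed
  then obtain g where g: "\<And>k. kc_in S (g k)" "\<And>k. J (g k) < Jm + 1 / real (Suc k)" by metis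
  have lim: "(\<lambda>k. J (g k)) \<longlonglongrightarrow> Jm"
  proof (rule tendsto_sandwich[of "\<lambda>_. Jm" _ _ "\<lambda>k. Jm + 1 / real (Suc k)"])
    show "(\<lambda>k. Jm + 1 / real (Suc k)) \<longlonglongrightarrow> Jm"
      using tendsto_add[OF tendsto_const LIMSEQ_inverse_real_of_nat, of Jm]
      by (simp add: inverse_eq_divide)
  qed (use g Jm in \<open>auto intro!: always_eventually less_imp_le\<close>)
  have "kc_Cauchy g"
    unfolding kc_Cauchy_def
  proof (intro allI impI)
    fix e :: real assume "0 < e"
    then obtain N where N: "1 / real (Suc N) < \<mu> * e"
      using \<mu> by (metis inverse_eq_divide reals_Archimedean mult_pos_pos)
    show "\<exists>N. \<forall>k\<ge>N. \<forall>l\<ge>N. kc_dist K (g k) (g l) < e"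
    proof (intro exI[of _ N] allI impI)
      fix k l assume "N \<le> k" "N \<le> l"
      have le: "1 / real (Suc j) \<le> 1 / real (Suc N)" if "N \<le> j" for j
        using that by (simp add: frac_le)
      have "Jm \<le> (J (g k) + J (g l)) / 2 - \<mu> * kc_dist K (g k) (g l)"
        using mid[of "g k" "g l"] Jm[of "kc_lin (1/2) (g k) (1/2) (g l)"] g(1)
        by (meson kc_in_lin order_trans)
      then have "\<mu> * kc_dist K (g k) (g l) \<le> 1 / real (Suc N)"
        using g(2)[of k] g(2)[of l] le[OF \<open>N \<le> k\<close>] le[OF \<open>N \<le> l\<close>] by argo
      with N have "\<mu> * kc_dist K (g k) (g l) < \<mu> * e" by simp
      then show "kc_dist K (g k) (g l) < e" using \<mu> by simp
    qed
  qed
  then show ?thesis using that g(1) lim Jm by blast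
qed

definition kc_limit :: "'a set \<Rightarrow> (nat \<Rightarrow> 'a kcomb) \<Rightarrow> 'a \<Rightarrow> real" where
  "kc_limit S g x = (if x \<in> S then lim (\<lambda>k. kc_eval K (g k) x) else 0)"

lemma kc_limit_approx:
  assumes "\<And>k. kc_in S (g k)" "kc_Cauchy g"
  shows "rkhs_approx K S (kc_limit S g) g"
  using assms kc_Cauchy_eval_convergent[OF assms(2)]
  by (auto simp: rkhs_approx_iff kc_limit_def convergent_LIMSEQ_iff)

lemma kc_limit_rkhs:
  assumes "\<And>k. kc_in S (g k)" "kc_Cauchy g"
  shows "kc_limit S g \<in> rkhs K S"
  using kc_limit_approx[OF assms] by (auto simp: rkhs_def kc_limit_def)

text \<open>Riesz representation. Replacing \<open>a\<close> by its multiples shows that the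
  hypothesis is the bound \<open>(kc_app \<phi> a)\<^sup>2 \<le> B * kc_inner K a a\<close>. The
  representer is the limit of a minimizing sequence of \<open>J\<close>, and its values are those of
  \<open>\<phi>\<close> because the first variation vanishes. Superpositions of Gaussian windows
  enter the RKHS this way.\<close>

lemma bounded_functional_in_rkhs:
  assumes bound: "\<And>a. kc_in S a \<Longrightarrow> 2 * kc_app \<phi> a \<le> kc_inner K a a + B"
    and zero: "\<And>x. x \<notin> S \<Longrightarrow> \<phi> x = 0"
  shows "\<phi> \<in> rkhs K S" "rkhs_sqnorm K S \<phi> \<le> 4 * B"
proof -
  define J where "J a = kc_inner K a a - 2 * kc_app \<phi> a" for a
  have lower: "- B \<le> J a" if "kc_in S a" for a
    using bound[OF that] by (simp add: J_def)
  have mid: "J (kc_lin (1/2) a (1/2) b) \<le> (J a + J b) / 2 - 1/4 * kc_dist K a b" for a b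
    unfolding J_def midpoint by (simp add: kc_app_lin field_simps)
  obtain g Jm where g: "\<And>k. kc_in S (g k)" "kc_Cauchy g" "(\<lambda>k. J (g k)) \<longlonglongrightarrow> Jm"
      "\<And>a. kc_in S a \<Longrightarrow> Jm \<le> J a"
    by (rule minimizing_sequence[of S "- B" J "1/4"]) (use lower mid in auto)
  define f where "f = kc_limit S g"
  note ap = kc_limit_approx[OF g(1,2), folded f_def]
  have "f = \<phi>"
  proof
    fix x show "f x = \<phi> x"
    proof (cases "x \<in> S")
      case True
      define d where "d = f x - \<phi> x"
      have ev: "(\<lambda>k. kc_eval K (g k) x) \<longlonglongrightarrow> f x" using ap True by (auto simp: rkhs_approx_iff)
      \<comment> \<open>First variation: moving \<open>g k\<close> by \<open>t\<close> times the
        kernel at \<open>x\<close> cannot lead below the infimum \<open>Jm\<close>. The limit is a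
        quadratic in \<open>t\<close> without constant term that is nonnegative for every
        \<open>t\<close>.\<close>
      have var: "0 \<le> 2 * t * d + t\<^sup>2 * K x x" for t
      proof -
        have "J (kc_lin 1 (g k) t (kc_single x)) =
            J (g k) + (2 * t * (kc_eval K (g k) x - \<phi> x) + t\<^sup>2 * K x x)" for k
          by (simp add: J_def inner_lin_self kc_app_lin inner_single eval_single algebra_simps)
        moreover have "Jm \<le> J (kc_lin 1 (g k) t (kc_single x))" for k
          using g True by (intro g(4) kc_in_lin kc_in_single) auto
        ultimately have "\<And>k. Jm \<le> J (g k) + (2 * t * (kc_eval K (g k) x - \<phi> x) + t\<^sup>2 * K x x)"
          by simp
        moreover have "(\<lambda>k. J (g k) + (2 * t * (kc_eval K (g k) x - \<phi> x) + t\<^sup>2 * K x x))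
            \<longlonglongrightarrow> Jm + (2 * t * d + t\<^sup>2 * K x x)"
          unfolding d_def by (intro tendsto_intros g(3) ev)
        ultimately have "Jm \<le> Jm + (2 * t * d + t\<^sup>2 * K x x)"
          by (intro LIMSEQ_le_const) auto
        then show ?thesis by simp
      qed
      have k0: "0 \<le> K x x" using inner_ge0[of "kc_single x"] by (simp add: inner_single_single)
      have "d = 0"
      proof (rule ccontr)
        assume "d \<noteq> 0"
        \<comment> \<open>The minimum is at \<open>- d / K x x\<close>; adding 1 guards against a
          vanishing diagonal and keeps the value negative.\<close>
        define t where "t = - d / (K x x + 1)"
        have "2 * t * d + t\<^sup>2 * K x x = (- d\<^sup>2 * (K x x + 2)) / (K x x + 1)\<^sup>2"
        proof -
          have "K x x + 1 \<noteq> 0" using k0 by simp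
          then have "2 * t * d = - 2 * d\<^sup>2 * (K x x + 1) / (K x x + 1)\<^sup>2"
              "t\<^sup>2 * K x x = d\<^sup>2 * K x x / (K x x + 1)\<^sup>2"
            by (simp_all add: t_def power2_eq_square)
          then show ?thesis by (simp add: add_divide_distrib[symmetric] algebra_simps)
        qed
        also have "\<dots> < 0"
          using k0 \<open>d \<noteq> 0\<close> by (intro divide_neg_pos) (auto intro!: mult_neg_pos simp del: mult_minus_left)
        finally show False using var[of t] by simp
      qed
      then show ?thesis by (simp add: d_def)
    qed (simp add: f_def kc_limit_def zero)
  qed
  with ap kc_limit_rkhs[OF g(1,2)] show "\<phi> \<in> rkhs K S" by (simp add: f_def)
  define L where "L = rkhs_sqnorm K S \<phi>"
  have L: "(\<lambda>k. kc_inner K (g k) (g k)) \<longlonglongrightarrow> L"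
    unfolding L_def using sqnorm_tendsto[OF ap] \<open>f = \<phi>\<close> by simp
  have "L \<le> Jm + (L / 2 + 2 * B)"
  proof (rule LIMSEQ_le[OF L])
    show "(\<lambda>k. J (g k) + (kc_inner K (g k) (g k) / 2 + 2 * B)) \<longlonglongrightarrow> Jm + (L / 2 + 2 * B)"
      by (intro tendsto_intros g(3) L) auto
    \<comment> \<open>The hypothesis at one half of \<open>g n\<close> leaves only half of the
      squared norm on the right, so the norm can be absorbed. This is the source of the factor
      4.\<close>
    have half: "2 * kc_app \<phi> (g n) \<le> kc_inner K (g n) (g n) / 2 + 2 * B" for n
      using bound[OF kc_in_lin[OF g(1) kc_in_zero], of "1/2" n 0]
      by (simp add: kc_app_lin inner_lin_self power2_eq_square kc_inner_app[of _ _ kc_zero] kc_inner_app[of _ kc_zero])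
    have "kc_inner K (g n) (g n) \<le> J (g n) + (kc_inner K (g n) (g n) / 2 + 2 * B)" for n
      unfolding J_def using half[of n] by linarith
    then show "\<exists>N. \<forall>n\<ge>N. kc_inner K (g n) (g n) \<le> J (g n) + (kc_inner K (g n) (g n) / 2 + 2 * B)"
      by blast
  qed
  moreover have "Jm \<le> 0" using g(4)[OF kc_in_zero] by (simp add: J_def kc_inner_app)
  ultimately show "rkhs_sqnorm K S \<phi> \<le> 4 * B" by (simp add: L_def)
qed

text \<open>The hinge term is convex and the penalty has the quadratic gain of
  \<open>midpoint\<close>, so a minimizing sequence of combinations is Cauchy and its limit is
  optimal.\<close>

lemma regularized_minimizer_exists:
  fixes D :: "nat \<Rightarrow> 'a \<times> real"
  assumes lam: "0 < lam" and S: "\<And>i. i < m \<Longrightarrow> fst (D i) \<in> S"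
  defines "J \<equiv> \<lambda>f. (1 / real m) * (\<Sum>i<m. hinge (snd (D i) * f (fst (D i)))) + lam * rkhs_sqnorm K S f"
  shows "\<exists>f\<in>rkhs K S. \<forall>g\<in>rkhs K S. J f \<le> J g"
proof -
  define Jc where "Jc a = (1 / real m) * (\<Sum>i<m. hinge (snd (D i) * kc_eval K a (fst (D i)))) + lam * kc_inner K a a" for a
  have hinge0: "0 \<le> hinge u" for u by (simp add: hinge_def)
  have lower: "0 \<le> Jc a" for a
    unfolding Jc_def using lam inner_ge0[of a]
    by (intro add_nonneg_nonneg mult_nonneg_nonneg sum_nonneg hinge0) auto
  have mid: "Jc (kc_lin (1/2) a (1/2) b) \<le> (Jc a + Jc b) / 2 - lam / 4 * kc_dist K a b" for a b
  proof -
    define h where "h a i = hinge (snd (D i) * kc_eval K a (fst (D i)))" for a i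
    have "hinge (y * (u / 2 + v / 2)) \<le> (hinge (y * u) + hinge (y * v)) / 2" for y u v
      unfolding hinge_def by (simp add: algebra_simps max_def)
    then have "(\<Sum>i<m. h (kc_lin (1/2) a (1/2) b) i) \<le> (\<Sum>i<m. (h a i + h b i) / 2)"
      unfolding h_def by (intro sum_mono) (simp add: kc_eval_lin)
    also have "\<dots> = ((\<Sum>i<m. h a i) + (\<Sum>i<m. h b i)) / 2"
      by (simp add: sum.distrib sum_divide_distrib add_divide_distrib)
    finally have "(1 / real m) * (\<Sum>i<m. h (kc_lin (1/2) a (1/2) b) i) \<le>
        (1 / real m) * (((\<Sum>i<m. h a i) + (\<Sum>i<m. h b i)) / 2)"
      by (intro mult_left_mono) auto
    then show ?thesis unfolding Jc_def midpoint h_def by (simp add: add_divide_distrib algebra_simps)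
  qed
  \<comment> \<open>The data enter through finitely many evaluations at points of \<open>S\<close>,
    so pointwise convergence on \<open>S\<close> carries the objective to the limit.\<close>
  have lim: "(\<lambda>k. Jc (g k)) \<longlonglongrightarrow> J f" if ap: "rkhs_approx K S f g" for f g
    unfolding Jc_def J_def hinge_def
    by (intro tendsto_intros sqnorm_tendsto[OF ap]) (use ap S in \<open>auto simp: rkhs_approx_iff\<close>)
  have l4: "0 < lam / 4" using lam by simp
  obtain g Jm where g: "\<And>k. kc_in S (g k)" "kc_Cauchy g" "(\<lambda>k. Jc (g k)) \<longlonglongrightarrow> Jm"
      "\<And>a. kc_in S a \<Longrightarrow> Jm \<le> Jc a"
    using minimizing_sequence[of S 0 Jc "lam / 4"] lower l4 mid by blast
  show ?thesis
  proof (intro bexI[of _ "kc_limit S g"] ballI)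
    show "kc_limit S g \<in> rkhs K S" by (rule kc_limit_rkhs[OF g(1,2)])
    have 1: "J (kc_limit S g) = Jm"
      using LIMSEQ_unique[OF lim[OF kc_limit_approx[OF g(1,2)]] g(3)] .
    fix h assume "h \<in> rkhs K S"
    then obtain gh where gh: "rkhs_approx K S h gh" by (auto simp: rkhs_def)
    have "Jm \<le> J h"
      using LIMSEQ_le_const[OF lim[OF gh]] g(4) gh by (auto simp: rkhs_approx_iff)
    with 1 show "J (kc_limit S g) \<le> J h" by simp
  qed
qed

text \<open>A diagonal bounded by 1 turns closeness in norm into uniform closeness, so a net for
  combinations is also one for RKHS elements.\<close>

lemma rkhs_approx_uniform:
  assumes f: "f \<in> rkhs K S" and e: "0 < e" and K1: "\<And>x. K x x \<le> 1"
  obtains a where "kc_in S a" "kc_inner K a a \<le> rkhs_sqnorm K S f + 1"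
    "\<And>x. x \<in> S \<Longrightarrow> \<bar>f x - kc_eval K a x\<bar> \<le> e"
proof -
  obtain g where ap: "rkhs_approx K S f g" using f by (auto simp: rkhs_def)
  then have g: "\<And>k. kc_in S (g k)" "kc_Cauchy g" "\<And>x. x \<in> S \<Longrightarrow> (\<lambda>k. kc_eval K (g k) x) \<longlonglongrightarrow> f x"
    by (auto simp: rkhs_approx_iff)
  obtain N where N: "\<And>k l. k \<ge> N \<Longrightarrow> l \<ge> N \<Longrightarrow> sqrt (kc_dist K (g k) (g l)) < e"
    using kc_Cauchy_sqrt[OF g(2) e] by auto
  have "eventually (\<lambda>k. kc_inner K (g k) (g k) < rkhs_sqnorm K S f + 1) sequentially"
    using order_tendstoD(2)[OF sqnorm_tendsto[OF ap]] by simp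
  then obtain k where k: "k \<ge> N" "kc_inner K (g k) (g k) < rkhs_sqnorm K S f + 1"
    unfolding eventually_sequentially by (meson max.cobounded1 max.cobounded2)
  show ?thesis
  proof (rule that[of "g k"])
    fix x assume x: "x \<in> S"
    have 1: "(\<lambda>l. \<bar>kc_eval K (g l) x - kc_eval K (g k) x\<bar>) \<longlonglongrightarrow> \<bar>f x - kc_eval K (g k) x\<bar>"
      by (intro tendsto_intros g(3) x)
    show "\<bar>f x - kc_eval K (g k) x\<bar> \<le> e"
    proof (rule LIMSEQ_le_const2[OF 1], intro exI[of _ N] allI impI)
      fix l assume "N \<le> l"
      have "\<bar>kc_eval K (g l) x - kc_eval K (g k) x\<bar> \<le> sqrt (kc_dist K (g l) (g k)) * sqrt (K x x)"
        by (rule eval_diff_le)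
      also have "\<dots> \<le> sqrt (kc_dist K (g l) (g k)) * 1"
        using K1 kc_dist_ge0 by (intro mult_left_mono) auto
      also have "\<dots> \<le> e" using N[OF \<open>N \<le> l\<close> k(1)] by simp
      finally show "\<bar>kc_eval K (g l) x - kc_eval K (g k) x\<bar> \<le> e" .
    qed
  qed (use g k in auto)
qed

end

section \<open>Local power series of the Gaussian kernel\<close>

text \<open>Words over the coordinates replace multi-indices: a power of an inner product becomes a
  plain sum over words, without multinomial coefficients. The redundancy is harmless because the
  word length will be bounded independently of the sample size.\<close>

definition words :: "nat \<Rightarrow> 'd::finite list set" where
  "words k = {w. length w = k}"

definition words_less :: "nat \<Rightarrow> 'd::finite list set" where
  "words_less n = {w. length w < n}"

lemma finite_words: "finite (words k :: 'd::finite list set)"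
  using finite_lists_length_eq[of "UNIV :: 'd set" k] by (simp add: words_def)

lemma words_less_Union: "words_less n = (\<Union>k<n. words k)"
  by (auto simp: words_less_def words_def)

lemma finite_words_less: "finite (words_less n :: 'd::finite list set)"
  by (simp add: words_less_Union finite_words)

lemma sum_words_less: "(\<Sum>w\<in>words_less n. f w) = (\<Sum>k<n. \<Sum>w\<in>words k. f w)"
  unfolding words_less_Union by (rule sum.UNION_disjoint) (auto simp: finite_words, auto simp: words_def)

lemma words_Suc: "words (Suc k) = (\<lambda>(i, w). i # w) ` (UNIV \<times> words k)"
  by (auto simp: words_def image_iff length_Suc_conv)

lemma sum_power_words:
  fixes u v :: "'d::finite \<Rightarrow> real"
  shows "(\<Sum>i\<in>UNIV. u i * v i) ^ k = (\<Sum>w\<in>words k. prod_list (map u w) * prod_list (map v w))"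
proof (induction k)
  case 0
  have "words 0 = {[] :: 'd list}" by (auto simp: words_def)
  then show ?case by simp
next
  case (Suc k)
  have "(\<Sum>w\<in>words (Suc k). prod_list (map u w) * prod_list (map v w)) =
      (\<Sum>(i, w)\<in>UNIV \<times> words k. (u i * v i) * (prod_list (map u w) * prod_list (map v w)))"
    unfolding words_Suc
    by (subst sum.reindex) (auto simp: inj_on_def intro!: sum.cong)
  also have "\<dots> = (\<Sum>i\<in>UNIV. u i * v i) * (\<Sum>w\<in>words k. prod_list (map u w) * prod_list (map v w))"
    by (simp add: sum.cartesian_product[symmetric] sum_product)
  finally show ?case using Suc by simp
qed

text \<open>Features of the Gaussian kernel from the power series of
  \<open>exp (2 (x - p) \<bullet> (y - p) / \<sigma>\<^sup>2)\<close>; re-centring at \<open>p\<close> makes the series converge fast near \<open>p\<close>.\<close>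

definition gfeat :: "real \<Rightarrow> real^'d \<Rightarrow> 'd list \<Rightarrow> real^'d \<Rightarrow> real" where
  "gfeat \<sigma> p w x = exp (- (norm (x - p))\<^sup>2 / \<sigma>\<^sup>2) * sqrt ((2 / \<sigma>\<^sup>2) ^ length w / fact (length w))
     * prod_list (map (\<lambda>i. (x - p) $ i) w)"

definition gterm :: "real \<Rightarrow> real^'d \<Rightarrow> nat \<Rightarrow> real^'d \<Rightarrow> real^'d \<Rightarrow> real" where
  "gterm \<sigma> p k x y = exp (- (norm (x - p))\<^sup>2 / \<sigma>\<^sup>2) * exp (- (norm (y - p))\<^sup>2 / \<sigma>\<^sup>2)
     * ((2 / \<sigma>\<^sup>2 * ((x - p) \<bullet> (y - p))) ^ k / fact k)"

definition grest :: "real \<Rightarrow> real^'d \<Rightarrow> nat \<Rightarrow> real^'d \<Rightarrow> real^'d \<Rightarrow> real" where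
  "grest \<sigma> p n x y = gauss_kernel \<sigma> x y - (\<Sum>k<n. gterm \<sigma> p k x y)"

lemma gterm_words:
  fixes p x y :: "real^'d"
  shows "gterm \<sigma> p k x y = (\<Sum>w\<in>words k. gfeat \<sigma> p w x * gfeat \<sigma> p w y)"
proof -
  define e where "e x = exp (- (norm (x - p))\<^sup>2 / \<sigma>\<^sup>2)" for x
  define c where "c = (2 / \<sigma>\<^sup>2) ^ k / fact k"
  have c0: "0 \<le> c" by (simp add: c_def)
  have "gfeat \<sigma> p w x * gfeat \<sigma> p w y = (e x * e y * c) *
      (prod_list (map (\<lambda>i. (x - p) $ i) w) * prod_list (map (\<lambda>i. (y - p) $ i) w))" if "w \<in> words k" for w
  proof -
    have "length w = k" using that by (simp add: words_def)
    then have "gfeat \<sigma> p w x * gfeat \<sigma> p w y = e x * e y * (sqrt c * sqrt c) *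
      (prod_list (map (\<lambda>i. (x - p) $ i) w) * prod_list (map (\<lambda>i. (y - p) $ i) w))"
      unfolding gfeat_def e_def c_def by (simp only: mult_ac)
    then show ?thesis using c0 by simp
  qed
  then have "(\<Sum>w\<in>words k. gfeat \<sigma> p w x * gfeat \<sigma> p w y) = (e x * e y * c) * ((x - p) \<bullet> (y - p)) ^ k"
    by (simp add: sum_power_words inner_vec_def sum_distrib_left)
  then show ?thesis by (simp only: gterm_def e_def c_def power_mult_distrib) simp
qed

lemma gauss_kernel_factor:
  "gauss_kernel \<sigma> x y = exp (- (norm (x - p))\<^sup>2 / \<sigma>\<^sup>2) * exp (- (norm (y - p))\<^sup>2 / \<sigma>\<^sup>2)
     * exp (2 / \<sigma>\<^sup>2 * ((x - p) \<bullet> (y - p)))"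
proof -
  have "(norm (x - y))\<^sup>2 = (norm ((x - p) - (y - p)))\<^sup>2" by simp
  also have "\<dots> = (norm (x - p))\<^sup>2 + (norm (y - p))\<^sup>2 - 2 * ((x - p) \<bullet> (y - p))"
    by (simp only: power2_norm_eq_inner inner_diff_left inner_diff_right inner_commute) simp
  finally show ?thesis
    unfolding gauss_kernel_def exp_add[symmetric]
    by (simp add: add_divide_distrib diff_divide_distrib)
qed

lemma gterm_sums: "(\<lambda>k. gterm \<sigma> p k x y) sums gauss_kernel \<sigma> x y"
  unfolding gauss_kernel_factor[of \<sigma> x y p] gterm_def
  using exp_converges[of "2 / \<sigma>\<^sup>2 * ((x - p) \<bullet> (y - p))"]
  by (intro sums_mult) (simp add: scaleR_conv_of_real divide_inverse mult.commute)

lemma grest_sums: "(\<lambda>k. gterm \<sigma> p (k + n) x y) sums grest \<sigma> p n x y"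
  unfolding grest_def using gterm_sums by (rule sums_split_initial_segment)

lemma inner_gterm: "kc_inner (gterm \<sigma> p k) a a = (\<Sum>w\<in>words k. (kc_app (gfeat \<sigma> p w) a)\<^sup>2)"
proof -
  have "gterm \<sigma> p k = (\<lambda>x y. \<Sum>w\<in>words k. gfeat \<sigma> p w x * gfeat \<sigma> p w y)"
    by (simp add: gterm_words fun_eq_iff)
  then show ?thesis
    by (simp add: kc_inner_app kc_app_sum kc_app_cmult kc_app_multc power2_eq_square)
qed

text \<open>Every term of the tail is a sum of squares of features. Hence the remainder is a psd
  kernel with a Cauchy-Schwarz inequality of its own; the case \<open>n = 0\<close> is the Gaussian
  kernel itself.\<close>

lemma inner_grest_ge0: "0 \<le> kc_inner (grest \<sigma> p n) a a"
proof (rule sums_le[of "\<lambda>_. 0" _ 0])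
  show "(\<lambda>k. kc_inner (gterm \<sigma> p (k + n)) a a) sums kc_inner (grest \<sigma> p n) a a"
    unfolding kc_inner_def by (intro sums_sum sums_mult grest_sums)
qed (auto simp: inner_gterm intro: sum_nonneg)

lemma gauss_kernel_sym: "gauss_kernel \<sigma> x y = gauss_kernel \<sigma> y x"
  by (simp add: gauss_kernel_def norm_minus_commute)

lemma psd_grest: "psd_kernel (grest \<sigma> p n)"
  by (auto simp: psd_kernel_def inner_grest_ge0 grest_def gterm_def gauss_kernel_sym inner_commute mult_ac
      split_paired_all)

lemma psd_gauss: "psd_kernel (gauss_kernel \<sigma> :: real^'d \<Rightarrow> real^'d \<Rightarrow> real)"
proof -
  have "grest \<sigma> 0 0 = (gauss_kernel \<sigma> :: real^'d \<Rightarrow> real^'d \<Rightarrow> real)"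
    by (simp add: grest_def fun_eq_iff)
  then show ?thesis using psd_grest[of \<sigma> "0 :: real^'d" 0] by simp
qed

interpretation gauss: psd "gauss_kernel \<sigma>" for \<sigma> :: real
  by unfold_locales (rule psd_gauss)

lemma inner_gauss_split:
  "kc_inner (gauss_kernel \<sigma>) a a = (\<Sum>w\<in>words_less n. (kc_app (gfeat \<sigma> p w) a)\<^sup>2) + kc_inner (grest \<sigma> p n) a a"
proof -
  have "gauss_kernel \<sigma> = (\<lambda>x y. (\<Sum>k<n. gterm \<sigma> p k x y) + grest \<sigma> p n x y)"
    by (simp add: grest_def fun_eq_iff)
  then have "kc_inner (gauss_kernel \<sigma>) a a = kc_inner (\<lambda>x y. (\<Sum>k<n. gterm \<sigma> p k x y) + grest \<sigma> p n x y) a a"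
    by simp
  also have "\<dots> = (\<Sum>k<n. kc_inner (gterm \<sigma> p k) a a) + kc_inner (grest \<sigma> p n) a a"
    by (simp add: kc_inner_app kc_app_add kc_app_sum)
  finally show ?thesis by (simp add: inner_gterm sum_words_less)
qed

lemma eval_gauss_split:
  "kc_eval (gauss_kernel \<sigma>) a x =
     (\<Sum>w\<in>words_less n. gfeat \<sigma> p w x * kc_app (gfeat \<sigma> p w) a) + kc_eval (grest \<sigma> p n) a x"
proof -
  have "gauss_kernel \<sigma> = (\<lambda>x y. (\<Sum>k<n. gterm \<sigma> p k x y) + grest \<sigma> p n x y)"
    by (simp add: grest_def fun_eq_iff)
  then have "kc_eval (gauss_kernel \<sigma>) a x = kc_eval (\<lambda>x y. (\<Sum>k<n. gterm \<sigma> p k x y) + grest \<sigma> p n x y) a x"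
    by simp
  also have "\<dots> = (\<Sum>k<n. kc_eval (gterm \<sigma> p k) a x) + kc_eval (grest \<sigma> p n) a x"
    by (simp add: kc_eval_app kc_app_add kc_app_sum)
  finally show ?thesis
    by (simp add: kc_eval_app gterm_words kc_app_sum kc_app_multc sum_words_less mult.commute[of "kc_app _ _"])
qed

text \<open>A Bessel inequality: by \<open>inner_gauss_split\<close> the squared norm is the sum of
  squared feature coefficients plus a nonnegative remainder. Applied to a single point, it bounds
  the features themselves.\<close>

lemma gfeat_app_le: "\<bar>kc_app (gfeat \<sigma> p w) a\<bar> \<le> sqrt (kc_inner (gauss_kernel \<sigma>) a a)"
proof -
  let ?n = "Suc (length w)"
  have "(kc_app (gfeat \<sigma> p w) a)\<^sup>2 \<le> (\<Sum>w\<in>words_less ?n. (kc_app (gfeat \<sigma> p w) a)\<^sup>2)"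
    by (rule member_le_sum) (auto simp: finite_words_less, auto simp: words_less_def)
  also have "\<dots> \<le> kc_inner (gauss_kernel \<sigma>) a a"
    using inner_gauss_split[of \<sigma> a p ?n] inner_grest_ge0[of \<sigma> p ?n a] by linarith
  finally show ?thesis using real_sqrt_le_mono by fastforce
qed

lemma gauss_kernel_self [simp]: "gauss_kernel \<sigma> x x = 1"
  by (simp add: gauss_kernel_def)

lemma gfeat_le_1: "\<bar>gfeat \<sigma> p w x\<bar> \<le> 1"
  using gfeat_app_le[of \<sigma> p w "kc_single x"] by (simp add: gauss.inner_single_single)

text \<open>On the diagonal the remainder is \<open>exp (- z)\<close> times the Taylor remainder of
  \<open>exp z\<close>, so the exponentials cancel. Dropping the factorial leaves a geometric rate,
  which suffices close to \<open>p\<close>.\<close>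

lemma grest_diag_le:
  assumes "0 < \<sigma>"
  shows "grest \<sigma> p n x x \<le> ((sqrt 2 * norm (x - p) / \<sigma>) ^ n)\<^sup>2"
proof -
  define z where "z = 2 / \<sigma>\<^sup>2 * ((x - p) \<bullet> (x - p))"
  have z0: "0 \<le> z" by (simp add: z_def)
  have e: "exp (- (norm (x - p))\<^sup>2 / \<sigma>\<^sup>2) * exp (- (norm (x - p))\<^sup>2 / \<sigma>\<^sup>2) = exp (- z)"
    by (simp add: exp_add[symmetric] z_def power2_norm_eq_inner)
  have "grest \<sigma> p n x x = exp (- z) * (exp z - (\<Sum>k<n. z ^ k / fact k))"
    unfolding grest_def gauss_kernel_factor[of \<sigma> x x p] gterm_def e
    by (simp add: z_def sum_distrib_left right_diff_distrib)
  moreover obtain t where t: "\<bar>t\<bar> \<le> \<bar>z\<bar>" "exp z = (\<Sum>k<n. z ^ k / fact k) + exp t / fact n * z ^ n"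
    using Maclaurin_exp_le[of z n] by blast
  ultimately have "grest \<sigma> p n x x = exp (- z) * (exp t / fact n * z ^ n)"
    by simp
  also have "\<dots> \<le> exp (- z) * (exp z * z ^ n)"
  proof (intro mult_left_mono mult_right_mono)
    have "exp t / fact n \<le> exp t" by (simp add: field_simps)
    also have "\<dots> \<le> exp z" using t(1) z0 by simp
    finally show "exp t / fact n \<le> exp z" .
  qed (use z0 in auto)
  also have "\<dots> = z ^ n" by (simp add: exp_minus)
  also have "z = (sqrt 2 * norm (x - p) / \<sigma>)\<^sup>2"
    by (simp add: z_def power_divide power_mult_distrib power2_norm_eq_inner)
  finally show ?thesis by (simp add: power_mult[symmetric] mult.commute)
qed

text \<open>Cauchy-Schwarz for the remainder kernel, whose norm is at most the Gaussian one and
  whose diagonal is small near \<open>p\<close>.\<close>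

lemma gauss_local_expansion:
  assumes "0 < \<sigma>"
  shows "\<bar>kc_eval (gauss_kernel \<sigma>) a x - (\<Sum>w\<in>words_less n. gfeat \<sigma> p w x * kc_app (gfeat \<sigma> p w) a)\<bar>
      \<le> sqrt (kc_inner (gauss_kernel \<sigma>) a a) * (sqrt 2 * norm (x - p) / \<sigma>) ^ n"
proof -
  interpret R: psd "grest \<sigma> p n" by unfold_locales (rule psd_grest)
  have "\<bar>kc_eval (grest \<sigma> p n) a x\<bar> \<le> sqrt (kc_inner (grest \<sigma> p n) a a) * sqrt (grest \<sigma> p n x x)"
    using R.cauchy_schwarz_abs[of a "kc_single x"] by (simp add: R.inner_single R.eval_single)
  also have "\<dots> \<le> sqrt (kc_inner (gauss_kernel \<sigma>) a a) * (sqrt 2 * norm (x - p) / \<sigma>) ^ n"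
  proof (rule mult_mono)
    have "0 \<le> (\<Sum>w\<in>words_less n. (kc_app (gfeat \<sigma> p w) a)\<^sup>2)" by (intro sum_nonneg) simp
    then show "sqrt (kc_inner (grest \<sigma> p n) a a) \<le> sqrt (kc_inner (gauss_kernel \<sigma>) a a)"
      using inner_gauss_split[of \<sigma> a p n] by simp
    show "sqrt (grest \<sigma> p n x x) \<le> (sqrt 2 * norm (x - p) / \<sigma>) ^ n"
      using grest_diag_le[OF assms, of p n x] assms by (intro real_le_lsqrt) auto
    show "0 \<le> sqrt (grest \<sigma> p n x x)"
      using R.inner_ge0[of "kc_single x"] by (simp add: R.inner_single_single)
  qed (simp add: gauss.inner_ge0)
  finally show ?thesis by (simp add: eval_gauss_split[of \<sigma> a x p n])
qed

section \<open>Grids in the unit cube and finite nets of kernel combinations\<close>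

lemma unit_cube_iff:
  fixes x :: "real^'d"
  shows "x \<in> unit_cube \<longleftrightarrow> (\<forall>i. 0 \<le> x $ i \<and> x $ i \<le> 1)"
proof -
  have "(One :: real^'d) $ i = 1" for i
    by (rule trans[OF cart_eq_inner_axis]) simp
  then show ?thesis by (auto simp: unit_cube_def mem_box_cart)
qed

definition cube_grid :: "nat \<Rightarrow> (real^'d) set" where
  "cube_grid N = (\<lambda>f. \<chi> i. real (f i) / real N) ` (PiE UNIV (\<lambda>_. {..N}))"

lemma finite_cube_grid: "finite (cube_grid N :: (real^'d) set)"
  unfolding cube_grid_def by (intro finite_imageI finite_PiE) auto

lemma card_cube_grid: "card (cube_grid N :: (real^'d) set) \<le> (N + 1) ^ CARD('d)"
proof -
  have "card (cube_grid N :: (real^'d) set) \<le> card (PiE (UNIV :: 'd set) (\<lambda>_. {..N}))"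
    unfolding cube_grid_def by (intro card_image_le finite_PiE) auto
  then show ?thesis by (simp add: card_PiE)
qed

lemma cube_grid_dense:
  fixes x :: "real^'d"
  assumes "x \<in> unit_cube" "0 < N"
  obtains p where "p \<in> cube_grid N" "norm (x - p) \<le> real CARD('d) / real N"
proof -
  define f where "f i = nat \<lfloor>real N * x $ i\<rfloor>" for i
  define p :: "real^'d" where "p = (\<chi> i. real (f i) / real N)"
  have x: "0 \<le> x $ i" "x $ i \<le> 1" for i using assms by (auto simp: unit_cube_iff)
  have f: "f i \<le> N" "real (f i) \<le> real N * x $ i" "real N * x $ i \<le> real (f i) + 1" for i
  proof -
    have 0: "0 \<le> real N * x $ i" using x by simp
    have "real N * x $ i \<le> real N" using x[of i] by (simp add: mult_left_le)
    then have "\<lfloor>real N * x $ i\<rfloor> \<le> int N" by linarith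
    then show "f i \<le> N" by (simp add: f_def)
    show "real (f i) \<le> real N * x $ i" "real N * x $ i \<le> real (f i) + 1"
      using 0 unfolding f_def by linarith+
  qed
  have "p \<in> cube_grid N" unfolding p_def cube_grid_def using f by (intro imageI) auto
  moreover have "norm (x - p) \<le> real CARD('d) / real N"
  proof -
    have "norm (x - p) \<le> (\<Sum>i\<in>UNIV. \<bar>(x - p) $ i\<bar>)" by (rule norm_le_l1_cart)
    also have "\<dots> \<le> (\<Sum>i\<in>(UNIV::'d set). 1 / real N)"
    proof (rule sum_mono)
      fix i
      have "(x - p) $ i = (real N * x $ i - real (f i)) / real N"
        using assms by (simp add: p_def field_simps)
      then show "\<bar>(x - p) $ i\<bar> \<le> 1 / real N" using f[of i] assms by (simp add: divide_right_mono)
    qed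
    finally show ?thesis by simp
  qed
  ultimately show ?thesis by (rule that)
qed

text \<open>A combination of norm at most \<open>B\<close> is coded by its feature coefficients at
  all grid points at once, rounded down to multiples of \<open>s\<close>. Equal codes give close
  functions at every \<open>x\<close>, by expanding around a grid point near \<open>x\<close>: each
  of the \<open>M\<close> features costs at most \<open>s\<close>, each of the two remainders at
  most \<open>B\<close> times the power.\<close>

lemma gauss_combination_net:
  fixes \<sigma> B s :: real and N n :: nat
  assumes \<sigma>: "0 < \<sigma>" and N: "0 < N" and B: "0 \<le> B" and s: "0 < s"
  defines "K \<equiv> gauss_kernel \<sigma> :: real^'d \<Rightarrow> real^'d \<Rightarrow> real"
  defines "M \<equiv> card (words_less n :: 'd list set)"
  obtains A where "finite A" "real (card A) \<le> (2 * (B / s) + 3) ^ ((N + 1) ^ CARD('d) * M)"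
    "\<And>a. a \<in> A \<Longrightarrow> kc_inner K a a \<le> B\<^sup>2"
    "\<And>a. kc_inner K a a \<le> B\<^sup>2 \<Longrightarrow> \<exists>b\<in>A. \<forall>x\<in>unit_cube.
        \<bar>kc_eval K a x - kc_eval K b x\<bar> \<le> s * M + 2 * B * (sqrt 2 * real CARD('d) / (real N * \<sigma>)) ^ n"
proof -
  define I :: "((real^'d) \<times> 'd list) set" where "I = cube_grid N \<times> words_less n"
  define L where "L = \<lceil>B / s\<rceil>"
  define ball where "ball = {a. kc_inner K a a \<le> B\<^sup>2}"
  define code where "code a = restrict (\<lambda>(p, w). \<lfloor>kc_app (gfeat \<sigma> p w) a / s\<rfloor>) I" for a
  \<comment> \<open>One representative for each code that occurs, taken inside the ball so that its
    own remainder obeys the same bound.\<close>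
  define A where "A = (\<lambda>c. SOME a. a \<in> ball \<and> code a = c) ` code ` ball"
  have finI: "finite I" by (simp add: I_def finite_cube_grid finite_words_less)
  have cardI: "card I \<le> (N + 1) ^ CARD('d) * M"
    unfolding I_def M_def card_cartesian_product by (intro mult_right_mono card_cube_grid) simp
  have app: "\<bar>kc_app (gfeat \<sigma> p w) a\<bar> \<le> B" if "a \<in> ball" for a p w
  proof -
    have "sqrt (kc_inner K a a) \<le> B" using that B by (simp add: ball_def real_le_lsqrt gauss.inner_ge0 K_def)
    then show ?thesis using gfeat_app_le[of \<sigma> p w a] by (simp add: K_def)
  qed
  have "0 \<le> B / s" using B s by simp
  then have L0: "0 \<le> L" unfolding L_def by linarith
  have code_in: "code ` ball \<subseteq> PiE I (\<lambda>_. {- L..L})"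
  proof
    fix c assume "c \<in> code ` ball"
    then obtain a where a: "a \<in> ball" "c = code a" by auto
    have "\<lfloor>kc_app (gfeat \<sigma> p w) a / s\<rfloor> \<in> {- L..L}" for p w
    proof -
      define v where "v = kc_app (gfeat \<sigma> p w) a / s"
      have v: "\<bar>v\<bar> \<le> B / s" using app[OF a(1), of p w] s by (simp add: v_def abs_divide divide_right_mono)
      then have "- real_of_int L \<le> v" "v \<le> real_of_int L" unfolding L_def by linarith+
      then show ?thesis unfolding v_def[symmetric] by (auto simp: le_floor_iff floor_le_iff)
    qed
    then show "c \<in> PiE I (\<lambda>_. {- L..L})" by (auto simp: a(2) code_def restrict_def PiE_def extensional_def)
  qed
  have finP: "finite (PiE I (\<lambda>_. {- L..L}))" by (intro finite_PiE finI) auto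
  have fin: "finite (code ` ball)" by (rule finite_subset[OF code_in finP])
  have "card A \<le> card (code ` ball)" unfolding A_def by (rule card_image_le[OF fin])
  also have "\<dots> \<le> card (PiE I (\<lambda>_. {- L..L}))" by (rule card_mono[OF finP code_in])
  also have "\<dots> = nat (2 * L + 1) ^ card I" using finI L0 by (simp add: card_PiE)
  finally have "real (card A) \<le> real (nat (2 * L + 1) ^ card I)" by (rule of_nat_mono)
  also have "\<dots> = (2 * real_of_int L + 1) ^ card I" using L0 by simp
  also have "\<dots> \<le> (2 * (B / s) + 3) ^ card I"
  proof (rule power_mono)
    show "2 * real_of_int L + 1 \<le> 2 * (B / s) + 3" unfolding L_def by linarith
  qed (use L0 in simp)
  also have "\<dots> \<le> (2 * (B / s) + 3) ^ ((N + 1) ^ CARD('d) * M)"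
    using B s cardI by (intro power_increasing) auto
  finally have card: "real (card A) \<le> (2 * (B / s) + 3) ^ ((N + 1) ^ CARD('d) * M)" .
  have repr: "(SOME b. b \<in> ball \<and> code b = code a) \<in> ball"
      "code (SOME b. b \<in> ball \<and> code b = code a) = code a" if "a \<in> ball" for a
    using someI[of "\<lambda>b. b \<in> ball \<and> code b = code a" a] that by auto
  show ?thesis
  proof (rule that[of A])
    show "finite A" unfolding A_def using fin by simp
    show "kc_inner K a a \<le> B\<^sup>2" if "a \<in> A" for a
      using that repr(1) by (auto simp: A_def ball_def)
    fix a assume "kc_inner K a a \<le> B\<^sup>2"
    then have a: "a \<in> ball" by (simp add: ball_def)
    define b where "b = (SOME b. b \<in> ball \<and> code b = code a)"
    have b: "b \<in> ball" "code b = code a" using repr[OF a] by (auto simp: b_def)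
    have "b \<in> A" unfolding A_def b_def using a by blast
    moreover have "\<bar>kc_eval K a x - kc_eval K b x\<bar> \<le> s * M + 2 * B * (sqrt 2 * real CARD('d) / (real N * \<sigma>)) ^ n"
      if x: "x \<in> unit_cube" for x
    proof -
      obtain p where p: "p \<in> cube_grid N" "norm (x - p) \<le> real CARD('d) / real N"
        using cube_grid_dense[OF x N] .
      define T where "T a = (\<Sum>w\<in>words_less n. gfeat \<sigma> p w x * kc_app (gfeat \<sigma> p w) a)" for a
      have rest: "\<bar>kc_eval K a x - T a\<bar> \<le> B * (sqrt 2 * real CARD('d) / (real N * \<sigma>)) ^ n"
        if "a \<in> ball" for a
      proof -
        have "\<bar>kc_eval K a x - T a\<bar> \<le> sqrt (kc_inner K a a) * (sqrt 2 * norm (x - p) / \<sigma>) ^ n"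
          unfolding T_def K_def by (rule gauss_local_expansion[OF \<sigma>])
        also have "\<dots> \<le> B * (sqrt 2 * real CARD('d) / (real N * \<sigma>)) ^ n"
        proof (intro mult_mono power_mono)
          show "sqrt (kc_inner K a a) \<le> B"
            using that B by (simp add: ball_def real_le_lsqrt gauss.inner_ge0 K_def)
          have "sqrt 2 * norm (x - p) / \<sigma> \<le> sqrt 2 * (real CARD('d) / real N) / \<sigma>"
            using p \<sigma> by (intro divide_right_mono mult_left_mono) auto
          then show "sqrt 2 * norm (x - p) / \<sigma> \<le> sqrt 2 * real CARD('d) / (real N * \<sigma>)" by simp
        qed (use \<sigma> B in auto)
        finally show ?thesis .
      qed
      have "\<bar>T a - T b\<bar> \<le> (\<Sum>w\<in>words_less n. \<bar>gfeat \<sigma> p w x * kc_app (gfeat \<sigma> p w) a - gfeat \<sigma> p w x * kc_app (gfeat \<sigma> p w) b\<bar>)"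
        unfolding T_def sum_subtractf[symmetric] by (rule sum_abs)
      also have "\<dots> \<le> (\<Sum>w\<in>(words_less n :: 'd list set). s)"
      proof (rule sum_mono)
        fix w :: "'d list" assume w: "w \<in> words_less n"
        define u where "u = kc_app (gfeat \<sigma> p w) a / s"
        define v where "v = kc_app (gfeat \<sigma> p w) b / s"
        have "code a (p, w) = code b (p, w)" using b by simp
        then have "\<lfloor>u\<rfloor> = \<lfloor>v\<rfloor>" using p w by (simp add: code_def I_def u_def v_def)
        then have "\<bar>u - v\<bar> \<le> 1" by linarith
        have "\<bar>gfeat \<sigma> p w x * kc_app (gfeat \<sigma> p w) a - gfeat \<sigma> p w x * kc_app (gfeat \<sigma> p w) b\<bar> =
            \<bar>gfeat \<sigma> p w x\<bar> * (s * \<bar>u - v\<bar>)"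
          using s by (simp add: u_def v_def right_diff_distrib[symmetric] abs_mult diff_divide_distrib[symmetric] abs_divide)
        also have "\<dots> \<le> 1 * (s * 1)"
          using gfeat_le_1[of \<sigma> p w x] s \<open>\<bar>u - v\<bar> \<le> 1\<close> by (intro mult_mono) auto
        finally show "\<bar>gfeat \<sigma> p w x * kc_app (gfeat \<sigma> p w) a - gfeat \<sigma> p w x * kc_app (gfeat \<sigma> p w) b\<bar> \<le> s" by simp
      qed
      finally have "\<bar>T a - T b\<bar> \<le> s * M" by (simp add: M_def mult.commute)
      then show ?thesis using rest[OF a] rest[OF b(1)] by linarith
    qed
    ultimately show "\<exists>b\<in>A. \<forall>x\<in>unit_cube.
        \<bar>kc_eval K a x - kc_eval K b x\<bar> \<le> s * M + 2 * B * (sqrt 2 * real CARD('d) / (real N * \<sigma>)) ^ n"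
      by blast
  qed (rule card)
qed

section \<open>Metric entropy of balls in the Gaussian RKHS\<close>

lemma card_words_less_pos: "0 < n \<Longrightarrow> 0 < card (words_less n :: 'd::finite list set)"
proof -
  assume "0 < n"
  then have "[] \<in> (words_less n :: 'd list set)" by (simp add: words_less_def)
  then show ?thesis using finite_words_less by (metis card_gt_0_iff empty_iff)
qed

text \<open>The factor \<open>m powr \<kappa>\<close> pays for the refined grid and for the
  logarithm of the number of rounding levels. The summand 1 inside \<open>ln\<close> reserves room
  for one more event in the later union bound. The radius \<open>6 / m\<close> is 1 for
  approximation by a combination, 1 for rounding and 4 for the remainders, each over
  \<open>m\<close>.\<close>

lemma gauss_ball_net:
  fixes \<kappa> :: real
  assumes \<kappa>: "0 < \<kappa>"
  shows "\<exists>C\<ge>0. \<forall>(m::nat) \<sigma>. 1 \<le> m \<and> 0 < \<sigma> \<and> \<sigma> \<le> 1 \<longrightarrow>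
    (\<exists>A :: (real^'d) kcomb set. finite A \<and> ln (real (card A) + 1) \<le> C * (1 / \<sigma>) ^ CARD('d) * real m powr \<kappa> \<and>
      (\<forall>f\<in>H_gauss \<sigma>. gauss_sqnorm \<sigma> f \<le> real m \<longrightarrow>
         (\<exists>a\<in>A. \<forall>x\<in>unit_cube. \<bar>f x - kc_eval (gauss_kernel \<sigma>) a x\<bar> \<le> 6 / real m)))"
proof -
  define d where "d = CARD('d)"
  have d1: "1 \<le> d" unfolding d_def by (metis One_nat_def Suc_leI zero_less_card_finite)
  \<comment> \<open>The power \<open>m powr k\<close> will occur \<open>d + 1\<close> times: once
    per coordinate of the grid and once for a logarithm.\<close>
  define k where "k = \<kappa> / (real d + 1)"
  have k: "0 < k" using \<kappa> by (simp add: k_def)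
  \<comment> \<open>\<open>k * n \<ge> 2\<close> turns the remainder, of size \<open>4 * m\<close>
    times \<open>m powr (- k * n)\<close>, into \<open>4 / m\<close>.\<close>
  define n where "n = nat \<lceil>2 / k\<rceil>"
  have n2: "2 \<le> k * real n"
  proof -
    have "2 / k \<le> real n" unfolding n_def by linarith
    then show ?thesis using k by (simp add: field_simps)
  qed
  then have n0: "0 < n" by (cases n) auto
  define M where "M = card (words_less n :: 'd list set)"
  have M: "1 \<le> real M" using card_words_less_pos[OF n0, where ?'d='d] by (simp add: M_def)
  define C where "C = 2 * (2 * real d + 2) ^ d * real M * (ln (7 * real M) + 2 / k)"
  have lnM: "0 \<le> ln (7 * real M)" using M by simp
  have C0: "0 \<le> C" unfolding C_def using lnM k by (intro mult_nonneg_nonneg) auto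
  show ?thesis
  proof (intro exI[of _ C] conjI allI impI C0)
    fix m :: nat and \<sigma> :: real
    assume "1 \<le> m \<and> 0 < \<sigma> \<and> \<sigma> \<le> 1"
    then have m: "1 \<le> real m" and \<sigma>: "0 < \<sigma>" "\<sigma> \<le> 1" by auto
    have m0: "0 < real m" using m by simp
    define q where "q = real m powr k"
    have q1: "1 \<le> q" unfolding q_def using m k by (simp add: ge_one_powr_ge_zero)
    \<comment> \<open>The additional factor \<open>q\<close> in the grid density brings the ratio of
      the local expansion down to \<open>1 / q\<close>, so that a number of terms independent of
      \<open>m\<close> is enough.\<close>
    define N where "N = nat \<lceil>sqrt 2 * real d / \<sigma> * q\<rceil>"
    have sd: "0 < sqrt 2 * real d / \<sigma> * q" using d1 \<sigma> q1 by simp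
    have N1: "sqrt 2 * real d / \<sigma> * q \<le> real N" unfolding N_def by linarith
    have N2: "real N \<le> sqrt 2 * real d / \<sigma> * q + 1" unfolding N_def using sd by linarith
    have N0: "0 < N" using sd N1 by (cases N) auto
    have NS: "real (N + 1) \<le> (2 * real d + 2) * (1 / \<sigma> * q)"
    proof -
      have "1 \<le> 1 / \<sigma> * q" using \<sigma> q1 mult_mono[of 1 "1/\<sigma>" 1 q] by simp
      moreover have "sqrt 2 * real d / \<sigma> * q \<le> 2 * real d * (1 / \<sigma> * q)"
        using sqrt2_less_2 \<sigma> q1 by (simp add: mult_right_mono divide_right_mono)
      ultimately show ?thesis using N2 by (simp add: distrib_right add_divide_distrib)
    qed
    have ratio: "sqrt 2 * real d / (real N * \<sigma>) \<le> real m powr (- k)"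
    proof -
      have "sqrt 2 * real d / (real N * \<sigma>) \<le> 1 / q"
        using N1 N0 \<sigma> q1 by (simp add: field_simps)
      then show ?thesis by (simp add: q_def powr_minus inverse_eq_divide)
    qed
    have rem: "2 * (2 * real m) * (sqrt 2 * real d / (real N * \<sigma>)) ^ n \<le> 4 / real m"
    proof -
      have "(sqrt 2 * real d / (real N * \<sigma>)) ^ n \<le> (real m powr (- k)) ^ n"
        using ratio \<sigma> by (intro power_mono) auto
      also have "\<dots> = real m powr (- (k * real n))"
        using m0 by (simp add: powr_realpow[symmetric] powr_powr)
      also have "\<dots> \<le> real m powr (-2)" using m n2 by (intro powr_mono) auto
      also have "\<dots> = 1 / (real m)\<^sup>2" using m0 by (simp add: powr_minus inverse_eq_divide)
      finally have "2 * (2 * real m) * (sqrt 2 * real d / (real N * \<sigma>)) ^ n \<le> 2 * (2 * real m) * (1 / (real m)\<^sup>2)"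
        using m0 by (intro mult_left_mono) auto
      also have "\<dots> = 4 / real m" using m0 by (simp add: power2_eq_square)
      finally show ?thesis .
    qed
    \<comment> \<open>Makes the total rounding error \<open>s * M\<close> equal to
      \<open>1 / m\<close>.\<close>
    define s where "s = 1 / (real m * real M)"
    have s0: "0 < s" unfolding s_def using m M by simp
    let ?K = "gauss_kernel \<sigma> :: real^'d \<Rightarrow> real^'d \<Rightarrow> real"
    obtain A where A: "finite A" "real (card A) \<le> (2 * (2 * real m / s) + 3) ^ ((N + 1) ^ CARD('d) * M)"
      "\<And>a. kc_inner ?K a a \<le> (2 * real m)\<^sup>2 \<Longrightarrow> \<exists>b\<in>A. \<forall>x\<in>unit_cube.
          \<bar>kc_eval ?K a x - kc_eval ?K b x\<bar> \<le> s * M + 2 * (2 * real m) * (sqrt 2 * real CARD('d) / (real N * \<sigma>)) ^ n"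
      using gauss_combination_net[OF \<sigma>(1) N0 _ s0, of "2 * real m" n, where ?'d='d] m0
      unfolding M_def by (metis less_eq_real_def mult_nonneg_nonneg zero_le_numeral)
    define X where "X = 2 * (2 * real m / s) + 3"
    define E where "E = (N + 1) ^ d * M"
    have X3: "3 \<le> X" unfolding X_def using m0 s0 by simp
    have XM: "X \<le> 7 * real M * (real m)\<^sup>2"
    proof -
      have "X = 4 * real M * (real m)\<^sup>2 + 3" by (simp add: X_def s_def power2_eq_square)
      also have "3 \<le> 3 * (real M * (real m)\<^sup>2)"
        using M m mult_mono[of 1 "real M" 1 "(real m)\<^sup>2"] by simp
      finally show ?thesis by simp
    qed
    have E1: "1 \<le> E" unfolding E_def using M by simp
    have "real (card A) + 1 \<le> X ^ E + X ^ E"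
      using A(2) X3 by (intro add_mono) (auto simp: X_def E_def d_def)
    also have "\<dots> \<le> X ^ E * X ^ E"
    proof -
      have "2 \<le> X ^ E" using X3 E1 self_le_power[of X E] by simp
      then show ?thesis using mult_right_mono[of 2 "X ^ E" "X ^ E"] by simp
    qed
    finally have "ln (real (card A) + 1) \<le> ln (X ^ E * X ^ E)" by simp
    also have "\<dots> = 2 * real E * ln X" using X3 by (simp add: ln_mult ln_realpow)
    also have "\<dots> \<le> 2 * real E * ((ln (7 * real M) + 2 / k) * q)"
    proof (rule mult_left_mono)
      have "ln X \<le> ln (7 * real M * (real m)\<^sup>2)" using XM X3 by simp
      also have "\<dots> = ln (7 * real M) + 2 * ln (real m)"
        using M m0 by (simp add: ln_mult ln_realpow)
      \<comment> \<open>Trades the logarithm for the last of the \<open>d + 1\<close> factors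
        \<open>q\<close>.\<close>
      also have "ln (real m) \<le> q / k"
      proof -
        have "ln q \<le> q" using q1 ln_le_minus_one[of q] by simp
        then have "k * ln (real m) \<le> q" using m0 by (simp add: q_def ln_powr)
        then show ?thesis using k by (simp add: field_simps)
      qed
      also have "ln (7 * real M) + 2 * (q / k) \<le> (ln (7 * real M) + 2 / k) * q"
        using lnM q1 mult_left_mono[of 1 q "ln (7 * real M)"] by (simp add: algebra_simps)
      finally show "ln X \<le> (ln (7 * real M) + 2 / k) * q" by simp
    qed simp
    also have "\<dots> \<le> 2 * (((2 * real d + 2) * (1 / \<sigma> * q)) ^ d * real M) * ((ln (7 * real M) + 2 / k) * q)"
    proof (intro mult_right_mono mult_left_mono)
      show "real E \<le> ((2 * real d + 2) * (1 / \<sigma> * q)) ^ d * real M"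
        unfolding E_def of_nat_mult of_nat_power using NS by (intro mult_right_mono power_mono) auto
    qed (use lnM k q1 in auto)
    also have "\<dots> = C * (1 / \<sigma>) ^ d * (q ^ d * q)"
      by (simp only: C_def power_mult_distrib mult_ac)
    also have "q ^ d * q = real m powr \<kappa>"
    proof -
      have "q ^ d * q = q ^ (d + 1)" by simp
      also have "\<dots> = real m powr (k * real (d + 1))"
        using m0 by (simp only: q_def powr_realpow[symmetric] powr_powr powr_gt_zero)
      also have "k * real (d + 1) = \<kappa>" by (simp add: k_def add.commute)
      finally show ?thesis .
    qed
    finally have card: "ln (real (card A) + 1) \<le> C * (1 / \<sigma>) ^ CARD('d) * real m powr \<kappa>"
      by (simp add: d_def)
    show "\<exists>A :: (real^'d) kcomb set. finite A \<and> ln (real (card A) + 1) \<le> C * (1 / \<sigma>) ^ CARD('d) * real m powr \<kappa> \<and>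
      (\<forall>f\<in>H_gauss \<sigma>. gauss_sqnorm \<sigma> f \<le> real m \<longrightarrow>
         (\<exists>a\<in>A. \<forall>x\<in>unit_cube. \<bar>f x - kc_eval ?K a x\<bar> \<le> 6 / real m))"
    proof (intro exI[of _ A] conjI ballI impI A(1) card)
      fix f :: "real^'d \<Rightarrow> real"
      assume f: "f \<in> H_gauss \<sigma>" "gauss_sqnorm \<sigma> f \<le> real m"
      have "0 < 1 / real m" using m0 by simp
      then obtain a where a: "kc_inner ?K a a \<le> gauss_sqnorm \<sigma> f + 1"
          "\<And>x. x \<in> unit_cube \<Longrightarrow> \<bar>f x - kc_eval ?K a x\<bar> \<le> 1 / real m"
        using gauss.rkhs_approx_uniform[of f \<sigma> unit_cube "1 / real m"] f(1)
        unfolding H_gauss_def gauss_sqnorm_def by (metis gauss_kernel_self order_refl)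
      \<comment> \<open>The radius \<open>2 * m\<close> is generous, but it enters the entropy only
        through a logarithm.\<close>
      have "kc_inner ?K a a \<le> (2 * real m)\<^sup>2"
      proof -
        have "real m \<le> (real m)\<^sup>2" "1 \<le> (real m)\<^sup>2" using m self_le_power[of "real m" 2] one_le_power[of "real m" 2] by auto
        then have "gauss_sqnorm \<sigma> f + 1 \<le> 4 * (real m)\<^sup>2" using f(2) by linarith
        then show ?thesis using a(1) by (simp add: power_mult_distrib)
      qed
      then obtain b where b: "b \<in> A" "\<forall>x\<in>unit_cube. \<bar>kc_eval ?K a x - kc_eval ?K b x\<bar>
          \<le> s * M + 2 * (2 * real m) * (sqrt 2 * real CARD('d) / (real N * \<sigma>)) ^ n"
        using A(3) by blast
      have sM: "s * M = 1 / real m" using M by (simp add: s_def)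
      show "\<exists>a\<in>A. \<forall>x\<in>unit_cube. \<bar>f x - kc_eval ?K a x\<bar> \<le> 6 / real m"
      proof (intro bexI[of _ b] ballI b(1))
        fix x :: "real^'d" assume x: "x \<in> unit_cube"
        have "\<bar>kc_eval ?K a x - kc_eval ?K b x\<bar> \<le> 1 / real m + 4 / real m"
          using b(2) x rem sM by (force simp: d_def)
        then have "\<bar>f x - kc_eval ?K b x\<bar> \<le> 1 / real m + (1 / real m + 4 / real m)"
          using a(2)[OF x] by linarith
        then show "\<bar>f x - kc_eval ?K b x\<bar> \<le> 6 / real m" by (simp add: add_divide_distrib[symmetric])
      qed
    qed
  qed
qed

section \<open>Approximation of separated labels in the Gaussian RKHS\<close>

lemma gaussian_integrable: "integrable lborel (\<lambda>w::'a::euclidean_space. exp (- (norm w)\<^sup>2))"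
proof (rule integrableI_nonneg)
  have one: "(\<integral>\<^sup>+x. ennreal (exp (- x\<^sup>2)) \<partial>(lborel::real measure)) < \<infinity>"
  proof -
    \<comment> \<open>Variance 1/2 gives the exponent \<open>- x\<^sup>2\<close>.\<close>
    have "integrable lborel (normal_density 0 (1 / sqrt 2))" by simp
    then have "integrable lborel (\<lambda>x. sqrt pi * normal_density 0 (1 / sqrt 2) x)"
      by (rule integrable_mult_right)
    moreover have "(\<lambda>x. sqrt pi * normal_density 0 (1 / sqrt 2) x) = (\<lambda>x::real. exp (- x\<^sup>2))"
      by (auto simp: normal_density_def fun_eq_iff power_divide)
    ultimately show ?thesis
      using real_integrable_def by (auto simp: integrable_iff_bounded)
  qed
  have "(\<integral>\<^sup>+w. ennreal (exp (- (norm w)\<^sup>2)) \<partial>(lborel::'a measure))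
      = (\<integral>\<^sup>+w. (\<Prod>b\<in>Basis. ennreal (exp (- (w \<bullet> b)\<^sup>2))) \<partial>(lborel::'a measure))"
    by (intro nn_integral_cong)
      (simp add: prod_ennreal exp_sum[symmetric] sum_negf norm_eq_sqrt_inner
        euclidean_inner[of w w for w] power2_eq_square sum_nonneg)
  also have "\<dots> = (\<Prod>b\<in>(Basis::'a set). \<integral>\<^sup>+x. ennreal (exp (- x\<^sup>2)) \<partial>lborel)"
    by (rule nn_integral_lborel_prod) auto
  also have "\<dots> < \<infinity>" using one by (simp add: power_less_top_ennreal)
  finally show "(\<integral>\<^sup>+w. ennreal (exp (- (norm w)\<^sup>2)) \<partial>(lborel::'a measure)) < \<infinity>" .
qed auto

text \<open>The number \<open>pi powr (DIM('a) / 2)\<close>, left unevaluated; the type argument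
  carries the dimension.\<close>

definition gauss_mass :: "'a::euclidean_space itself \<Rightarrow> real" where
  "gauss_mass _ = (\<integral>w. exp (- (norm w)\<^sup>2) \<partial>(lborel::'a measure))"

lemma gauss_mass_pos: "0 < gauss_mass TYPE('a::euclidean_space)"
proof -
  have "gauss_mass TYPE('a) \<noteq> 0"
  proof
    assume "gauss_mass TYPE('a) = 0"
    then have "AE w::'a in lborel. exp (- (norm w)\<^sup>2) = 0"
      unfolding gauss_mass_def
      by (subst (asm) integral_nonneg_eq_0_iff_AE[OF gaussian_integrable]) auto
    then have "AE w::'a in lborel. False" by simp
    then have "emeasure lborel (UNIV :: 'a set) = 0" by (simp add: AE_iff_null null_sets_def)
    then show False by simp
  qed
  moreover have "0 \<le> gauss_mass TYPE('a)" unfolding gauss_mass_def by simp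
  ultimately show ?thesis by simp
qed

lemma gaussian_integral:
  fixes x :: "'a::euclidean_space"
  assumes c: "0 < c" and \<sigma>: "0 < \<sigma>"
  shows "integrable lborel (\<lambda>w. exp (- (c * (norm (x - w))\<^sup>2) / \<sigma>\<^sup>2))"
    and "(\<integral>w. exp (- (c * (norm (x - w))\<^sup>2) / \<sigma>\<^sup>2) \<partial>lborel) = (\<sigma> / sqrt c) ^ DIM('a) * gauss_mass TYPE('a)"
proof -
  define a where "a = \<sigma> / sqrt c"
  have a: "0 < a" using c \<sigma> by (simp add: a_def)
  define F where "F w = exp (- (c * (norm (x - w))\<^sup>2) / \<sigma>\<^sup>2)" for w
  have F: "F (x + a *\<^sub>R v) = exp (- (norm v)\<^sup>2)" for v
  proof -
    have "c * (norm (x - (x + a *\<^sub>R v)))\<^sup>2 / \<sigma>\<^sup>2 = c * a\<^sup>2 / \<sigma>\<^sup>2 * (norm v)\<^sup>2"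
      by (simp add: power_mult_distrib)
    also have "c * a\<^sup>2 / \<sigma>\<^sup>2 = 1" using c \<sigma> by (simp add: a_def power_divide)
    finally show ?thesis by (simp add: F_def)
  qed
  have [measurable]: "F \<in> borel_measurable borel" unfolding F_def by measurable
  have eq: "lborel = density (distr lborel borel (\<lambda>v. x + a *\<^sub>R v)) (\<lambda>_. ennreal (a ^ DIM('a)))"
    using lborel_affine[of a x] a by (simp add: ennreal_power)
  have int: "integrable lborel (\<lambda>v. a ^ DIM('a) * F (x + a *\<^sub>R v))"
    unfolding F by (intro integrable_mult_right gaussian_integrable)
  \<comment> \<open>The right-hand side of \<open>eq\<close> contains \<open>lborel\<close> again,
    so the whole integrability statement is rewritten rather than the measure.\<close>
  have "integrable lborel F"
    unfolding eq[symmetric, THEN arg_cong[where f="\<lambda>M. integrable M F"], symmetric]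
    using a int by (simp add: integrable_density integrable_distr_eq)
  then show "integrable lborel (\<lambda>w. exp (- (c * (norm (x - w))\<^sup>2) / \<sigma>\<^sup>2))" by (simp add: F_def[abs_def])
  have "(\<integral>w. F w \<partial>lborel) = (\<integral>w. F w \<partial>(density (distr lborel borel (\<lambda>v. x + a *\<^sub>R v)) (\<lambda>_. ennreal (a ^ DIM('a)))))"
    using eq by simp
  also have "\<dots> = (\<integral>v. a ^ DIM('a) * F (x + a *\<^sub>R v) \<partial>lborel)"
    using a by (simp add: integral_density integral_distr)
  also have "\<dots> = a ^ DIM('a) * gauss_mass TYPE('a)"
    unfolding F gauss_mass_def by simp
  finally show "(\<integral>w. exp (- (c * (norm (x - w))\<^sup>2) / \<sigma>\<^sup>2) \<partial>lborel) = (\<sigma> / sqrt c) ^ DIM('a) * gauss_mass TYPE('a)"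
    by (simp add: F_def a_def)
qed

text \<open>The factor 2 is what makes products of two windows integrate to a multiple of
  \<open>gauss_kernel\<close>: by the parallelogram law, \<open>2 |x - w|^2 + 2 |y - w|^2\<close> is
  \<open>|x - y|^2\<close> plus a square centred at the midpoint.\<close>

definition gwin :: "real \<Rightarrow> real^'d \<Rightarrow> real^'d \<Rightarrow> real" where
  "gwin \<sigma> w x = exp (- (2 * (norm (x - w))\<^sup>2) / \<sigma>\<^sup>2)"

lemma gwin_measurable [measurable]: "(\<lambda>w. gwin \<sigma> w x) \<in> borel_measurable borel"
  unfolding gwin_def by measurable

lemma gwin_mult:
  "gwin \<sigma> w x * gwin \<sigma> w y = gauss_kernel \<sigma> x y * exp (- (4 * (norm ((1/2) *\<^sub>R (x + y) - w))\<^sup>2) / \<sigma>\<^sup>2)"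
proof -
  have "2 * (norm (x - w))\<^sup>2 + 2 * (norm (y - w))\<^sup>2 = (norm (x - y))\<^sup>2 + 4 * (norm ((1/2) *\<^sub>R (x + y) - w))\<^sup>2"
    unfolding power2_norm_eq_inner
    by (simp add: inner_diff_left inner_diff_right inner_add_left inner_add_right inner_commute algebra_simps)
  then show ?thesis
    unfolding gwin_def gauss_kernel_def exp_add[symmetric] add_divide_distrib[symmetric]
    by (simp add: minus_add_distrib[symmetric] del: minus_add_distrib)
qed

lemma gwin_mult_integral:
  fixes x y :: "real^'d"
  assumes "0 < \<sigma>"
  shows "integrable lborel (\<lambda>w. gwin \<sigma> w x * gwin \<sigma> w y)"
    and "(\<integral>w. gwin \<sigma> w x * gwin \<sigma> w y \<partial>lborel) =
      ((\<sigma> / 2) ^ CARD('d) * gauss_mass TYPE(real^'d)) * gauss_kernel \<sigma> x y"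
proof -
  have *: "sqrt 4 = (2::real)" by (simp add: real_sqrt_unique)
  show "integrable lborel (\<lambda>w. gwin \<sigma> w x * gwin \<sigma> w y)"
    unfolding gwin_mult by (intro integrable_mult_right gaussian_integral assms) auto
  show "(\<integral>w. gwin \<sigma> w x * gwin \<sigma> w y \<partial>lborel) =
      ((\<sigma> / 2) ^ CARD('d) * gauss_mass TYPE(real^'d)) * gauss_kernel \<sigma> x y"
    unfolding gwin_mult using gaussian_integral(2)[of 4 \<sigma> "(1/2) *\<^sub>R (x + y)"] assms by (simp add: *)
qed

lemma gwin_integral:
  fixes x :: "real^'d"
  assumes "0 < \<sigma>"
  shows "integrable lborel (\<lambda>w. gwin \<sigma> w x)"
    and "(\<integral>w. gwin \<sigma> w x \<partial>lborel) = (\<sigma> / sqrt 2) ^ CARD('d) * gauss_mass TYPE(real^'d)"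
  unfolding gwin_def using gaussian_integral[of 2 \<sigma> x] assms by auto

lemma kc_app_integrable:
  assumes "\<And>x. integrable M (\<lambda>w. \<phi> w x)"
  shows "integrable M (\<lambda>w. kc_app (\<phi> w) a)"
  unfolding kc_app_def using assms by auto

lemma kc_app_integral:
  assumes "\<And>x. integrable M (\<lambda>w. \<phi> w x)"
  shows "(\<integral>w. kc_app (\<phi> w) a \<partial>M) = kc_app (\<lambda>x. \<integral>w. \<phi> w x \<partial>M) a"
  unfolding kc_app_def using assms by simp

text \<open>\<open>gauss_kernel\<close> is the Gram kernel of the windows \<open>gwin\<close> in \<open>L\<^sup>2\<close>, so superpositions of windows
  with square-integrable density lie in the RKHS.\<close>

lemma window_superposition_in_rkhs:
  fixes h :: "real^'d \<Rightarrow> real"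
  assumes \<sigma>: "0 < \<sigma>" and h [measurable]: "h \<in> borel_measurable borel"
    and hb: "\<And>w. \<bar>h w\<bar> \<le> c * indicator U w" and U [measurable]: "U \<in> sets borel" and Uf: "emeasure lborel U < \<infinity>"
    and c: "0 \<le> c"
  defines "\<phi> \<equiv> \<lambda>x. if x \<in> unit_cube then (\<integral>w. h w * gwin \<sigma> w x \<partial>lborel) else 0"
  shows "\<phi> \<in> H_gauss \<sigma>"
    "gauss_sqnorm \<sigma> \<phi> \<le> 4 * (((\<sigma> / 2) ^ CARD('d) * gauss_mass TYPE(real^'d)) * (c\<^sup>2 * measure lborel U))"
proof -
  define Z where "Z = (\<sigma> / 2) ^ CARD('d) * gauss_mass TYPE(real^'d)"
  have Z: "0 < Z" using \<sigma> gauss_mass_pos[where 'a="real^'d"] by (simp add: Z_def)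
  let ?K = "gauss_kernel \<sigma> :: real^'d \<Rightarrow> real^'d \<Rightarrow> real"
  have intU: "integrable lborel (\<lambda>w. c\<^sup>2 * indicator U w :: real)"
    using Uf by (intro integrable_mult_right) auto
  have h2: "(h w)\<^sup>2 \<le> c\<^sup>2 * indicator U w" for w
    using power_mono[OF hb[of w], of 2] by (auto simp: indicator_def split: if_splits)
  have inth2: "integrable lborel (\<lambda>w. (h w)\<^sup>2)"
    by (rule Bochner_Integration.integrable_bound[OF intU]) (use h2 in auto)
  have inthg: "integrable lborel (\<lambda>w. h w * gwin \<sigma> w x)" for x
  proof (rule Bochner_Integration.integrable_bound[OF integrable_mult_right[OF gwin_integral(1)[OF \<sigma>], of c x]])
    have "\<bar>h w\<bar> \<le> c" for w using hb[of w] c by (cases "w \<in> U") auto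
    then show "AE w in lborel. norm (h w * gwin \<sigma> w x) \<le> norm (c * gwin \<sigma> w x)"
      using c by (auto simp: abs_mult gwin_def mult_right_mono intro!: always_eventually)
  qed auto
  have bound: "2 * kc_app \<phi> a \<le> kc_inner ?K a a + Z * (c\<^sup>2 * measure lborel U)" if a: "kc_in unit_cube a" for a
  proof -
    define u where "u w = kc_app (gwin \<sigma> w) a" for w
    have "kc_app \<phi> a = kc_app (\<lambda>x. \<integral>w. h w * gwin \<sigma> w x \<partial>lborel) a"
      using a by (auto simp: kc_app_def \<phi>_def kc_in_def intro!: sum.cong)
    also have "\<dots> = (\<integral>w. kc_app (\<lambda>x. h w * gwin \<sigma> w x) a \<partial>lborel)"
      by (rule kc_app_integral[symmetric]) (rule inthg)
    also have "\<dots> = (\<integral>w. h w * u w \<partial>lborel)" by (simp add: kc_app_cmult u_def)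
    finally have 1: "kc_app \<phi> a = (\<integral>w. h w * u w \<partial>lborel)" .
    have int1: "integrable lborel (\<lambda>w. h w * u w)"
      using kc_app_integrable[of lborel "\<lambda>w x. h w * gwin \<sigma> w x" a] inthg by (simp add: kc_app_cmult u_def)
    have u2: "(u w)\<^sup>2 = kc_app (\<lambda>x. kc_app (\<lambda>y. gwin \<sigma> w x * gwin \<sigma> w y) a) a" for w
      by (simp add: u_def power2_eq_square kc_app_cmult kc_app_multc)
    have int2: "integrable lborel (\<lambda>w. (u w)\<^sup>2)"
      unfolding u2 by (intro kc_app_integrable gwin_mult_integral \<sigma>)
    have "(\<integral>w. (u w)\<^sup>2 \<partial>lborel) = kc_app (\<lambda>x. kc_app (\<lambda>y. Z * ?K x y) a) a"
      unfolding u2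
      by (subst kc_app_integral, intro kc_app_integrable gwin_mult_integral \<sigma>,
          subst kc_app_integral, intro gwin_mult_integral \<sigma>) (simp add: gwin_mult_integral(2)[OF \<sigma>] Z_def)
    also have "\<dots> = Z * kc_inner ?K a a" by (simp add: kc_inner_app kc_app_cmult)
    finally have 2: "(\<integral>w. (u w)\<^sup>2 \<partial>lborel) = Z * kc_inner ?K a a" .
    have "2 * (\<integral>w. h w * u w \<partial>lborel) = (\<integral>w. 2 * (h w * u w) \<partial>lborel)" by simp
    \<comment> \<open>Young's inequality with weight \<open>Z\<close>, chosen so that the part with
      \<open>u\<close> integrates exactly to the kernel norm.\<close>
    also have "\<dots> \<le> (\<integral>w. (1 / Z) * (u w)\<^sup>2 + Z * (h w)\<^sup>2 \<partial>lborel)"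
    proof (rule integral_mono)
      fix w
      have "0 \<le> Z * (h w - u w / Z)\<^sup>2" using Z by simp
      also have "\<dots> = (1 / Z) * (u w)\<^sup>2 + Z * (h w)\<^sup>2 - 2 * (h w * u w)"
        using Z by (simp add: power2_eq_square field_simps)
      finally show "2 * (h w * u w) \<le> (1 / Z) * (u w)\<^sup>2 + Z * (h w)\<^sup>2" by simp
    qed (use int1 int2 inth2 in auto)
    also have "\<dots> = (1 / Z) * (\<integral>w. (u w)\<^sup>2 \<partial>lborel) + Z * (\<integral>w. (h w)\<^sup>2 \<partial>lborel)"
      using int2 inth2 by simp
    also have "\<dots> = kc_inner ?K a a + Z * (\<integral>w. (h w)\<^sup>2 \<partial>lborel)" using Z by (simp add: 2)
    also have "(\<integral>w. (h w)\<^sup>2 \<partial>lborel) \<le> (\<integral>w. c\<^sup>2 * indicator U w \<partial>lborel)"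
      by (rule integral_mono[OF inth2 intU h2])
    also have "\<dots> = c\<^sup>2 * measure lborel U" by simp
    finally show ?thesis using Z 1 by (simp add: mult_left_mono)
  qed
  have "\<phi> x = 0" if "x \<notin> unit_cube" for x using that by (simp add: \<phi>_def)
  from gauss.bounded_functional_in_rkhs[OF bound this]
  show "\<phi> \<in> H_gauss \<sigma>"
    "gauss_sqnorm \<sigma> \<phi> \<le> 4 * (((\<sigma> / 2) ^ CARD('d) * gauss_mass TYPE(real^'d)) * (c\<^sup>2 * measure lborel U))"
    by (auto simp: H_gauss_def gauss_sqnorm_def Z_def)
qed

lemma norm_unit_cube_le:
  fixes x :: "real^'d"
  assumes "x \<in> unit_cube"
  shows "norm x \<le> real CARD('d)"
proof -
  have "norm x \<le> (\<Sum>i\<in>UNIV. \<bar>x $ i\<bar>)" by (rule norm_le_l1_cart)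
  also have "\<dots> \<le> (\<Sum>i\<in>(UNIV::'d set). 1)"
    using assms by (intro sum_mono) (auto simp: unit_cube_iff)
  finally show ?thesis by simp
qed

text \<open>Near a point of \<open>Ap\<close> or \<open>Am\<close> the averaged label is constant,
  so the error comes only from the window's tail beyond distance \<open>\<gamma> / 2\<close>. The
  sets \<open>Ap\<close> and \<open>Am\<close> need not be measurable.\<close>

lemma gauss_approximation:
  fixes Ap Am :: "(real^'d) set"
  assumes \<gamma>: "0 < \<gamma>" and Ap: "Ap \<subseteq> unit_cube" and Am: "Am \<subseteq> unit_cube"
    and sep: "\<And>x y. x \<in> Ap \<Longrightarrow> y \<in> Am \<Longrightarrow> \<gamma> \<le> dist x y"
  shows "\<exists>C\<ge>0. \<forall>\<sigma>>0. \<exists>f0\<in>H_gauss \<sigma>. gauss_sqnorm \<sigma> f0 \<le> C * (1 / \<sigma>) ^ CARD('d) \<and> (\<forall>x. \<bar>f0 x\<bar> \<le> 1) \<and>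
    (\<forall>x\<in>Ap. \<bar>f0 x - 1\<bar> \<le> C * exp (- (\<gamma>\<^sup>2 / (4 * \<sigma>\<^sup>2)))) \<and> (\<forall>x\<in>Am. \<bar>f0 x + 1\<bar> \<le> C * exp (- (\<gamma>\<^sup>2 / (4 * \<sigma>\<^sup>2))))"
proof -
  define d where "d = CARD('d)"
  define I where "I = gauss_mass TYPE(real^'d)"
  have I: "0 < I" unfolding I_def by (rule gauss_mass_pos)
  \<comment> \<open>Truncation makes the density square-integrable; the radius leaves room for the
    \<open>\<gamma> / 2\<close>-ball around every point of the cube.\<close>
  define U :: "(real^'d) set" where "U = ball 0 (real d + \<gamma>)"
  have [measurable]: "U \<in> sets borel" by (simp add: U_def)
  have Uf: "emeasure lborel U < \<infinity>" unfolding U_def by (rule emeasure_lborel_ball_finite)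
  \<comment> \<open>Open, hence Borel for arbitrary \<open>Ap\<close>; by separation the
    \<open>\<gamma> / 2\<close>-balls around points of \<open>Am\<close> avoid it.\<close>
  define P where "P = (\<Union>x\<in>Ap. ball x (\<gamma> / 2))"
  have [measurable]: "P \<in> sets borel" unfolding P_def by (intro borel_open open_UN) auto
  define C where "C = 4 * measure lborel U / I + 2 * sqrt 2 ^ d"
  have C: "4 * measure lborel U / I \<le> C" "2 * sqrt 2 ^ d \<le> C" "0 \<le> C" using I by (auto simp: C_def)
  show ?thesis
  proof (intro exI[of _ C] conjI allI impI C(3))
    fix \<sigma> :: real assume \<sigma>: "0 < \<sigma>"
    \<comment> \<open>Normalizes the window to total mass 1, whence
      \<open>\<bar>f0\<bar> \<le> 1\<close>.\<close>
    define c where "c = 1 / ((\<sigma> / sqrt 2) ^ d * I)"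
    have c: "0 < c" using \<sigma> I by (simp add: c_def)
    define h where "h w = c * (indicator U w * (if w \<in> P then 1 else - 1))" for w
    have [measurable]: "h \<in> borel_measurable borel" unfolding h_def by measurable
    have hU: "\<bar>h w\<bar> \<le> c * indicator U w" for w using c by (simp add: h_def abs_mult indicator_def)
    have hc: "\<bar>h w\<bar> \<le> c" for w using c by (simp add: h_def abs_mult indicator_def)
    define f0 where "f0 = (\<lambda>x. if x \<in> unit_cube then (\<integral>w. h w * gwin \<sigma> w x \<partial>lborel) else 0)"
    note sup = window_superposition_in_rkhs[OF \<sigma> _ hU _ Uf less_imp_le[OF c], folded f0_def]
    have gi: "integrable lborel (\<lambda>w. gwin \<sigma> w x)" "(\<integral>w. c * gwin \<sigma> w x \<partial>lborel) = 1" for x :: "real^'d"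
      using gwin_integral[OF \<sigma>, of x] I \<sigma> by (simp_all add: c_def d_def I_def)
    have gpos: "0 < gwin \<sigma> w x" for w x :: "real^'d" by (simp add: gwin_def)
    have hgi: "integrable lborel (\<lambda>w. h w * gwin \<sigma> w x)" for x
    proof (rule Bochner_Integration.integrable_bound[OF integrable_mult_right[OF gi(1), of c x]])
      show "AE w in lborel. norm (h w * gwin \<sigma> w x) \<le> norm (c * gwin \<sigma> w x)"
        using hc c gpos by (auto simp: abs_mult intro!: always_eventually mult_right_mono)
    qed auto
    have norm: "gauss_sqnorm \<sigma> f0 \<le> C * (1 / \<sigma>) ^ CARD('d)"
    proof -
      have "gauss_sqnorm \<sigma> f0 \<le> 4 * (((\<sigma> / 2) ^ d * I) * (c\<^sup>2 * measure lborel U))"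
        using sup(2) by (simp add: d_def I_def)
      also have "((\<sigma> / 2) ^ d * I) * (c\<^sup>2 * measure lborel U) = (measure lborel U / I) * (1 / \<sigma>) ^ d"
      proof -
        have sq: "((\<sigma> / sqrt 2) ^ d)\<^sup>2 = (\<sigma> / 2) ^ d * \<sigma> ^ d"
        proof -
          have "((\<sigma> / sqrt 2) ^ d)\<^sup>2 = ((\<sigma> / sqrt 2)\<^sup>2) ^ d" by (simp add: power_mult[symmetric] mult.commute)
          also have "(\<sigma> / sqrt 2)\<^sup>2 = (\<sigma> / 2) * \<sigma>" by (simp add: power_divide power2_eq_square)
          finally show ?thesis by (simp only: power_mult_distrib)
        qed
        have c2: "c\<^sup>2 = 1 / ((\<sigma> / 2) ^ d * \<sigma> ^ d * I\<^sup>2)"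
          by (simp only: c_def power_one_over power_mult_distrib sq)
        show ?thesis unfolding c2 using \<sigma> I by (simp add: power_divide power2_eq_square)
      qed
      also have "4 * ((measure lborel U / I) * (1 / \<sigma>) ^ d) = (4 * measure lborel U / I) * (1 / \<sigma>) ^ d" by simp
      also have "\<dots> \<le> C * (1 / \<sigma>) ^ d" using C(1) \<sigma> by (intro mult_right_mono) auto
      finally show ?thesis by (simp add: d_def)
    qed
    have le1: "\<bar>f0 x\<bar> \<le> 1" for x
    proof (cases "x \<in> unit_cube")
      case True
      have "\<bar>\<integral>w. h w * gwin \<sigma> w x \<partial>lborel\<bar> \<le> (\<integral>w. \<bar>h w * gwin \<sigma> w x\<bar> \<partial>lborel)"
        by (rule integral_abs_bound)
      also have "\<dots> \<le> (\<integral>w. c * gwin \<sigma> w x \<partial>lborel)"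
        using gi(1) hgi hc gpos[THEN less_imp_le]
        by (intro integral_mono integrable_abs integrable_mult_right) (auto simp: abs_mult intro!: mult_right_mono)
      finally show ?thesis using True gi(2) by (simp add: f0_def)
    qed (simp add: f0_def)
    have tail: "\<bar>f0 x - s\<bar> \<le> C * exp (- (\<gamma>\<^sup>2 / (4 * \<sigma>\<^sup>2)))"
      if x: "x \<in> unit_cube" and s: "\<bar>s\<bar> = 1" and near: "\<And>w. dist x w < \<gamma> / 2 \<Longrightarrow> (if w \<in> P then 1 else - 1) = s" for x s
    proof -
      define e where "e = exp (- (\<gamma>\<^sup>2 / (4 * \<sigma>\<^sup>2)))"
      have G: "integrable lborel (\<lambda>w. exp (- (norm (x - w))\<^sup>2 / \<sigma>\<^sup>2))"
          "(\<integral>w. exp (- (norm (x - w))\<^sup>2 / \<sigma>\<^sup>2) \<partial>lborel) = \<sigma> ^ d * I"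
        using gaussian_integral[of 1 \<sigma> x] \<sigma> by (simp_all add: d_def I_def)
      have "f0 x - s = (\<integral>w. h w * gwin \<sigma> w x \<partial>lborel) - s * (\<integral>w. c * gwin \<sigma> w x \<partial>lborel)"
        using x by (simp add: f0_def gi(2) del: Bochner_Integration.integral_mult_right_zero)
      also have "\<dots> = (\<integral>w. h w * gwin \<sigma> w x - s * (c * gwin \<sigma> w x) \<partial>lborel)"
        using hgi gi(1) by simp
      finally have "\<bar>f0 x - s\<bar> \<le> (\<integral>w. \<bar>h w * gwin \<sigma> w x - s * (c * gwin \<sigma> w x)\<bar> \<partial>lborel)"
        by (simp only: integral_abs_bound)
      also have "\<dots> \<le> (\<integral>w. (2 * c * e) * exp (- (norm (x - w))\<^sup>2 / \<sigma>\<^sup>2) \<partial>lborel)"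
      proof (rule integral_mono)
        fix w
        have eq: "\<bar>h w * gwin \<sigma> w x - s * (c * gwin \<sigma> w x)\<bar> = \<bar>h w - s * c\<bar> * gwin \<sigma> w x"
          using gpos[of w x] by (simp add: abs_mult[symmetric] left_diff_distrib[symmetric] mult.assoc[symmetric] abs_mult)
        show "\<bar>h w * gwin \<sigma> w x - s * (c * gwin \<sigma> w x)\<bar> \<le> (2 * c * e) * exp (- (norm (x - w))\<^sup>2 / \<sigma>\<^sup>2)"
        proof (cases "dist x w < \<gamma> / 2")
          case True
          have "norm w \<le> norm x + dist x w" using norm_triangle_sub[of w x] by (simp add: dist_norm norm_minus_commute)
          then have "w \<in> U" using norm_unit_cube_le[OF x] True \<gamma> by (simp add: U_def d_def)
          then have "h w = s * c" using near[OF True] by (simp add: h_def)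
          then show ?thesis unfolding eq using c by (simp add: e_def)
        next
          case False
          then have "(\<gamma> / 2)\<^sup>2 \<le> (norm (x - w))\<^sup>2" using \<gamma> by (intro power_mono) (auto simp: dist_norm)
          then have "\<gamma>\<^sup>2 / 4 / \<sigma>\<^sup>2 \<le> (norm (x - w))\<^sup>2 / \<sigma>\<^sup>2"
            by (intro divide_right_mono) (auto simp: power_divide)
          then have "exp (- (norm (x - w))\<^sup>2 / \<sigma>\<^sup>2) \<le> e" by (simp add: e_def)
          \<comment> \<open>The window is split into two equal factors: one yields the exponentially
            small bound, the other remains to be integrated.\<close>
          have gsq: "gwin \<sigma> w x = exp (- (norm (x - w))\<^sup>2 / \<sigma>\<^sup>2) * exp (- (norm (x - w))\<^sup>2 / \<sigma>\<^sup>2)"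
            by (simp add: gwin_def exp_add[symmetric])
          have "gwin \<sigma> w x \<le> e * exp (- (norm (x - w))\<^sup>2 / \<sigma>\<^sup>2)"
            unfolding gsq using \<open>exp (- (norm (x - w))\<^sup>2 / \<sigma>\<^sup>2) \<le> e\<close> by (intro mult_right_mono) auto
          moreover have "\<bar>h w - s * c\<bar> \<le> 2 * c"
          proof -
            have "\<bar>s * c\<bar> = c" using s c by (simp add: abs_mult)
            then show ?thesis using hc[of w] by linarith
          qed
          ultimately have "\<bar>h w - s * c\<bar> * gwin \<sigma> w x \<le> (2 * c) * (e * exp (- (norm (x - w))\<^sup>2 / \<sigma>\<^sup>2))"
            using c gpos[of w x] by (intro mult_mono) auto
          then show ?thesis unfolding eq by (simp add: mult.assoc)
        qed
      qed (use hgi gi(1) G(1) in auto)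
      also have "\<dots> = 2 * c * e * (\<sigma> ^ d * I)" using G by simp
      also have "\<dots> = 2 * sqrt 2 ^ d * e" using \<sigma> I by (simp add: c_def power_divide)
      also have "\<dots> \<le> C * e" using C(2) by (intro mult_right_mono) (auto simp: e_def)
      finally show ?thesis by (simp add: e_def)
    qed
    show "\<exists>f0\<in>H_gauss \<sigma>. gauss_sqnorm \<sigma> f0 \<le> C * (1 / \<sigma>) ^ CARD('d) \<and> (\<forall>x. \<bar>f0 x\<bar> \<le> 1) \<and>
      (\<forall>x\<in>Ap. \<bar>f0 x - 1\<bar> \<le> C * exp (- (\<gamma>\<^sup>2 / (4 * \<sigma>\<^sup>2)))) \<and> (\<forall>x\<in>Am. \<bar>f0 x + 1\<bar> \<le> C * exp (- (\<gamma>\<^sup>2 / (4 * \<sigma>\<^sup>2))))"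
    proof (intro bexI[of _ f0] conjI norm allI le1 ballI)
      show "f0 \<in> H_gauss \<sigma>" by (rule sup(1)) auto
      fix x assume "x \<in> Ap"
      then have "w \<in> P" if "dist x w < \<gamma> / 2" for w using that by (auto simp: P_def)
      then show "\<bar>f0 x - 1\<bar> \<le> C * exp (- (\<gamma>\<^sup>2 / (4 * \<sigma>\<^sup>2)))" using \<open>x \<in> Ap\<close> Ap by (intro tail) auto
    next
      fix x assume x: "x \<in> Am"
      have "w \<notin> P" if "dist x w < \<gamma> / 2" for w
      proof
        assume "w \<in> P"
        then obtain y where y: "y \<in> Ap" "dist y w < \<gamma> / 2" by (auto simp: P_def)
        have "dist y x \<le> dist y w + dist x w" by (rule dist_triangle2)
        then show False using sep[OF y(1) x] y(2) that by linarith
      qed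
      then have "\<bar>f0 x - (- 1)\<bar> \<le> C * exp (- (\<gamma>\<^sup>2 / (4 * \<sigma>\<^sup>2)))" using x Am by (intro tail) auto
      then show "\<bar>f0 x + 1\<bar> \<le> C * exp (- (\<gamma>\<^sup>2 / (4 * \<sigma>\<^sup>2)))" by simp
    qed
  qed
qed

section \<open>Consequences of the smoothness assumption\<close>

text \<open>Mean value inequality on the interval of admissible parameters. The derivative is
  supplied only at parameter 0 of each re-based line, so it is moved along the line by the chain
  rule for a translation.\<close>

lemma cube_coordinate_lipschitz:
  fixes F :: "real^'d \<Rightarrow> real" and DF :: "'d \<Rightarrow> real^'d \<Rightarrow> real"
  assumes der: "\<And>i x. x \<in> unit_cube \<Longrightarrow>
      ((\<lambda>t. F (x + t *\<^sub>R axis i 1)) has_real_derivative DF i x) (at 0 within {t. x + t *\<^sub>R axis i 1 \<in> unit_cube})"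
    and bnd: "\<And>i x. x \<in> unit_cube \<Longrightarrow> \<bar>DF i x\<bar> \<le> B"
    and x: "x \<in> unit_cube" and y: "x + s *\<^sub>R axis i 1 \<in> unit_cube"
  shows "\<bar>F (x + s *\<^sub>R axis i 1) - F x\<bar> \<le> B * \<bar>s\<bar>"
proof -
  define S where "S = {t. x + t *\<^sub>R axis i 1 \<in> unit_cube}"
  have "S = {- (x $ i)..1 - x $ i}"
  proof (intro equalityI subsetI)
    fix t assume "t \<in> S"
    then have "0 \<le> (x + t *\<^sub>R axis i 1) $ i" "(x + t *\<^sub>R axis i 1) $ i \<le> 1"
      unfolding S_def mem_Collect_eq unit_cube_iff by blast+
    then show "t \<in> {- (x $ i)..1 - x $ i}" by (simp add: axis_def)
  next
    fix t assume "t \<in> {- (x $ i)..1 - x $ i}"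
    then show "t \<in> S" using x by (auto simp: S_def unit_cube_iff axis_def)
  qed
  then have cv: "convex S" by simp
  have "\<bar>F (x + s *\<^sub>R axis i 1) - F (x + 0 *\<^sub>R axis i 1)\<bar> \<le> B * \<bar>s - 0\<bar>"
    unfolding real_norm_def[symmetric]
  proof (rule field_differentiable_bound[OF cv, where f'="\<lambda>t. DF i (x + t *\<^sub>R axis i 1)"])
    fix z assume z: "z \<in> S"
    define G where "G \<tau> = F ((x + z *\<^sub>R axis i 1) + \<tau> *\<^sub>R axis i 1)" for \<tau>
    have im: "(\<lambda>t. t - z) ` S = {\<tau>. (x + z *\<^sub>R axis i 1) + \<tau> *\<^sub>R axis i 1 \<in> unit_cube}"
    proof (intro equalityI subsetI)
      fix \<tau> assume "\<tau> \<in> {\<tau>. (x + z *\<^sub>R axis i 1) + \<tau> *\<^sub>R axis i 1 \<in> unit_cube}"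
      then have "\<tau> + z \<in> S" by (simp add: S_def scaleR_left_distrib add_ac)
      then show "\<tau> \<in> (\<lambda>t. t - z) ` S" by (intro image_eqI[of _ _ "\<tau> + z"]) auto
    qed (auto simp: S_def scaleR_left_diff_distrib)
    have "x + z *\<^sub>R axis i 1 \<in> unit_cube" using z by (simp add: S_def)
    from der[OF this, of i] have "(G has_field_derivative DF i (x + z *\<^sub>R axis i 1)) (at ((\<lambda>t. t - z) z) within (\<lambda>t. t - z) ` S)"
      unfolding im G_def by simp
    moreover have "((\<lambda>t. t - z) has_field_derivative 1) (at z within S)"
      by (auto intro!: derivative_eq_intros)
    ultimately have "(G \<circ> (\<lambda>t. t - z) has_field_derivative DF i (x + z *\<^sub>R axis i 1) * 1) (at z within S)"
      by (rule DERIV_image_chain)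
    moreover have "G \<circ> (\<lambda>t. t - z) = (\<lambda>t. F (x + t *\<^sub>R axis i 1))"
      by (auto simp: G_def fun_eq_iff scaleR_left_diff_distrib)
    ultimately show "((\<lambda>t. F (x + t *\<^sub>R axis i 1)) has_field_derivative DF i (x + z *\<^sub>R axis i 1)) (at z within S)"
      by simp
    show "norm (DF i (x + z *\<^sub>R axis i 1)) \<le> B" using bnd z by (simp add: S_def)
  qed (use x y in \<open>auto simp: S_def\<close>)
  then show ?thesis by simp
qed

text \<open>Coordinates of \<open>x\<close> are exchanged for those of \<open>y\<close> one at a
  time; the cube contains all mixed points, and bounded partial derivatives suffice without
  continuity.\<close>

lemma cube_lipschitz:
  fixes F :: "real^'d \<Rightarrow> real" and DF :: "'d \<Rightarrow> real^'d \<Rightarrow> real"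
  assumes der: "\<And>i x. x \<in> unit_cube \<Longrightarrow>
      ((\<lambda>t. F (x + t *\<^sub>R axis i 1)) has_real_derivative DF i x) (at 0 within {t. x + t *\<^sub>R axis i 1 \<in> unit_cube})"
    and bnd: "\<And>i x. x \<in> unit_cube \<Longrightarrow> \<bar>DF i x\<bar> \<le> B"
    and x: "x \<in> unit_cube" and y: "y \<in> unit_cube"
  shows "\<bar>F x - F y\<bar> \<le> real CARD('d) * B * norm (x - y)"
proof -
  define mix :: "'d set \<Rightarrow> real^'d" where "mix I = (\<chi> j. if j \<in> I then y $ j else x $ j)" for I
  have mix: "mix I \<in> unit_cube" for I using x y by (auto simp: unit_cube_iff mix_def)
  have B0: "0 \<le> B" using bnd[OF x] by (meson abs_ge_zero order_trans)
  have "\<bar>F (mix I) - F x\<bar> \<le> real (card I) * B * norm (x - y)" if "finite I" for I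
    using that
  proof (induction I rule: finite_induct)
    case empty
    have "mix {} = x" by (simp add: mix_def vec_eq_iff)
    then show ?case by simp
  next
    case (insert i I)
    have eq: "mix (insert i I) = mix I + (y $ i - x $ i) *\<^sub>R axis i 1"
      using insert.hyps by (auto simp: vec_eq_iff mix_def axis_def)
    have "\<bar>F (mix (insert i I)) - F (mix I)\<bar> \<le> B * \<bar>y $ i - x $ i\<bar>"
      unfolding eq by (rule cube_coordinate_lipschitz[OF der bnd mix]) (use mix[of "insert i I"] eq in auto)
    also have "\<dots> \<le> B * norm (x - y)"
      using component_le_norm_cart[of "x - y" i] B0 by (intro mult_left_mono) (auto simp: abs_minus_commute)
    finally show ?case using insert by (simp add: algebra_simps)
  qed
  from this[of UNIV] show ?thesis
    by (simp add: mix_def abs_minus_commute)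
qed

text \<open>Descent in the order of differentiation: a Hoelder function on the cube is bounded, and
  bounded derivatives of one order make those of the previous order Lipschitz.\<close>

lemma lip_class_holder:
  fixes f :: "real^'d \<Rightarrow> real"
  assumes "lip_class r c0 f" and r: "0 < r" and c0: "0 < c0"
  shows "\<exists>C v. 0 \<le> C \<and> 0 < v \<and> (\<forall>x\<in>unit_cube. \<forall>y\<in>unit_cube. \<bar>f x - f y\<bar> \<le> C * norm (x - y) powr v)"
proof -
  define u where "u = nat (\<lceil>r\<rceil> - 1)"
  define v where "v = r - real u"
  have v0: "0 < v"
  proof -
    have "1 \<le> \<lceil>r\<rceil>" using r by simp
    then have "real u = real_of_int \<lceil>r\<rceil> - 1" by (simp add: u_def)
    then show ?thesis unfolding v_def by linarith
  qed
  obtain Df :: "'d list \<Rightarrow> real^'d \<Rightarrow> real" where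
    Df0: "\<forall>x\<in>unit_cube. Df [] x = f x" and
    Dfd: "\<And>\<beta> i x. length \<beta> < u \<Longrightarrow> x \<in> unit_cube \<Longrightarrow>
          ((\<lambda>t. Df \<beta> (x + t *\<^sub>R axis i 1)) has_real_derivative Df (i # \<beta>) x)
            (at 0 within {t. x + t *\<^sub>R axis i 1 \<in> unit_cube})" and
    Dfu: "\<And>\<beta> x x'. length \<beta> = u \<Longrightarrow> x \<in> unit_cube \<Longrightarrow> x' \<in> unit_cube \<Longrightarrow>
          \<bar>Df \<beta> x - Df \<beta> x'\<bar> \<le> c0 * norm (x - x') powr v"
    using assms(1) unfolding lip_class_def Let_def u_def v_def by blast
  \<comment> \<open>Induction on \<open>k\<close>, the number of orders below the top order
    \<open>u\<close>; exponent and constant may change at each step.\<close>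
  have "\<forall>\<beta>. length \<beta> = u - k \<longrightarrow> (\<exists>C v. 0 \<le> C \<and> 0 < v \<and>
      (\<forall>x\<in>unit_cube. \<forall>y\<in>unit_cube. \<bar>Df \<beta> x - Df \<beta> y\<bar> \<le> C * norm (x - y) powr v))" if "k \<le> u" for k
    using that
  proof (induction k)
    case 0
    show ?case
    proof (intro allI impI)
      fix \<beta> :: "'d list" assume "length \<beta> = u - 0"
      then show "\<exists>C v. 0 \<le> C \<and> 0 < v \<and>
          (\<forall>x\<in>unit_cube. \<forall>y\<in>unit_cube. \<bar>Df \<beta> x - Df \<beta> y\<bar> \<le> C * norm (x - y) powr v)"
        using Dfu v0 c0 by (rule_tac exI[of _ c0], rule_tac exI[of _ v]) auto
    qed
  next
    case (Suc k)
    show ?case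
    proof (intro allI impI)
      fix \<beta> :: "'d list" assume \<beta>: "length \<beta> = u - Suc k"
      have len: "length (i # \<beta>) = u - k" for i using \<beta> Suc.prems by simp
      have lt: "length \<beta> < u" using \<beta> Suc.prems by simp
      have z: "(0::real^'d) \<in> unit_cube" by (simp add: unit_cube_iff)
      have "\<exists>B. \<forall>x\<in>unit_cube. \<bar>Df (i # \<beta>) x\<bar> \<le> B" for i
      proof -
        obtain C w where Cw: "0 \<le> C" "0 < w"
            "\<forall>x\<in>unit_cube. \<forall>y\<in>unit_cube. \<bar>Df (i # \<beta>) x - Df (i # \<beta>) y\<bar> \<le> C * norm (x - y) powr w"
          using Suc len by (meson Suc_leD)
        have "\<bar>Df (i # \<beta>) x\<bar> \<le> \<bar>Df (i # \<beta>) 0\<bar> + C * real CARD('d) powr w" if "x \<in> unit_cube" for x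
        proof -
          have "\<bar>Df (i # \<beta>) x - Df (i # \<beta>) 0\<bar> \<le> C * norm (x - 0) powr w"
            using Cw(3) that z by blast
          also have "\<dots> \<le> C * real CARD('d) powr w"
            using Cw norm_unit_cube_le[OF that] by (intro mult_left_mono powr_mono2) auto
          finally show ?thesis by linarith
        qed
        then show ?thesis by blast
      qed
      then obtain B where B: "\<And>i x. x \<in> unit_cube \<Longrightarrow> \<bar>Df (i # \<beta>) x\<bar> \<le> B i" by metis
      define BB where "BB = (\<Sum>i\<in>UNIV. \<bar>B i\<bar>)"
      have BB: "\<bar>Df (i # \<beta>) x\<bar> \<le> BB" if "x \<in> unit_cube" for i x
      proof -
        have "\<bar>B i\<bar> \<le> BB" unfolding BB_def by (rule member_le_sum) auto
        then show ?thesis using B[OF that, of i] by linarith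
      qed
      have BB0: "0 \<le> BB" unfolding BB_def by (intro sum_nonneg) auto
      show "\<exists>C v. 0 \<le> C \<and> 0 < v \<and>
          (\<forall>x\<in>unit_cube. \<forall>y\<in>unit_cube. \<bar>Df \<beta> x - Df \<beta> y\<bar> \<le> C * norm (x - y) powr v)"
      proof (rule exI[of _ "real CARD('d) * BB"], rule exI[of _ 1], intro conjI ballI)
        fix x y :: "real^'d" assume "x \<in> unit_cube" "y \<in> unit_cube"
        then show "\<bar>Df \<beta> x - Df \<beta> y\<bar> \<le> real CARD('d) * BB * norm (x - y) powr 1"
          using cube_lipschitz[where F="Df \<beta>" and DF="\<lambda>i. Df (i # \<beta>)" and B=BB, OF Dfd[OF lt] BB] by simp
      qed (use BB0 in auto)
    qed
  qed
  from this[of u] show ?thesis using Df0 by simp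
qed

lemma lip_class_modulus:
  fixes f :: "real^'d \<Rightarrow> real"
  assumes "lip_class r c0 f" "0 < r" "0 < c0"
  shows "\<exists>\<gamma>>0. \<forall>x\<in>unit_cube. \<forall>y\<in>unit_cube. dist x y < \<gamma> \<longrightarrow> \<bar>f x - f y\<bar> < 1"
proof -
  obtain C v where C: "0 \<le> C" "0 < v"
      "\<And>x y. x \<in> unit_cube \<Longrightarrow> y \<in> unit_cube \<Longrightarrow> \<bar>f x - f y\<bar> \<le> C * norm (x - y) powr v"
    using lip_class_holder[OF assms] by blast
  \<comment> \<open>Chosen so that \<open>C * \<gamma> powr v = C / (C + 1) < 1\<close>, also when
    \<open>C = 0\<close>.\<close>
  define \<gamma> where "\<gamma> = (1 / (C + 1)) powr (1 / v)"
  show ?thesis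
  proof (intro exI[of _ \<gamma>] conjI ballI impI)
    show "0 < \<gamma>" using C by (simp add: \<gamma>_def)
    fix x y :: "real^'d" assume xy: "x \<in> unit_cube" "y \<in> unit_cube" "dist x y < \<gamma>"
    have "norm (x - y) powr v \<le> \<gamma> powr v" using xy C by (intro powr_mono2) (auto simp: dist_norm)
    also have "\<dots> = 1 / (C + 1)" using C by (simp add: \<gamma>_def powr_powr)
    finally have "C * norm (x - y) powr v \<le> C * (1 / (C + 1))" using C by (intro mult_left_mono) auto
    also have "\<dots> < 1" using C by (simp add: field_simps)
    finally show "\<bar>f x - f y\<bar> < 1" using C(3)[OF xy(1,2)] by linarith
  qed
qed

text \<open>On \<open>[-1, 1]\<close> the conditional risk is affine with slope
  \<open>1 - 2 * \<eta> x\<close>, and beyond a kink it is at least its value there. Inequalities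
  are the best possible: for \<open>\<eta> x\<close> equal to 0 or 1 the minimizers form a
  half-line.\<close>

lemma hinge_minimizer_separates:
  assumes min: "\<And>t. cond_hinge_risk \<eta> x s \<le> cond_hinge_risk \<eta> x t" and eta: "0 \<le> \<eta> x" "\<eta> x \<le> 1"
  shows "1 / 2 < \<eta> x \<Longrightarrow> 1 \<le> s" "\<eta> x < 1 / 2 \<Longrightarrow> s \<le> - 1"
proof -
  have 1: "cond_hinge_risk \<eta> x 1 = 2 * (1 - \<eta> x)" "cond_hinge_risk \<eta> x (-1) = 2 * \<eta> x"
    by (simp_all add: cond_hinge_risk_def hinge_def)
  have 2: "cond_hinge_risk \<eta> x s = 1 - (2 * \<eta> x - 1) * s" if "- 1 \<le> s" "s \<le> 1"
  proof -
    have "hinge s = 1 - s" "hinge (- s) = 1 + s" using that by (auto simp: hinge_def)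
    then show ?thesis by (simp only: cond_hinge_risk_def) (simp add: algebra_simps)
  qed
  have 3: "cond_hinge_risk \<eta> x s = \<eta> x * (1 - s)" if "s < - 1"
    using that by (simp add: cond_hinge_risk_def hinge_def max_def)
  have 4: "cond_hinge_risk \<eta> x s = (1 - \<eta> x) * (1 + s)" if "1 < s"
    using that by (simp add: cond_hinge_risk_def hinge_def max_def)
  show "1 \<le> s" if h: "1 / 2 < \<eta> x"
  proof (rule ccontr)
    assume "\<not> 1 \<le> s"
    then consider "s < - 1" | "- 1 \<le> s" "s < 1" by linarith
    then show False
    proof cases
      case 1
      have "\<eta> x * 2 \<le> \<eta> x * (1 - s)" using 1 eta by (intro mult_left_mono) auto
      then have "\<eta> x * 2 \<le> cond_hinge_risk \<eta> x s" using 3[OF 1] by simp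
      then show False using min[of 1] \<open>cond_hinge_risk \<eta> x 1 = _\<close> h by simp
    next
      case 2
      have "0 < (2 * \<eta> x - 1) * (1 - s)" using 2 h by simp
      then have "(2 * \<eta> x - 1) * s < 2 * \<eta> x - 1" by (simp add: algebra_simps)
      then show False using min[of 1] \<open>\<lbrakk>- 1 \<le> s; s \<le> 1\<rbrakk> \<Longrightarrow> _\<close> 2 \<open>cond_hinge_risk \<eta> x 1 = _\<close> by auto
    qed
  qed
  show "s \<le> - 1" if h: "\<eta> x < 1 / 2"
  proof (rule ccontr)
    assume "\<not> s \<le> - 1"
    then consider "1 < s" | "- 1 < s" "s \<le> 1" by linarith
    then show False
    proof cases
      case 1
      have "(1 - \<eta> x) * 2 \<le> (1 - \<eta> x) * (1 + s)" using 1 eta by (intro mult_left_mono) auto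
      then have "(1 - \<eta> x) * 2 \<le> cond_hinge_risk \<eta> x s" using 4[OF 1] by simp
      then show False using min[of "-1"] \<open>cond_hinge_risk \<eta> x (-1) = _\<close> h by simp
    next
      case 2
      have "0 < (1 - 2 * \<eta> x) * (1 + s)" using 2 h by simp
      then have "(2 * \<eta> x - 1) * s < 1 - 2 * \<eta> x" by (simp add: algebra_simps)
      then show False using min[of "-1"] \<open>\<lbrakk>- 1 \<le> s; s \<le> 1\<rbrakk> \<Longrightarrow> _\<close> 2 \<open>cond_hinge_risk \<eta> x (-1) = _\<close> by auto
    qed
  qed
qed

section \<open>Concentration and the classification risk\<close>

lemma exp_le_quadratic:
  fixes x :: real
  assumes "\<bar>x\<bar> \<le> 1"
  shows "exp x \<le> 1 + x + x\<^sup>2"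
proof (cases "0 \<le> x")
  case True
  then show ?thesis using exp_bound[of x] assms by simp
next
  case False
  define y where "y = - x"
  have y: "0 \<le> y" using False by (simp add: y_def)
  have pos: "0 < 1 + y" using y by simp
  have "exp (- y) \<le> 1 / (1 + y)"
    using exp_ge_add_one_self[of y] pos by (simp add: exp_minus inverse_eq_divide frac_le)
  also have "\<dots> \<le> 1 - y + y\<^sup>2"
  proof -
    have "(1 - y + y\<^sup>2) * (1 + y) = 1 + y ^ 3" by (simp add: algebra_simps power2_eq_square power3_eq_cube)
    then have "1 \<le> (1 - y + y\<^sup>2) * (1 + y)" using y by simp
    then show ?thesis using pos by (simp add: divide_le_eq)
  qed
  finally show ?thesis by (simp add: y_def)
qed

text \<open>Exponential Markov inequality at a fixed parameter. The bounds on
  \<open>\<theta>\<close> and \<open>F\<close> keep \<open>\<theta> * F z\<close> in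
  \<open>[-1, 1]\<close>, where \<open>exp_le_quadratic\<close> applies. The raw second moment is
  kept because that is what the noise condition controls.\<close>

lemma (in prob_space) iid_sum_deviation:
  fixes F :: "'a \<Rightarrow> real" and m :: nat
  assumes F [measurable]: "F \<in> borel_measurable M" and bnd: "AE z in M. \<bar>F z\<bar> \<le> 2"
    and \<theta>: "0 < \<theta>" "\<theta> \<le> 1 / 2"
  shows "measure (PiM {..<m} (\<lambda>_. M)) {D \<in> space (PiM {..<m} (\<lambda>_. M)).
      real m * (expectation F + \<theta> * expectation (\<lambda>z. (F z)\<^sup>2)) + \<tau> / \<theta> \<le> (\<Sum>i<m. F (D i))} \<le> exp (- \<tau>)"
proof -
  let ?P = "PiM {..<m} (\<lambda>_. M)"
  interpret PS: product_sigma_finite "\<lambda>_::nat. M" by standard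
  interpret PP: prob_space ?P by (intro prob_space_PiM) (rule prob_space_axioms)
  have intF: "integrable M F" by (rule integrable_const_bound[of _ 2]) (use bnd in auto)
  have "AE z in M. (F z)\<^sup>2 \<le> 4"
    using bnd by eventually_elim (use power_mono[of "\<bar>F z\<bar>" 2 2 for z] in simp)
  then have intF2: "integrable M (\<lambda>z. (F z)\<^sup>2)" by (intro integrable_const_bound[of _ 4]) auto
  have ab: "AE z in M. \<bar>\<theta> * F z\<bar> \<le> 1"
    using bnd by eventually_elim (use \<theta> mult_mono[OF \<theta>(2), of "\<bar>F z\<bar>" 2 for z] in \<open>simp add: abs_mult\<close>)
  have intE: "integrable M (\<lambda>z. exp (\<theta> * F z))"
  proof (rule integrable_const_bound[of _ "exp 1"])
    show "AE z in M. norm (exp (\<theta> * F z)) \<le> exp 1"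
      using ab by eventually_elim (simp add: abs_le_iff)
  qed simp
  have quad: "AE z in M. exp (\<theta> * F z) \<le> 1 + \<theta> * F z + \<theta>\<^sup>2 * (F z)\<^sup>2"
    using ab by eventually_elim (simp add: exp_le_quadratic[of "\<theta> * F z" for z, unfolded power_mult_distrib])
  define a where "a = \<theta> * expectation F + \<theta>\<^sup>2 * expectation (\<lambda>z. (F z)\<^sup>2)"
  have "expectation (\<lambda>z. exp (\<theta> * F z)) \<le> expectation (\<lambda>z. 1 + \<theta> * F z + \<theta>\<^sup>2 * (F z)\<^sup>2)"
    using intE intF intF2 quad by (intro integral_mono_AE) auto
  also have "\<dots> = 1 + a" using intF intF2 by (simp add: a_def prob_space)
  also have "\<dots> \<le> exp a" by (rule exp_ge_add_one_self)
  finally have mgf: "expectation (\<lambda>z. exp (\<theta> * F z)) \<le> exp a" .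
  have intP: "integrable ?P (\<lambda>D. \<Prod>i<m. exp (\<theta> * F (D i)))"
    by (rule PS.product_integrable_prod) (use intE in auto)
  have "(\<integral>D. (\<Prod>i<m. exp (\<theta> * F (D i))) \<partial>?P) = (\<Prod>i<m. expectation (\<lambda>z. exp (\<theta> * F z)))"
    by (rule PS.product_integral_prod) (use intE in auto)
  also have "\<dots> \<le> exp (real m * a)"
    using mgf power_mono[OF mgf, of m] by (simp add: exp_of_nat_mult)
  finally have EP: "(\<integral>D. (\<Prod>i<m. exp (\<theta> * F (D i))) \<partial>?P) \<le> exp (real m * a)" .
  define c where "c = exp (real m * a + \<tau>)"
  have "{D \<in> space ?P. real m * (expectation F + \<theta> * expectation (\<lambda>z. (F z)\<^sup>2)) + \<tau> / \<theta> \<le> (\<Sum>i<m. F (D i))}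
      = {D \<in> space ?P. c \<le> (\<Prod>i<m. exp (\<theta> * F (D i)))}"
  proof (intro Collect_cong conj_cong refl)
    fix D
    have "c \<le> (\<Prod>i<m. exp (\<theta> * F (D i))) \<longleftrightarrow> real m * a + \<tau> \<le> \<theta> * (\<Sum>i<m. F (D i))"
      by (simp add: c_def exp_sum[symmetric] sum_distrib_left)
    also have "real m * a + \<tau> = \<theta> * (real m * (expectation F + \<theta> * expectation (\<lambda>z. (F z)\<^sup>2)) + \<tau> / \<theta>)"
      using \<theta> by (simp add: a_def power2_eq_square algebra_simps)
    finally show "real m * (expectation F + \<theta> * expectation (\<lambda>z. (F z)\<^sup>2)) + \<tau> / \<theta> \<le> (\<Sum>i<m. F (D i)) \<longleftrightarrow>
        c \<le> (\<Prod>i<m. exp (\<theta> * F (D i)))" using \<theta> by simp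
  qed
  also have "measure ?P \<dots> \<le> (\<integral>D. (\<Prod>i<m. exp (\<theta> * F (D i))) \<partial>?P) / c"
    by (rule integral_Markov_inequality_measure[OF intP, of "space ?P"])
      (auto simp: c_def prod_nonneg intro!: always_eventually)
  also have "\<dots> \<le> exp (real m * a) / c" using EP by (intro divide_right_mono) (auto simp: c_def)
  also have "\<dots> = exp (- \<tau>)" by (simp add: c_def exp_diff[symmetric])
  finally show ?thesis .
qed

section \<open>Conditional label probabilities, linearized hinge loss and its second moment\<close>

locale binary_classification =
  fixes \<rho> :: "((real^'d) \<times> real) measure" and \<eta> :: "real^'d \<Rightarrow> real"
  assumes prob: "prob_space \<rho>"
    and sets_rho [measurable_cong]: "sets \<rho> = sets (borel :: ((real^'d) \<times> real) measure)"
    and supp: "emeasure \<rho> (unit_cube \<times> {-1, 1}) = 1"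
    and eta_meas [measurable]: "\<eta> \<in> borel_measurable borel"
    and eta_range: "\<And>x. 0 \<le> \<eta> x" "\<And>x. \<eta> x \<le> 1"
    and eta_cond: "\<And>A. A \<in> sets borel \<Longrightarrow>
        measure \<rho> (A \<times> {1}) = set_lebesgue_integral (distr \<rho> borel fst) A \<eta>"
begin

sublocale prob_space \<rho> by (rule prob)

abbreviation "\<rho>X \<equiv> distr \<rho> borel fst"

lemma space_rho: "space \<rho> = UNIV"
  using sets_eq_imp_space_eq[OF sets_rho] by simp

lemma fst_meas [measurable]: "fst \<in> measurable \<rho> borel"
  by (rule measurable_cong_sets[OF sets_rho refl, THEN equalityD2, THEN subsetD]) (simp add: borel_measurable_continuous_onI continuous_on_fst continuous_on_id)

lemma snd_meas [measurable]: "snd \<in> borel_measurable \<rho>"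
  by (rule measurable_cong_sets[OF sets_rho refl, THEN equalityD2, THEN subsetD]) (simp add: borel_measurable_continuous_onI continuous_on_snd continuous_on_id)

lemma prob_X: "prob_space \<rho>X"
  by (rule prob_space_distr) simp

sublocale X: prob_space \<rho>X by (rule prob_X)

lemma unit_cube_meas [measurable]: "unit_cube \<in> sets (borel :: (real^'d) measure)"
  by (simp add: unit_cube_def)

lemma AE_supp: "AE z in \<rho>. fst z \<in> unit_cube \<and> (snd z = 1 \<or> snd z = - 1)"
proof -
  have "AE z in \<rho>. z \<in> unit_cube \<times> {-1, 1}"
  proof (subst AE_in_set_eq_1)
    have "closed ((unit_cube :: (real^'d) set) \<times> {-1, 1::real})"
      by (intro closed_Times) (auto simp: unit_cube_def closed_cbox)
    then show "unit_cube \<times> {-1, 1} \<in> events" by (simp add: sets_rho)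
    show "prob (unit_cube \<times> {-1, 1}) = 1" using supp by (simp add: measure_def)
  qed
  then show ?thesis by eventually_elim auto
qed

lemma AE_X: "AE x in \<rho>X. x \<in> unit_cube"
  using AE_supp by (subst AE_distr_iff) auto

lemma AE_label: "AE z in \<rho>. snd z = 1 \<or> snd z = - 1"
  using AE_supp by eventually_elim auto

lemma bounded_integrable_X:
  fixes \<phi> :: "real^'d \<Rightarrow> real"
  assumes "\<phi> \<in> borel_measurable borel" "\<And>x. \<bar>\<phi> x\<bar> \<le> B"
  shows "integrable \<rho>X \<phi>"
  by (rule X.integrable_const_bound[of _ B]) (use assms in auto)

text \<open>Lifts the defining property of \<open>\<eta>\<close> from sets to an equality of
  measures, so that functions of \<open>x\<close> can be integrated against the positive
  labels.\<close>

lemma joint_positive_label: "distr (density \<rho> (\<lambda>z. indicator {1} (snd z))) borel fst = density \<rho>X (\<lambda>x. ennreal (\<eta> x))"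
proof (rule measure_eqI)
  fix A assume "A \<in> sets (distr (density \<rho> (\<lambda>z. indicator {1} (snd z))) borel fst)"
  then have A [measurable]: "A \<in> sets borel" by simp
  have "emeasure (distr (density \<rho> (\<lambda>z. indicator {1} (snd z))) borel fst) A
      = (\<integral>\<^sup>+z. indicator {1} (snd z) * indicator (fst -` A \<inter> space \<rho>) z \<partial>\<rho>)"
    by (subst emeasure_distr) (auto simp: emeasure_density)
  also have "\<dots> = (\<integral>\<^sup>+z. indicator (A \<times> {1}) z \<partial>\<rho>)"
    by (intro nn_integral_cong) (auto simp: indicator_def space_rho)
  also have "\<dots> = emeasure \<rho> (A \<times> {1})"
  proof (rule nn_integral_indicator)
    have "A \<times> {1} = {z \<in> space \<rho>. fst z \<in> A \<and> snd z = 1}" by (auto simp: space_rho)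
    also have "\<dots> \<in> sets \<rho>" by measurable
    finally show "A \<times> {1} \<in> sets \<rho>" .
  qed
  also have "\<dots> = ennreal (set_lebesgue_integral \<rho>X A \<eta>)"
    using eta_cond[OF A] by (simp add: emeasure_eq_measure)
  also have "\<dots> = (\<integral>\<^sup>+x. ennreal (indicator A x *\<^sub>R \<eta> x) \<partial>\<rho>X)"
    unfolding set_lebesgue_integral_def
    by (rule nn_integral_eq_integral[symmetric], rule bounded_integrable_X[of _ 1])
      (use eta_range in \<open>auto simp: indicator_def intro!: always_eventually\<close>)
  also have "\<dots> = (\<integral>\<^sup>+x. ennreal (\<eta> x) * indicator A x \<partial>\<rho>X)"
    by (intro nn_integral_cong) (auto simp: indicator_def)
  also have "\<dots> = emeasure (density \<rho>X (\<lambda>x. ennreal (\<eta> x))) A"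
    by (simp add: emeasure_density)
  finally show "emeasure (distr (density \<rho> (\<lambda>z. indicator {1} (snd z))) borel fst) A = emeasure (density \<rho>X (\<lambda>x. ennreal (\<eta> x))) A" .
qed simp

text \<open>The conditional mean of the label is \<open>2 * \<eta> x - 1\<close>, since almost
  surely the label is twice the indicator of 1, minus 1.\<close>

lemma integral_label:
  assumes \<phi> [measurable]: "\<phi> \<in> borel_measurable borel" and bnd: "\<And>x. \<bar>\<phi> x\<bar> \<le> B"
  shows "(\<integral>z. snd z * \<phi> (fst z) \<partial>\<rho>) = (\<integral>x. (2 * \<eta> x - 1) * \<phi> x \<partial>\<rho>X)"
proof -
  have B0: "0 \<le> B" using bnd[of 0] by linarith
  have i1: "integrable \<rho> (\<lambda>z. indicator {1} (snd z) * \<phi> (fst z))"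
    by (rule integrable_const_bound[of _ B]) (use bnd B0 in \<open>auto simp: indicator_def\<close>)
  have i2: "integrable \<rho> (\<lambda>z. \<phi> (fst z))"
    by (rule integrable_const_bound[of _ B]) (use bnd in auto)
  have i3: "integrable \<rho>X (\<lambda>x. \<eta> x * \<phi> x)"
  proof (rule bounded_integrable_X[of _ "1 * B"])
    fix x show "\<bar>\<eta> x * \<phi> x\<bar> \<le> 1 * B"
      unfolding abs_mult using eta_range[of x] bnd[of x] by (intro mult_mono) auto
  qed simp
  have i4: "integrable \<rho>X \<phi>" by (rule bounded_integrable_X[OF \<phi> bnd])
  have "(\<integral>z. indicator {1} (snd z) * \<phi> (fst z) \<partial>\<rho>) = (\<integral>x. \<phi> x \<partial>distr (density \<rho> (\<lambda>z. indicator {1} (snd z))) borel fst)"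
  proof -
    have "(\<integral>x. \<phi> x \<partial>distr (density \<rho> (\<lambda>z. ennreal (indicator {1} (snd z)))) borel fst) = (\<integral>z. \<phi> (fst z) \<partial>density \<rho> (\<lambda>z. ennreal (indicator {1} (snd z))))"
      by (rule integral_distr) auto
    also have "\<dots> = (\<integral>z. indicator {1} (snd z) *\<^sub>R \<phi> (fst z) \<partial>\<rho>)"
      by (rule integral_density) auto
    finally show ?thesis by (simp add: ennreal_indicator)
  qed
  also have "\<dots> = (\<integral>x. \<eta> x *\<^sub>R \<phi> x \<partial>\<rho>X)"
    unfolding joint_positive_label by (rule integral_density) (use eta_range in auto)
  finally have 1: "(\<integral>z. indicator {1} (snd z) * \<phi> (fst z) \<partial>\<rho>) = (\<integral>x. \<eta> x * \<phi> x \<partial>\<rho>X)" by simp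
  have "(\<integral>z. snd z * \<phi> (fst z) \<partial>\<rho>) = (\<integral>z. 2 * (indicator {1} (snd z) * \<phi> (fst z)) - \<phi> (fst z) \<partial>\<rho>)"
  proof (rule integral_cong_AE)
    show "AE z in \<rho>. snd z * \<phi> (fst z) = 2 * (indicator {1} (snd z) * \<phi> (fst z)) - \<phi> (fst z)"
      using AE_label by eventually_elim auto
  qed auto
  also have "\<dots> = 2 * (\<integral>z. indicator {1} (snd z) * \<phi> (fst z) \<partial>\<rho>) - (\<integral>z. \<phi> (fst z) \<partial>\<rho>)"
    using i1 i2 by simp
  also have "(\<integral>z. \<phi> (fst z) \<partial>\<rho>) = (\<integral>x. \<phi> x \<partial>\<rho>X)" by (rule integral_distr[symmetric]) auto
  also have "2 * (\<integral>z. indicator {1} (snd z) * \<phi> (fst z) \<partial>\<rho>) - (\<integral>x. \<phi> x \<partial>\<rho>X)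
      = (\<integral>x. 2 * (\<eta> x * \<phi> x) - \<phi> x \<partial>\<rho>X)" using 1 i3 i4 by simp
  also have "\<dots> = (\<integral>x. (2 * \<eta> x - 1) * \<phi> x \<partial>\<rho>X)" by (simp add: algebra_simps)
  finally show ?thesis .
qed

abbreviation "fs \<equiv> bayes_rule \<eta>"

lemma fs_meas [measurable]: "fs \<in> borel_measurable borel"
  unfolding bayes_rule_def[abs_def] by measurable

text \<open>For \<open>\<bar>g x\<bar> \<le> 1\<close> and labels \<open>1\<close> or
  \<open>-1\<close>, this is the hinge loss of \<open>g\<close> minus that of the Bayes
  rule.\<close>

definition ell :: "(real^'d \<Rightarrow> real) \<Rightarrow> (real^'d) \<times> real \<Rightarrow> real" where
  "ell g z = snd z * (fs (fst z) - g (fst z))"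

definition excess :: "(real^'d \<Rightarrow> real) \<Rightarrow> real" where
  "excess g = (\<integral>x. \<bar>2 * \<eta> x - 1\<bar> * \<bar>fs x - g x\<bar> \<partial>\<rho>X)"

lemma fs_diff_le: "\<bar>g x\<bar> \<le> 1 \<Longrightarrow> \<bar>fs x - g x\<bar> \<le> 2"
  by (auto simp: bayes_rule_def)

lemma eta_abs_le: "\<bar>2 * \<eta> x - 1\<bar> \<le> 1"
  using eta_range[of x] by auto

lemma excess_integrable:
  assumes [measurable]: "g \<in> borel_measurable borel" and "\<And>x. \<bar>g x\<bar> \<le> 1"
  shows "integrable \<rho>X (\<lambda>x. \<bar>2 * \<eta> x - 1\<bar> * \<bar>fs x - g x\<bar>)"
proof (rule bounded_integrable_X[of _ "1 * 2"])
  fix x show "\<bar>\<bar>2 * \<eta> x - 1\<bar> * \<bar>fs x - g x\<bar>\<bar> \<le> 1 * 2"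
    unfolding abs_mult abs_abs using eta_abs_le fs_diff_le assms(2) by (intro mult_mono) auto
qed simp

lemma excess_ge0: "0 \<le> excess g"
  unfolding excess_def by simp

text \<open>The factors \<open>2 * \<eta> x - 1\<close> and \<open>fs x - g x\<close> never have
  opposite signs, because \<open>fs\<close> takes the extreme value on the correct side of
  \<open>g\<close>.\<close>

lemma expectation_ell:
  assumes [measurable]: "g \<in> borel_measurable borel" and g: "\<And>x. \<bar>g x\<bar> \<le> 1"
  shows "(\<integral>z. ell g z \<partial>\<rho>) = excess g"
proof -
  have "(\<integral>z. ell g z \<partial>\<rho>) = (\<integral>x. (2 * \<eta> x - 1) * (fs x - g x) \<partial>\<rho>X)"
    unfolding ell_def by (rule integral_label[of _ 2]) (use fs_diff_le g in auto)
  also have "\<dots> = excess g"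
    unfolding excess_def
  proof (rule Bochner_Integration.integral_cong[OF refl])
    fix x
    show "(2 * \<eta> x - 1) * (fs x - g x) = \<bar>2 * \<eta> x - 1\<bar> * \<bar>fs x - g x\<bar>"
      using g[of x] by (auto simp: bayes_rule_def abs_mult[symmetric] abs_le_iff mult_nonpos_nonpos)
  qed
  finally show ?thesis .
qed

text \<open>Where the margin \<open>\<bar>2 * \<eta> x - 1\<bar>\<close> is at most
  \<open>ch * t\<close>, the square is at most 4 and the noise condition bounds the mass. Elsewhere
  the square is at most \<open>2 * \<bar>fs x - g x\<bar>\<close>, and dividing by the margin
  recovers the integrand of \<open>excess\<close>.\<close>

lemma variance_ell:
  assumes [measurable]: "g \<in> borel_measurable borel" and g: "\<And>x. \<bar>g x\<bar> \<le> 1"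
    and ch: "0 < ch" "0 < t"
    and tsy: "measure \<rho>X {x. \<bar>2 * \<eta> x - 1\<bar> \<le> ch * t} \<le> t powr q"
  shows "(\<integral>z. (ell g z)\<^sup>2 \<partial>\<rho>) \<le> 2 / (ch * t) * excess g + 4 * t powr q"
proof -
  define N where "N = {x. \<bar>2 * \<eta> x - 1\<bar> \<le> ch * t}"
  have [measurable]: "N \<in> sets borel" unfolding N_def by measurable
  have cht: "0 < ch * t" using ch by simp
  have iN: "integrable \<rho>X (\<lambda>x. 4 * indicator N x :: real)" by (rule bounded_integrable_X[of _ 4]) (auto simp: indicator_def)
  have "(\<integral>z. (ell g z)\<^sup>2 \<partial>\<rho>) = (\<integral>z. (fs (fst z) - g (fst z))\<^sup>2 \<partial>\<rho>)"
  proof (rule integral_cong_AE)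
    show "AE z in \<rho>. (ell g z)\<^sup>2 = (fs (fst z) - g (fst z))\<^sup>2"
      using AE_label by eventually_elim (auto simp: ell_def power_mult_distrib)
  qed (auto simp: ell_def)
  also have "\<dots> = (\<integral>x. (fs x - g x)\<^sup>2 \<partial>\<rho>X)" by (rule integral_distr[symmetric]) auto
  also have "\<dots> \<le> (\<integral>x. 2 / (ch * t) * (\<bar>2 * \<eta> x - 1\<bar> * \<bar>fs x - g x\<bar>) + 4 * indicator N x \<partial>\<rho>X)"
  proof (rule integral_mono)
    have sq: "(fs x - g x)\<^sup>2 \<le> 2 * \<bar>fs x - g x\<bar>" for x
      using mult_right_mono[OF fs_diff_le[of g x, OF g], of "\<bar>fs x - g x\<bar>"] by (simp add: power2_eq_square)
    show "integrable \<rho>X (\<lambda>x. (fs x - g x)\<^sup>2)"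
    proof (rule bounded_integrable_X[of _ 4])
      fix x show "\<bar>(fs x - g x)\<^sup>2\<bar> \<le> 4" using sq[of x] fs_diff_le[of g x, OF g] by simp
    qed simp
    show "integrable \<rho>X (\<lambda>x. 2 / (ch * t) * (\<bar>2 * \<eta> x - 1\<bar> * \<bar>fs x - g x\<bar>) + 4 * indicator N x)"
      by (intro Bochner_Integration.integrable_add integrable_mult_right excess_integrable g iN) auto
    fix x
    show "(fs x - g x)\<^sup>2 \<le> 2 / (ch * t) * (\<bar>2 * \<eta> x - 1\<bar> * \<bar>fs x - g x\<bar>) + 4 * indicator N x"
    proof (cases "x \<in> N")
      case True
      have "0 \<le> 2 / (ch * t) * (\<bar>2 * \<eta> x - 1\<bar> * \<bar>fs x - g x\<bar>)" using cht by simp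
      then show ?thesis using True sq[of x] fs_diff_le[of g x, OF g] by simp
    next
      case False
      then have "1 \<le> \<bar>2 * \<eta> x - 1\<bar> / (ch * t)" using cht by (simp add: N_def)
      then have "1 * \<bar>fs x - g x\<bar> \<le> \<bar>2 * \<eta> x - 1\<bar> / (ch * t) * \<bar>fs x - g x\<bar>" by (intro mult_right_mono) auto
      then show ?thesis using False sq[of x] by simp
    qed
  qed
  also have "\<dots> = 2 / (ch * t) * excess g + 4 * measure \<rho>X N"
    using iN excess_integrable[OF assms(1) g] by (simp add: excess_def)
  also have "\<dots> \<le> 2 / (ch * t) * excess g + 4 * t powr q" using tsy by (simp add: N_def)
  finally show ?thesis .
qed

section \<open>Clipping, comparison of hinge and classification risk, stability of the
  excess\<close>

definition clip :: "(real^'d \<Rightarrow> real) \<Rightarrow> real^'d \<Rightarrow> real" where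
  "clip f x = max (-1) (min 1 (f x))"

lemma clip_meas [measurable]: "f \<in> borel_measurable borel \<Longrightarrow> clip f \<in> borel_measurable borel"
  unfolding clip_def[abs_def] by (intro borel_measurable_max borel_measurable_min borel_measurable_const)

lemma clip_le1: "\<bar>clip f x\<bar> \<le> 1"
  by (auto simp: clip_def max_def min_def)

lemma risk_eq:
  assumes [measurable]: "c \<in> borel_measurable borel" and c: "\<And>x. c x = 1 \<or> c x = - 1"
  shows "risk \<rho> c = (1 - (\<integral>z. snd z * c (fst z) \<partial>\<rho>)) / 2"
proof -
  have i: "integrable \<rho> (\<lambda>z. snd z * c (fst z))"
  proof (rule integrable_const_bound[of _ 1])
    show "AE z in \<rho>. norm (snd z * c (fst z)) \<le> 1"
      using AE_supp
    proof eventually_elim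
      case (elim z)
      then show ?case using c[of "fst z"] by auto
    qed
  qed simp
  have "risk \<rho> c = (\<integral>z. indicator {z \<in> space \<rho>. c (fst z) \<noteq> snd z} z \<partial>\<rho>)"
    by (simp add: risk_def)
  also have "\<dots> = (\<integral>z. (1 - snd z * c (fst z)) / 2 \<partial>\<rho>)"
  proof (rule integral_cong_AE)
    show "AE z in \<rho>. indicator {z \<in> space \<rho>. c (fst z) \<noteq> snd z} z = (1 - snd z * c (fst z)) / 2"
      using AE_supp
    proof eventually_elim
      case (elim z)
      then show ?case using c[of "fst z"] by (auto simp: indicator_def space_rho)
    qed
  qed auto
  also have "\<dots> = (1 - (\<integral>z. snd z * c (fst z) \<partial>\<rho>)) / 2" using i by (simp add: prob_space)
  finally show ?thesis .
qed

text \<open>For classifiers with values \<open>1\<close> and \<open>-1\<close> the excess risk is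
  half of \<open>excess\<close>. If the sign of \<open>f\<close> disagrees with \<open>fs\<close>,
  the clipped value is at distance at least 1 from \<open>fs\<close>; if it agrees, the left side
  vanishes.\<close>

lemma excess_risk_le:
  assumes [measurable]: "f \<in> borel_measurable borel"
  shows "risk \<rho> (sign_clf f) - risk \<rho> fs \<le> excess (clip f)"
proof -
  have [measurable]: "sign_clf f \<in> borel_measurable borel" unfolding sign_clf_def[abs_def] by measurable
  have s1: "\<bar>sign_clf f x\<bar> \<le> 1" for x by (simp add: sign_clf_def)
  have i1: "integrable \<rho> (\<lambda>z. snd z * fs (fst z))" "integrable \<rho> (\<lambda>z. snd z * sign_clf f (fst z))"
  proof -
    have "AE z in \<rho>. norm (snd z * fs (fst z)) \<le> 1" "AE z in \<rho>. norm (snd z * sign_clf f (fst z)) \<le> 1"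
      using AE_label by (eventually_elim, auto simp: bayes_rule_def sign_clf_def)+
    then show "integrable \<rho> (\<lambda>z. snd z * fs (fst z))" "integrable \<rho> (\<lambda>z. snd z * sign_clf f (fst z))"
      by (auto intro!: integrable_const_bound[of _ 1])
  qed
  have "risk \<rho> (sign_clf f) - risk \<rho> fs = (\<integral>z. snd z * fs (fst z) \<partial>\<rho>) / 2 - (\<integral>z. snd z * sign_clf f (fst z) \<partial>\<rho>) / 2"
    by (subst (1 2) risk_eq) (auto simp: sign_clf_def bayes_rule_def diff_divide_distrib)
  also have "\<dots> = (\<integral>z. ell (sign_clf f) z \<partial>\<rho>) / 2"
    using i1 by (simp add: ell_def right_diff_distrib diff_divide_distrib)
  also have "\<dots> = excess (sign_clf f) / 2" by (subst expectation_ell) (use s1 in auto)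
  also have "\<dots> = (\<integral>x. (\<bar>2 * \<eta> x - 1\<bar> * \<bar>fs x - sign_clf f x\<bar>) / 2 \<partial>\<rho>X)" by (simp add: excess_def)
  also have "\<dots> \<le> excess (clip f)"
    unfolding excess_def
  proof (rule integral_mono)
    show "integrable \<rho>X (\<lambda>x. \<bar>2 * \<eta> x - 1\<bar> * \<bar>fs x - sign_clf f x\<bar> / 2)"
      using excess_integrable[of "sign_clf f"] s1 by auto
    show "integrable \<rho>X (\<lambda>x. \<bar>2 * \<eta> x - 1\<bar> * \<bar>fs x - clip f x\<bar>)"
      by (rule excess_integrable) (auto simp: clip_le1)
    fix x
    have "\<bar>fs x - sign_clf f x\<bar> / 2 \<le> \<bar>fs x - clip f x\<bar>"
      by (auto simp: bayes_rule_def sign_clf_def clip_def max_def min_def)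
    then show "\<bar>2 * \<eta> x - 1\<bar> * \<bar>fs x - sign_clf f x\<bar> / 2 \<le> \<bar>2 * \<eta> x - 1\<bar> * \<bar>fs x - clip f x\<bar>"
      using mult_left_mono[of _ _ "\<bar>2 * \<eta> x - 1\<bar>"] by fastforce
  qed
  finally show ?thesis .
qed

text \<open>The weight in \<open>excess\<close> vanishes where \<open>\<eta> x = 1 / 2\<close>, so
  no approximation is asked for there.\<close>

lemma excess_le_sup:
  assumes "g \<in> borel_measurable borel" "\<And>x. \<bar>g x\<bar> \<le> 1" "0 \<le> e"
    and close: "\<And>x. x \<in> unit_cube \<Longrightarrow> \<eta> x \<noteq> 1 / 2 \<Longrightarrow> \<bar>fs x - g x\<bar> \<le> e"
  shows "excess g \<le> e"
proof -
  have "excess g \<le> (\<integral>x. e \<partial>\<rho>X)"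
    unfolding excess_def
  proof (rule integral_mono_AE[OF excess_integrable[OF assms(1,2)]])
    show "AE x in \<rho>X. \<bar>2 * \<eta> x - 1\<bar> * \<bar>fs x - g x\<bar> \<le> e"
      using AE_X
    proof eventually_elim
      case (elim x)
      show ?case
      proof (cases "\<eta> x = 1 / 2")
        case True
        then have "2 * \<eta> x - 1 = 0" by simp
        then show ?thesis using \<open>0 \<le> e\<close> by simp
      next
        case False
        have "\<bar>2 * \<eta> x - 1\<bar> * \<bar>fs x - g x\<bar> \<le> 1 * e"
          using close[OF elim False] eta_abs_le by (intro mult_mono) auto
        then show ?thesis by simp
      qed
    qed
  qed simp
  then show ?thesis using X.prob_space by simp
qed

lemma excess_diff_le:
  assumes [measurable]: "g \<in> borel_measurable borel" "h \<in> borel_measurable borel"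
    and g: "\<And>x. \<bar>g x\<bar> \<le> 1" and h: "\<And>x. \<bar>h x\<bar> \<le> 1"
    and close: "\<And>x. x \<in> unit_cube \<Longrightarrow> \<bar>g x - h x\<bar> \<le> e"
  shows "excess g \<le> excess h + e"
proof -
  have ih: "integrable \<rho>X (\<lambda>x. \<bar>2 * \<eta> x - 1\<bar> * \<bar>fs x - h x\<bar>)" by (rule excess_integrable[OF _ h]) simp
  have "excess g \<le> (\<integral>x. \<bar>2 * \<eta> x - 1\<bar> * \<bar>fs x - h x\<bar> + e \<partial>\<rho>X)"
    unfolding excess_def
  proof (rule integral_mono_AE)
    show "AE x in \<rho>X. \<bar>2 * \<eta> x - 1\<bar> * \<bar>fs x - g x\<bar> \<le> \<bar>2 * \<eta> x - 1\<bar> * \<bar>fs x - h x\<bar> + e"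
      using AE_X
    proof eventually_elim
      case (elim x)
      have "\<bar>fs x - g x\<bar> \<le> \<bar>fs x - h x\<bar> + \<bar>g x - h x\<bar>" by linarith
      then have "\<bar>2 * \<eta> x - 1\<bar> * \<bar>fs x - g x\<bar> \<le> \<bar>2 * \<eta> x - 1\<bar> * (\<bar>fs x - h x\<bar> + \<bar>g x - h x\<bar>)"
        by (intro mult_left_mono) auto
      moreover have "\<bar>2 * \<eta> x - 1\<bar> * \<bar>g x - h x\<bar> \<le> 1 * e"
        using close[OF elim] eta_abs_le by (intro mult_mono) auto
      ultimately show ?case by (simp add: distrib_left)
    qed
  qed (use ih in \<open>auto intro: excess_integrable g\<close>)
  also have "\<dots> = excess h + e" using ih X.prob_space by (simp add: excess_def)
  finally show ?thesis .
qed

end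

section \<open>Oracle inequality for the support vector machine\<close>

lemma kc_eval_gauss_measurable [measurable]:
  "kc_eval (gauss_kernel \<sigma>) a \<in> borel_measurable (borel :: (real^'d) measure)"
  unfolding kc_eval_def[abs_def] gauss_kernel_def by measurable

lemma H_gauss_measurable:
  fixes f :: "real^'d \<Rightarrow> real"
  assumes "f \<in> H_gauss \<sigma>"
  shows "f \<in> borel_measurable borel"
proof -
  have [measurable]: "unit_cube \<in> sets (borel :: (real^'d) measure)" by (simp add: unit_cube_def)
  obtain g where z: "\<And>x. x \<notin> unit_cube \<Longrightarrow> f x = 0"
    and g: "\<And>x. x \<in> unit_cube \<Longrightarrow> (\<lambda>k. kc_eval (gauss_kernel \<sigma>) (g k) x) \<longlonglongrightarrow> f x"
    using assms unfolding H_gauss_def rkhs_def rkhs_approx_def by blast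
  show ?thesis
  proof (rule borel_measurable_LIMSEQ_real)
    fix x show "(\<lambda>k. indicator unit_cube x * kc_eval (gauss_kernel \<sigma>) (g k) x) \<longlonglongrightarrow> f x"
      using g[of x] z[of x] by (cases "x \<in> unit_cube") auto
  qed measurable
qed

text \<open>Discharges the choice in \<open>svm_sol\<close>. Sample points must lie in the cube,
  where RKHS elements are limits of combinations.\<close>

lemma svm_sol_optimal:
  assumes D: "\<And>i. i < m \<Longrightarrow> fst (D i) \<in> unit_cube" and lam: "0 < lam"
  shows "svm_sol \<sigma> lam m D \<in> H_gauss \<sigma>"
    "g \<in> H_gauss \<sigma> \<Longrightarrow> svm_objective \<sigma> lam m D (svm_sol \<sigma> lam m D) \<le> svm_objective \<sigma> lam m D g"
proof -
  have "\<exists>f. f \<in> H_gauss \<sigma> \<and> (\<forall>g\<in>H_gauss \<sigma>. svm_objective \<sigma> lam m D f \<le> svm_objective \<sigma> lam m D g)"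
    using gauss.regularized_minimizer_exists[where D=D and m=m and \<sigma>=\<sigma>, OF lam D]
    unfolding H_gauss_def svm_objective_def gauss_sqnorm_def by blast
  from someI_ex[OF this]
  show "svm_sol \<sigma> lam m D \<in> H_gauss \<sigma>"
    "g \<in> H_gauss \<sigma> \<Longrightarrow> svm_objective \<sigma> lam m D (svm_sol \<sigma> lam m D) \<le> svm_objective \<sigma> lam m D g"
    unfolding svm_sol_def by blast+
qed

context binary_classification
begin

lemma ell_measurable [measurable]:
  assumes [measurable]: "g \<in> borel_measurable borel"
  shows "ell g \<in> borel_measurable \<rho>"
  unfolding ell_def[abs_def] by measurable

lemma AE_ell_le:
  assumes "\<And>x. \<bar>g x\<bar> \<le> 1"
  shows "AE z in \<rho>. \<bar>ell g z\<bar> \<le> 2"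
  using AE_label by eventually_elim (use fs_diff_le[of g, OF assms] in \<open>auto simp: ell_def abs_mult\<close>)

lemma ell_eq_hinge:
  assumes "\<bar>g x\<bar> \<le> 1" "y = 1 \<or> y = - 1"
  shows "ell g (x, y) = hinge (y * g x) - hinge (y * fs x)"
  using assms by (auto simp: ell_def hinge_def bayes_rule_def)

lemma hinge_clip_le: "y = 1 \<or> y = - 1 \<Longrightarrow> hinge (y * clip f x) \<le> hinge (y * f x)"
  by (auto simp: hinge_def clip_def max_def min_def)

text \<open>Optimality is used twice: against the zero function, whose empirical hinge loss is 1,
  for the norm bound; and against \<open>f0\<close>. Clipping does not increase the hinge loss, and
  the penalty of the solution is dropped.\<close>

lemma ell_sum_svm_le:
  assumes D: "\<And>i. i < m \<Longrightarrow> fst (D i) \<in> unit_cube" "\<And>i. i < m \<Longrightarrow> snd (D i) = 1 \<or> snd (D i) = - 1"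
    and m: "1 \<le> m" and f0: "f0 \<in> H_gauss \<sigma>" "\<And>x. \<bar>f0 x\<bar> \<le> 1"
  defines "f \<equiv> svm_sol \<sigma> (1 / real m) m D"
  shows "gauss_sqnorm \<sigma> f \<le> real m"
    "(\<Sum>i<m. ell (clip f) (D i)) \<le> (\<Sum>i<m. ell f0 (D i)) + gauss_sqnorm \<sigma> f0"
proof -
  define h where "h g = (\<Sum>i<m. hinge (snd (D i) * g (fst (D i))))" for g
  have m0: "0 < real m" using m by simp
  have fH: "f \<in> H_gauss \<sigma>" unfolding f_def by (rule svm_sol_optimal) (use D m0 in auto)
  have opt: "svm_objective \<sigma> (1 / real m) m D f \<le> svm_objective \<sigma> (1 / real m) m D g" if "g \<in> H_gauss \<sigma>" for g
    unfolding f_def by (rule svm_sol_optimal) (use D m0 that in auto)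
  have obj: "real m * svm_objective \<sigma> (1 / real m) m D g = h g + gauss_sqnorm \<sigma> g" for g
    using m0 by (simp add: svm_objective_def h_def distrib_left)
  have le: "h f + gauss_sqnorm \<sigma> f \<le> h g + gauss_sqnorm \<sigma> g" if "g \<in> H_gauss \<sigma>" for g
    using mult_left_mono[OF opt[OF that], of "real m"] by (simp add: obj)
  have h0: "0 \<le> h g" for g unfolding h_def by (intro sum_nonneg) (simp add: hinge_def)
  have "h (\<lambda>_. 0) = real m" by (simp add: h_def hinge_def)
  moreover have "(\<lambda>_::real^'d. 0) \<in> H_gauss \<sigma>" "gauss_sqnorm \<sigma> (\<lambda>_::real^'d. 0) = 0"
    using gauss.zero_in_rkhs by (auto simp: H_gauss_def gauss_sqnorm_def)
  ultimately show "gauss_sqnorm \<sigma> f \<le> real m"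
    using le[of "\<lambda>_. 0"] h0[of f] by simp
  have n0: "0 \<le> gauss_sqnorm \<sigma> f"
    using fH gauss.sqnorm_ge0 by (simp add: H_gauss_def gauss_sqnorm_def)
  have eq: "(\<Sum>i<m. ell g (D i)) = h g - h fs" if "\<And>x. \<bar>g x\<bar> \<le> 1" for g
    unfolding h_def sum_subtractf[symmetric]
  proof (rule sum.cong[OF refl])
    fix i assume "i \<in> {..<m}"
    then show "ell g (D i) = hinge (snd (D i) * g (fst (D i))) - hinge (snd (D i) * fs (fst (D i)))"
      using ell_eq_hinge[of g "fst (D i)" "snd (D i)"] that D(2)[of i] by simp
  qed
  have "h (clip f) \<le> h f" unfolding h_def using D(2) by (intro sum_mono hinge_clip_le) auto
  then show "(\<Sum>i<m. ell (clip f) (D i)) \<le> (\<Sum>i<m. ell f0 (D i)) + gauss_sqnorm \<sigma> f0"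
    using le[OF f0(1)] n0 by (simp add: eq clip_le1 f0(2))
qed

text \<open>Only an upper deviation of \<open>f0\<close> and lower deviations of the net elements
  are excluded; the solution is compared with a net element close to it. The third bound on
  \<open>\<theta>\<close> makes the second-moment term cost at most half an excess, so
  \<open>1/2 * excess (g a)\<close> stands against \<open>3/2 * excess f0\<close>, and doubling
  gives the constants.\<close>

lemma oracle_inequality:
  fixes A :: "(real^'d) kcomb set" and m :: nat
  assumes m: "1 \<le> m" and A: "finite A" "ln (real (card A) + 1) \<le> V"
    and cover: "\<And>f. f \<in> H_gauss \<sigma> \<Longrightarrow> gauss_sqnorm \<sigma> f \<le> real m \<Longrightarrow>
      \<exists>a\<in>A. \<forall>x\<in>unit_cube. \<bar>f x - kc_eval (gauss_kernel \<sigma>) a x\<bar> \<le> \<epsilon>"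
    and f0: "f0 \<in> H_gauss \<sigma>" "\<And>x. \<bar>f0 x\<bar> \<le> 1"
    and ch: "0 < ch" "0 < t" and tsy: "measure \<rho>X {x. \<bar>2 * \<eta> x - 1\<bar> \<le> ch * t} \<le> t powr q"
    and \<theta>: "0 < \<theta>" "\<theta> \<le> 1 / 2" "\<theta> \<le> ch * t / 4" and \<delta>: "0 < \<delta>"
  shows "\<exists>E\<in>sets (PiM {..<m} (\<lambda>_. \<rho>)). measure (PiM {..<m} (\<lambda>_. \<rho>)) E \<ge> 1 - \<delta> \<and>
    (\<forall>D\<in>E. risk \<rho> (sign_clf (svm_sol \<sigma> (1 / real m) m D)) - risk \<rho> fs \<le>
       3 * excess f0 + 2 * gauss_sqnorm \<sigma> f0 / real m + 3 * \<epsilon> + 16 * \<theta> * t powr q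
         + 4 * (V + ln (1 / \<delta>)) / (\<theta> * real m))"
proof -
  let ?P = "PiM {..<m} (\<lambda>_. \<rho>)"
  interpret P: prob_space ?P by (intro prob_space_PiM) (rule prob)
  \<comment> \<open>\<open>V\<close> absorbs the number of net elements plus 1 in the union bound,
    \<open>ln (1 / \<delta>)\<close> the confidence.\<close>
  define \<tau> where "\<tau> = V + ln (1 / \<delta>)"
  define bad where "bad F = {D \<in> space ?P.
      real m * (expectation F + \<theta> * expectation (\<lambda>z. (F z)\<^sup>2)) + \<tau> / \<theta> \<le> (\<Sum>i<m. F (D i))}" for F
  define g where "g a = clip (kc_eval (gauss_kernel \<sigma>) a)" for a :: "(real^'d) kcomb"
  have g_meas [measurable]: "g a \<in> borel_measurable borel" for a unfolding g_def by measurable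
  have g1: "\<bar>g a x\<bar> \<le> 1" for a x unfolding g_def by (rule clip_le1)
  have f0_meas [measurable]: "f0 \<in> borel_measurable borel" by (rule H_gauss_measurable[OF f0(1)])
  \<comment> \<open>The sample respects the support of the distribution only almost surely, yet
    existence of the minimizer and linearity of the loss rely on it; hence it becomes part of the
    event.\<close>
  define good where "good = {D \<in> space ?P. \<forall>i<m. fst (D i) \<in> unit_cube \<and> (snd (D i) = 1 \<or> snd (D i) = - 1)}"
  have good_sets: "good \<in> sets ?P" unfolding good_def by measurable
  have "AE D in ?P. \<forall>i\<in>{..<m}. fst (D i) \<in> unit_cube \<and> (snd (D i) = 1 \<or> snd (D i) = - 1)"
    by (rule AE_finite_allI, simp, rule AE_PiM_component[OF prob _ AE_supp])
  then have "AE D in ?P. D \<in> good" by (rule AE_mp) (auto simp: good_def intro!: AE_I2)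
  then have good1: "P.prob good = 1" using P.AE_in_set_eq_1[OF good_sets] by simp
  have bad_sets: "bad F \<in> sets ?P" if [measurable]: "F \<in> borel_measurable \<rho>" for F
    unfolding bad_def by measurable
  have bad_le: "P.prob (bad F) \<le> exp (- \<tau>)" if "F \<in> borel_measurable \<rho>" "AE z in \<rho>. \<bar>F z\<bar> \<le> 2" for F
    unfolding bad_def by (rule iid_sum_deviation[OF that \<theta>(1,2)])
  \<comment> \<open>The sign is reversed because the net elements need a lower deviation
    bound.\<close>
  define nl where "nl a z = - ell (g a) z" for a z
  have nl_meas [measurable]: "nl a \<in> borel_measurable \<rho>" for a unfolding nl_def[abs_def] by measurable
  have nl2: "AE z in \<rho>. \<bar>nl a z\<bar> \<le> 2" for a unfolding nl_def using AE_ell_le[of "g a"] g1 by simp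
  define B where "B = bad (ell f0) \<union> (\<Union>a\<in>A. bad (nl a))"
  have B_sets: "B \<in> sets ?P" unfolding B_def using A(1) by (intro sets.Un sets.finite_UN bad_sets) auto
  have "P.prob B \<le> P.prob (bad (ell f0)) + P.prob (\<Union>a\<in>A. bad (nl a))"
    unfolding B_def using A(1) by (intro measure_Un_le sets.finite_UN bad_sets) auto
  also have "P.prob (\<Union>a\<in>A. bad (nl a)) \<le> (\<Sum>a\<in>A. P.prob (bad (nl a)))"
    using A(1) by (intro measure_UNION_le) (auto intro!: bad_sets)
  also have "\<dots> \<le> (\<Sum>a\<in>A. exp (- \<tau>))" by (intro sum_mono bad_le nl2) auto
  also have "P.prob (bad (ell f0)) \<le> exp (- \<tau>)" by (intro bad_le AE_ell_le f0) auto
  finally have "P.prob B \<le> (real (card A) + 1) * exp (- \<tau>)" by (simp add: distrib_right)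
  also have "real (card A) + 1 \<le> exp V" using A(2) exp_le_cancel_iff[of "ln (real (card A) + 1)" V] by simp
  also have "exp V * exp (- \<tau>) = \<delta>" using \<delta> by (simp add: \<tau>_def exp_add[symmetric] ln_div)
  finally have PB: "P.prob B \<le> \<delta>" by simp
  define E where "E = good - B"
  show ?thesis
  proof (intro bexI[of _ E] conjI ballI)
    show "E \<in> sets ?P" unfolding E_def using good_sets B_sets by auto
    have "P.prob good \<le> P.prob (E \<union> B)" unfolding E_def using good_sets B_sets by (intro P.finite_measure_mono) auto
    also have "\<dots> \<le> P.prob E + P.prob B" unfolding E_def using good_sets B_sets by (intro measure_Un_le) auto
    finally show "1 - \<delta> \<le> P.prob E" using good1 PB by simp
    fix D assume "D \<in> E"
    then have DG: "D \<in> good" and DB: "D \<notin> B" by (auto simp: E_def)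
    have DS: "D \<in> space ?P" using DG by (simp add: good_def)
    have D: "\<And>i. i < m \<Longrightarrow> fst (D i) \<in> unit_cube" "\<And>i. i < m \<Longrightarrow> snd (D i) = 1 \<or> snd (D i) = - 1"
      using DG by (auto simp: good_def)
    have m0: "0 < real m" using m by simp
    define f where "f = svm_sol \<sigma> (1 / real m) m D"
    have fH: "f \<in> H_gauss \<sigma>" unfolding f_def using D(1) m0 by (intro svm_sol_optimal) auto
    have f_meas [measurable]: "f \<in> borel_measurable borel" by (rule H_gauss_measurable[OF fH])
    have emp: "gauss_sqnorm \<sigma> f \<le> real m" "(\<Sum>i<m. ell (clip f) (D i)) \<le> (\<Sum>i<m. ell f0 (D i)) + gauss_sqnorm \<sigma> f0"
      unfolding f_def by (rule ell_sum_svm_le(1)[where ?f0.0=f0]; use D m f0 in simp)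
        (rule ell_sum_svm_le(2); use D m f0 in simp)
    obtain a where a: "a \<in> A" and fa: "\<And>x. x \<in> unit_cube \<Longrightarrow> \<bar>f x - kc_eval (gauss_kernel \<sigma>) a x\<bar> \<le> \<epsilon>"
      using cover[OF fH emp(1)] by auto
    have ca: "\<bar>clip f x - g a x\<bar> \<le> \<epsilon>" if "x \<in> unit_cube" for x
      using fa[OF that] by (auto simp: g_def clip_def max_def min_def)
    \<comment> \<open>Here \<open>\<theta> * 2 / (ch * t) \<le> 1 / 2\<close> enters.\<close>
    have var: "\<theta> * (\<integral>z. (ell h z)\<^sup>2 \<partial>\<rho>) \<le> excess h / 2 + 4 * \<theta> * t powr q"
      if "h \<in> borel_measurable borel" "\<And>x. \<bar>h x\<bar> \<le> 1" for h
    proof -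
      have "\<theta> * (\<integral>z. (ell h z)\<^sup>2 \<partial>\<rho>) \<le> \<theta> * (2 / (ch * t) * excess h + 4 * t powr q)"
        using \<theta> by (intro mult_left_mono variance_ell[OF that ch tsy]) auto
      also have "\<dots> = (\<theta> * (2 / (ch * t))) * excess h + 4 * \<theta> * t powr q" by (simp add: algebra_simps)
      also have "(\<theta> * (2 / (ch * t))) * excess h \<le> (1 / 2) * excess h"
        using \<theta>(3) ch excess_ge0 by (intro mult_right_mono) (auto simp: field_simps)
      finally show ?thesis by simp
    qed
    have dev0: "(\<Sum>i<m. ell f0 (D i)) \<le> real m * (3 / 2 * excess f0 + 4 * \<theta> * t powr q) + \<tau> / \<theta>"
    proof -
      have "D \<notin> bad (ell f0)" using DB by (simp add: B_def)
      then have "(\<Sum>i<m. ell f0 (D i)) \<le> real m * (excess f0 + \<theta> * expectation (\<lambda>z. (ell f0 z)\<^sup>2)) + \<tau> / \<theta>"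
        using DS by (simp add: bad_def expectation_ell f0(2))
      also have "\<dots> \<le> real m * (excess f0 + (excess f0 / 2 + 4 * \<theta> * t powr q)) + \<tau> / \<theta>"
        by (intro add_right_mono mult_left_mono add_left_mono var f0(2)) auto
      finally show ?thesis by (simp add: algebra_simps)
    qed
    have deva: "real m * (excess (g a) / 2) \<le> (\<Sum>i<m. ell (g a) (D i)) + real m * (4 * \<theta> * t powr q) + \<tau> / \<theta>"
    proof -
      have "D \<notin> bad (nl a)" using DB a by (simp add: B_def)
      moreover have "expectation (nl a) = - excess (g a)"
        unfolding nl_def using expectation_ell[of "g a"] g1 by simp
      ultimately have "- (\<Sum>i<m. ell (g a) (D i)) \<le> real m * (- excess (g a) + \<theta> * expectation (\<lambda>z. (ell (g a) z)\<^sup>2)) + \<tau> / \<theta>"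
        using DS by (simp add: bad_def nl_def sum_negf)
      also have "\<dots> \<le> real m * (- excess (g a) + (excess (g a) / 2 + 4 * \<theta> * t powr q)) + \<tau> / \<theta>"
        by (intro add_right_mono mult_left_mono add_left_mono var g1) auto
      finally show ?thesis by (simp add: algebra_simps)
    qed
    have suma: "(\<Sum>i<m. ell (g a) (D i)) \<le> (\<Sum>i<m. ell (clip f) (D i)) + real m * \<epsilon>"
    proof -
      have "(\<Sum>i<m. ell (g a) (D i)) \<le> (\<Sum>i<m. ell (clip f) (D i) + \<epsilon>)"
      proof (rule sum_mono)
        fix i assume "i \<in> {..<m}"
        then have "ell (g a) (D i) - ell (clip f) (D i) = snd (D i) * (clip f (fst (D i)) - g a (fst (D i)))"
            "\<bar>clip f (fst (D i)) - g a (fst (D i))\<bar> \<le> \<epsilon>" "\<bar>snd (D i)\<bar> = 1"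
          using D[of i] ca by (auto simp: ell_def algebra_simps)
        then have "\<bar>ell (g a) (D i) - ell (clip f) (D i)\<bar> \<le> \<epsilon>" by (simp add: abs_mult)
        then show "ell (g a) (D i) \<le> ell (clip f) (D i) + \<epsilon>" by linarith
      qed
      then show ?thesis by (simp add: sum.distrib)
    qed
    have "real m * (excess (g a) / 2) \<le> (real m * (3 / 2 * excess f0 + 4 * \<theta> * t powr q) + \<tau> / \<theta>)
        + gauss_sqnorm \<sigma> f0 + real m * \<epsilon> + real m * (4 * \<theta> * t powr q) + \<tau> / \<theta>"
      using deva suma emp(2) dev0 by linarith
    also have "\<dots> = real m * (3 / 2 * excess f0 + 8 * \<theta> * t powr q + \<epsilon>) + gauss_sqnorm \<sigma> f0 + 2 * (\<tau> / \<theta>)"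
      by (simp add: algebra_simps)
    also have "\<dots> = real m * (3 / 2 * excess f0 + 8 * \<theta> * t powr q + \<epsilon> + gauss_sqnorm \<sigma> f0 / real m + 2 * \<tau> / (\<theta> * real m))"
      using m0 by (simp add: distrib_left)
    finally have "excess (g a) / 2 \<le> 3 / 2 * excess f0 + 8 * \<theta> * t powr q + \<epsilon> + gauss_sqnorm \<sigma> f0 / real m + 2 * \<tau> / (\<theta> * real m)"
      using m0 by (simp only: mult_le_cancel_left_pos)
    moreover have "excess (clip f) \<le> excess (g a) + \<epsilon>"
      by (rule excess_diff_le) (use ca in \<open>auto simp: clip_le1 g1\<close>)
    moreover have "risk \<rho> (sign_clf f) - risk \<rho> fs \<le> excess (clip f)" by (rule excess_risk_le) simp
    ultimately show "risk \<rho> (sign_clf (svm_sol \<sigma> (1 / real m) m D)) - risk \<rho> fs \<le>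
       3 * excess f0 + 2 * gauss_sqnorm \<sigma> f0 / real m + 3 * \<epsilon> + 16 * \<theta> * t powr q
         + 4 * (V + ln (1 / \<delta>)) / (\<theta> * real m)"
      unfolding f_def[symmetric] \<tau>_def[symmetric] by linarith
  qed
qed

end

section \<open>Learning rate\<close>

text \<open>One term \<open>z ^ k / fact k\<close> of the exponential series at
  \<open>z = b / \<sigma>\<^sup>2\<close> already gives the power \<open>2 * k\<close>, which is at
  least \<open>r\<close>.\<close>

lemma exp_neg_inverse_square_le_powr:
  fixes b r :: real
  assumes b: "0 < b" and r: "0 < r"
  shows "\<exists>C\<ge>0. \<forall>\<sigma>. 0 < \<sigma> \<and> \<sigma> \<le> 1 \<longrightarrow> exp (- (b / \<sigma>\<^sup>2)) \<le> C * \<sigma> powr r"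
proof -
  define k where "k = nat \<lceil>r\<rceil>"
  have k: "r \<le> real k" unfolding k_def by linarith
  show ?thesis
  proof (intro exI[of _ "fact k / b ^ k"] conjI allI impI)
    show "0 \<le> fact k / b ^ k" using b by simp
    fix \<sigma> :: real assume \<sigma>: "0 < \<sigma> \<and> \<sigma> \<le> 1"
    define z where "z = b / \<sigma>\<^sup>2"
    have z: "0 < z" using b \<sigma> by (simp add: z_def)
    obtain u where "exp z = (\<Sum>i<Suc k. z ^ i / fact i) + exp u / fact (Suc k) * z ^ Suc k"
      using Maclaurin_exp_le[of z "Suc k"] by blast
    moreover have "0 \<le> exp u / fact (Suc k) * z ^ Suc k" using z by simp
    moreover have "z ^ k / fact k \<le> (\<Sum>i<Suc k. z ^ i / fact i)"
      using z by (intro member_le_sum) auto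
    ultimately have "z ^ k / fact k \<le> exp z" by linarith
    then have "exp (- z) \<le> fact k / z ^ k"
      using z by (simp add: exp_minus inverse_eq_divide divide_le_eq pos_divide_le_eq pos_le_divide_eq mult.commute)
    also have "\<dots> = fact k / b ^ k * \<sigma> powr (2 * real k)"
      using \<sigma> by (simp add: z_def power_divide powr_realpow[of \<sigma> "2 * k", simplified] power_mult)
    also have "\<dots> \<le> fact k / b ^ k * \<sigma> powr r"
      using \<sigma> k b r by (intro mult_left_mono powr_mono') auto
    finally show "exp (- (b / \<sigma>\<^sup>2)) \<le> fact k / b ^ k * \<sigma> powr r" by (simp add: z_def)
  qed
qed

theorem theorem3:
  fixes \<rho> :: "((real^'d) \<times> real) measure"
    and \<eta> :: "real^'d \<Rightarrow> real"
    and f\<rho> :: "real^'d \<Rightarrow> real"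
    and r c0 q :: real
  assumes prob: "prob_space \<rho>"
    and sets_rho: "sets \<rho> = sets (borel :: ((real^'d) \<times> real) measure)"
    and supp: "emeasure \<rho> (unit_cube \<times> {-1, 1}) = 1"
    and eta_meas: "\<eta> \<in> borel_measurable borel"
    and eta_range: "\<forall>x. 0 \<le> \<eta> x \<and> \<eta> x \<le> 1"
    and eta_cond: "\<forall>A \<in> sets borel.
        measure \<rho> (A \<times> {1}) = set_lebesgue_integral (distr \<rho> borel fst) A \<eta>"
    and minimizer: "\<forall>x\<in>unit_cube. \<forall>t. cond_hinge_risk \<eta> x (f\<rho> x) \<le> cond_hinge_risk \<eta> x t"
    and r_pos: "r > 0" and c0_pos: "c0 > 0"
    and lip: "lip_class r c0 f\<rho>"
    and q_nonneg: "q \<ge> 0"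
    and tsybakov: "\<exists>ch>0. \<forall>t>0.
        measure (distr \<rho> borel fst) {x. \<bar>2 * \<eta> x - 1\<bar> \<le> ch * t} \<le> t powr q"
  shows "\<forall>\<nu>. 0 < \<nu> \<and> \<nu> < (q + 1) * r / ((q + 2) * r + (q + 1) * real CARD('d)) \<longrightarrow>
     (\<exists>C. \<forall>(m::nat) \<delta>. m \<ge> 1 \<and> 0 < \<delta> \<and> \<delta> < 1 \<longrightarrow>
        (let \<sigma> = real m powr (- (q + 1) / ((q + 2) * r + (q + 1) * real CARD('d)));
             lam = 1 / real m
         in \<exists>E \<in> sets (PiM {..<m} (\<lambda>_. \<rho>)).
              measure (PiM {..<m} (\<lambda>_. \<rho>)) E \<ge> 1 - \<delta> \<and>
              (\<forall>D\<in>E. risk \<rho> (sign_clf (svm_sol \<sigma> lam m D)) - risk \<rho> (bayes_rule \<eta>)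
                 \<le> C * real m powr (- ((q + 1) * r / ((q + 2) * r + (q + 1) * real CARD('d))) + \<nu>)
                     * ln (4 / \<delta>))))"
proof (intro allI impI)
  fix \<nu> assume "0 < \<nu> \<and> \<nu> < (q + 1) * r / ((q + 2) * r + (q + 1) * real CARD('d))"
  then have \<nu>: "0 < \<nu>" by simp
  interpret binary_classification \<rho> \<eta>
    using eta_range eta_cond by (intro binary_classification.intro prob sets_rho supp eta_meas) blast+
  define d where "d = CARD('d)"
  define Q where "Q = (q + 2) * r + (q + 1) * real d"
  have d1: "1 \<le> real d" unfolding d_def by (metis One_nat_def Suc_leI of_nat_1 of_nat_mono zero_less_card_finite)
  have "0 < (q + 2) * r" "0 \<le> (q + 1) * real d" using q_nonneg r_pos by simp_all
  then have Q: "0 < Q" unfolding Q_def by linarith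
  define s where "s = (q + 1) / Q"
  define \<alpha> where "\<alpha> = s * r"
  have s0: "0 < s" using q_nonneg Q by (simp add: s_def)
  have \<alpha>_eq: "\<alpha> = (q + 1) * r / Q" by (simp add: \<alpha>_def s_def)

  obtain \<gamma> where \<gamma>: "0 < \<gamma>" "\<And>x y. x \<in> unit_cube \<Longrightarrow> y \<in> unit_cube \<Longrightarrow> dist x y < \<gamma> \<Longrightarrow> \<bar>f\<rho> x - f\<rho> y\<bar> < 1"
    using lip_class_modulus[OF lip r_pos c0_pos] by blast
  \<comment> \<open>Defined through \<open>f\<rho>\<close> so that separation follows from its
    modulus of continuity; the points with \<open>\<eta> x \<noteq> 1 / 2\<close> are covered by the
    two sets.\<close>
  define Ap where "Ap = {x \<in> unit_cube. 1 \<le> f\<rho> x}"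
  define Am where "Am = {x \<in> unit_cube. f\<rho> x \<le> - 1}"
  have sub: "Ap \<subseteq> unit_cube" "Am \<subseteq> unit_cube" by (auto simp: Ap_def Am_def)
  have sep: "\<gamma> \<le> dist x y" if "x \<in> Ap" "y \<in> Am" for x y
  proof (rule ccontr)
    assume "\<not> \<gamma> \<le> dist x y"
    then have "\<bar>f\<rho> x - f\<rho> y\<bar> < 1" using \<gamma>(2)[of x y] that by (simp add: Ap_def Am_def)
    then show False using that by (simp add: Ap_def Am_def)
  qed
  obtain C1 where C1: "0 \<le> C1" and approx: "\<And>\<sigma>. 0 < \<sigma> \<Longrightarrow> \<exists>f0\<in>H_gauss \<sigma>. gauss_sqnorm \<sigma> f0 \<le> C1 * (1 / \<sigma>) ^ CARD('d) \<and>
      (\<forall>x. \<bar>f0 x\<bar> \<le> 1) \<and> (\<forall>x\<in>Ap. \<bar>f0 x - 1\<bar> \<le> C1 * exp (- (\<gamma>\<^sup>2 / (4 * \<sigma>\<^sup>2)))) \<and>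
      (\<forall>x\<in>Am. \<bar>f0 x + 1\<bar> \<le> C1 * exp (- (\<gamma>\<^sup>2 / (4 * \<sigma>\<^sup>2))))"
    using gauss_approximation[of \<gamma> Ap Am] \<gamma>(1) sub sep by blast
  obtain C2 where C2: "0 \<le> C2" and net: "\<And>(m::nat) \<sigma>. 1 \<le> m \<Longrightarrow> 0 < \<sigma> \<Longrightarrow> \<sigma> \<le> 1 \<Longrightarrow>
    (\<exists>A :: (real^'d) kcomb set. finite A \<and> ln (real (card A) + 1) \<le> C2 * (1 / \<sigma>) ^ CARD('d) * real m powr \<nu> \<and>
      (\<forall>f\<in>H_gauss \<sigma>. gauss_sqnorm \<sigma> f \<le> real m \<longrightarrow>
         (\<exists>a\<in>A. \<forall>x\<in>unit_cube. \<bar>f x - kc_eval (gauss_kernel \<sigma>) a x\<bar> \<le> 6 / real m)))"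
    using gauss_ball_net[OF \<nu>, where ?'d='d] by blast
  have "0 < \<gamma>\<^sup>2 / 4" using \<gamma> by simp
  \<comment> \<open>Of the exponentially small error only the power \<open>\<sigma> powr r\<close>,
    equal to the target rate, is kept.\<close>
  then obtain C3 where C3: "0 \<le> C3" and tail: "\<And>\<sigma>. 0 < \<sigma> \<Longrightarrow> \<sigma> \<le> 1 \<Longrightarrow> exp (- (\<gamma>\<^sup>2 / 4 / \<sigma>\<^sup>2)) \<le> C3 * \<sigma> powr r"
    using exp_neg_inverse_square_le_powr[OF _ r_pos] by blast
  obtain ch where ch: "0 < ch" and tsy: "\<And>t. 0 < t \<Longrightarrow> measure \<rho>X {x. \<bar>2 * \<eta> x - 1\<bar> \<le> ch * t} \<le> t powr q"
    using tsybakov by blast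
  \<comment> \<open>Since \<open>t \<le> 1\<close> below, these bounds make
    \<open>\<theta> = c * t\<close> admissible in the oracle inequality.\<close>
  define c where "c = min (1 / 2) (ch / 4)"
  have c: "0 < c" "c \<le> 1 / 2" "c \<le> ch / 4" using ch by (auto simp: c_def)
  \<comment> \<open>In order: approximation error, norm of \<open>f0\<close>, net radius
    \<open>3 * 6\<close>, small-margin term \<open>16 * c \<le> 8\<close>, and estimation
    error.\<close>
  define C where "C = 3 * (C1 * C3) + 2 * C1 + 18 + 8 + 4 / c * (C2 + 1)"

  show "\<exists>C. \<forall>(m::nat) \<delta>. m \<ge> 1 \<and> 0 < \<delta> \<and> \<delta> < 1 \<longrightarrow>
        (let \<sigma> = real m powr (- (q + 1) / ((q + 2) * r + (q + 1) * real CARD('d)));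
             lam = 1 / real m
         in \<exists>E \<in> sets (PiM {..<m} (\<lambda>_. \<rho>)).
              measure (PiM {..<m} (\<lambda>_. \<rho>)) E \<ge> 1 - \<delta> \<and>
              (\<forall>D\<in>E. risk \<rho> (sign_clf (svm_sol \<sigma> lam m D)) - risk \<rho> (bayes_rule \<eta>)
                 \<le> C * real m powr (- ((q + 1) * r / ((q + 2) * r + (q + 1) * real CARD('d))) + \<nu>)
                     * ln (4 / \<delta>)))"
  proof (intro exI[of _ C] allI impI, unfold Let_def)
    fix m :: nat and \<delta> :: real
    assume "m \<ge> 1 \<and> 0 < \<delta> \<and> \<delta> < 1"
    then have m: "1 \<le> m" and \<delta>: "0 < \<delta>" "\<delta> < 1" by auto
    have m1: "1 \<le> real m" using m by simp
    then have m0: "0 < real m" by simp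
    define \<sigma> where "\<sigma> = real m powr (- s)"
    have \<sigma>: "0 < \<sigma>" "\<sigma> \<le> 1" using m0 m1 s0 powr_mono[of "- s" 0 "real m"] by (auto simp: \<sigma>_def)
    have \<sigma>_stmt: "real m powr (- (q + 1) / ((q + 2) * r + (q + 1) * real CARD('d))) = \<sigma>"
      by (simp only: \<sigma>_def s_def Q_def d_def minus_divide_left)
    \<comment> \<open>Then
      \<open>t powr (q + 1) = \<sigma> powr r = m powr (- \<alpha>)\<close>.\<close>
    define t where "t = real m powr (- (r / Q))"
    have t0: "0 < t" using m0 by (simp add: t_def)
    have t1: "t \<le> 1" using m0 m1 r_pos Q powr_mono[of "- (r / Q)" 0 "real m"] by (simp add: t_def)
    define \<theta> where "\<theta> = c * t"
    have \<theta>: "0 < \<theta>" "\<theta> \<le> 1 / 2" "\<theta> \<le> ch * t / 4"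
    proof -
      show "0 < \<theta>" using c t0 by (simp add: \<theta>_def)
      show "\<theta> \<le> 1 / 2" unfolding \<theta>_def using mult_mono[of c "1/2" t 1] c t0 t1 by simp
      show "\<theta> \<le> ch * t / 4" unfolding \<theta>_def using mult_right_mono[OF c(3), of t] t0 by simp
    qed
    define V where "V = C2 * (1 / \<sigma>) ^ CARD('d) * real m powr \<nu>"
    define L where "L = ln (4 / \<delta>)"
    have L1: "1 \<le> L"
    proof -
      have "exp 1 \<le> (4 :: real)" using exp_le by linarith
      also have "4 \<le> 4 / \<delta>" using \<delta> by (simp add: le_divide_eq)
      finally show ?thesis using \<delta> by (simp add: L_def ln_ge_iff)
    qed
    define M where "M = real m powr (- \<alpha> + \<nu>)"
    have M\<alpha>: "real m powr (- \<alpha>) \<le> M" unfolding M_def using m1 \<nu> by (intro powr_mono) auto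
    have M0: "0 < M" using m0 by (simp add: M_def)

    obtain A :: "(real^'d) kcomb set" where A: "finite A" "ln (real (card A) + 1) \<le> V"
      "\<And>f. f \<in> H_gauss \<sigma> \<Longrightarrow> gauss_sqnorm \<sigma> f \<le> real m \<Longrightarrow>
         \<exists>a\<in>A. \<forall>x\<in>unit_cube. \<bar>f x - kc_eval (gauss_kernel \<sigma>) a x\<bar> \<le> 6 / real m"
      using net[OF m \<sigma>] unfolding V_def by blast
    obtain f0 where f0: "f0 \<in> H_gauss \<sigma>" "gauss_sqnorm \<sigma> f0 \<le> C1 * (1 / \<sigma>) ^ CARD('d)" "\<And>x. \<bar>f0 x\<bar> \<le> 1"
        "\<And>x. x \<in> Ap \<Longrightarrow> \<bar>f0 x - 1\<bar> \<le> C1 * exp (- (\<gamma>\<^sup>2 / (4 * \<sigma>\<^sup>2)))"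
        "\<And>x. x \<in> Am \<Longrightarrow> \<bar>f0 x + 1\<bar> \<le> C1 * exp (- (\<gamma>\<^sup>2 / (4 * \<sigma>\<^sup>2)))"
      using approx[OF \<sigma>(1)] by blast
    obtain E where E: "E \<in> sets (PiM {..<m} (\<lambda>_. \<rho>))" "measure (PiM {..<m} (\<lambda>_. \<rho>)) E \<ge> 1 - \<delta>"
      "\<And>D. D \<in> E \<Longrightarrow> risk \<rho> (sign_clf (svm_sol \<sigma> (1 / real m) m D)) - risk \<rho> fs \<le>
         3 * excess f0 + 2 * gauss_sqnorm \<sigma> f0 / real m + 3 * (6 / real m) + 16 * \<theta> * t powr q
           + 4 * (V + ln (1 / \<delta>)) / (\<theta> * real m)"
      using oracle_inequality[OF m A f0(1,3) ch t0 tsy[OF t0] \<theta> \<delta>(1)] by blast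

    have exc: "excess f0 \<le> C1 * C3 * real m powr (- \<alpha>)"
    proof -
      have e: "C1 * exp (- (\<gamma>\<^sup>2 / (4 * \<sigma>\<^sup>2))) \<le> C1 * (C3 * \<sigma> powr r)"
        using tail[OF \<sigma>] C1 by (intro mult_left_mono) auto
      have "excess f0 \<le> C1 * exp (- (\<gamma>\<^sup>2 / (4 * \<sigma>\<^sup>2)))"
      proof (rule excess_le_sup[OF H_gauss_measurable[OF f0(1)] f0(3)])
        show "0 \<le> C1 * exp (- (\<gamma>\<^sup>2 / (4 * \<sigma>\<^sup>2)))" using C1 by simp
        fix x :: "real^'d" assume x: "x \<in> unit_cube" "\<eta> x \<noteq> 1 / 2"
        have min: "\<And>t. cond_hinge_risk \<eta> x (f\<rho> x) \<le> cond_hinge_risk \<eta> x t" using minimizer x by blast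
        have eta: "0 \<le> \<eta> x" "\<eta> x \<le> 1" using eta_range by auto
        show "\<bar>fs x - f0 x\<bar> \<le> C1 * exp (- (\<gamma>\<^sup>2 / (4 * \<sigma>\<^sup>2)))"
        proof (cases "1 / 2 < \<eta> x")
          case True
          then have "x \<in> Ap" "fs x = 1" using hinge_minimizer_separates(1)[OF min eta] x by (auto simp: Ap_def bayes_rule_def)
          then show ?thesis using f0(4) by (simp add: abs_minus_commute)
        next
          case False
          then have "x \<in> Am" "fs x = - 1" using hinge_minimizer_separates(2)[OF min eta] x by (auto simp: Am_def bayes_rule_def)
          then show ?thesis using f0(5)[of x] by (simp add: abs_minus_commute)
        qed
      qed
      also note e
      also have "\<sigma> powr r = real m powr (- \<alpha>)" by (simp add: \<sigma>_def powr_powr \<alpha>_def)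
      finally show ?thesis by simp
    qed
    have \<sigma>d: "(1 / \<sigma>) ^ CARD('d) = real m powr (s * real d)"
    proof -
      have "1 / \<sigma> = real m powr s" by (simp add: \<sigma>_def powr_minus inverse_eq_divide)
      then show ?thesis using m0 by (simp add: d_def powr_realpow[symmetric] powr_powr)
    qed
    \<comment> \<open>Multiplied by \<open>Q\<close> this reads
      \<open>(q + 1) * d + r - Q = - (q + 1) * r\<close>, the definition of \<open>Q\<close>. It
      fixes the exponent of \<open>(1 / \<sigma>) ^ d / (t * m)\<close>.\<close>
    have Qd: "s * real d + r / Q - 1 = - \<alpha>"
    proof -
      have "Q * (s * real d + r / Q - 1) = Q * (- \<alpha>)"
        using Q by (simp add: s_def \<alpha>_def field_simps) (simp add: Q_def algebra_simps)
      then show ?thesis using Q by (simp only: mult_cancel_left) simp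
    qed
    have rQ: "0 < r / Q" using r_pos Q by simp
    have nrm: "2 * gauss_sqnorm \<sigma> f0 / real m \<le> 2 * C1 * real m powr (- \<alpha>)"
    proof -
      have "2 * gauss_sqnorm \<sigma> f0 / real m \<le> 2 * (C1 * real m powr (s * real d)) / real m"
        using f0(2) m0 \<sigma>d by (intro divide_right_mono) auto
      also have "\<dots> = 2 * C1 * real m powr (s * real d - 1)" using m0 by (simp add: powr_diff)
      also have "\<dots> \<le> 2 * C1 * real m powr (- \<alpha>)"
        using C1 m1 Qd rQ by (intro mult_left_mono powr_mono) auto
      finally show ?thesis .
    qed
    have inv: "3 * (6 / real m) \<le> 18 * real m powr (- \<alpha>)"
    proof -
      \<comment> \<open>\<open>Q\<close> exceeds \<open>(q + 1) * r\<close> by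
        \<open>r + (q + 1) * d\<close>, so \<open>1 / m\<close> is never slower than the
        rate.\<close>
      have "\<alpha> \<le> 1" unfolding \<alpha>_eq using Q q_nonneg r_pos d1 by (simp add: divide_le_eq Q_def algebra_simps)
      then have "real m powr (-1) \<le> real m powr (- \<alpha>)" using m1 by (intro powr_mono) auto
      then show ?thesis using m0 by (simp add: powr_minus inverse_eq_divide)
    qed
    have bias: "16 * \<theta> * t powr q \<le> 8 * real m powr (- \<alpha>)"
    proof -
      have "t * t powr q = real m powr (- \<alpha>)"
      proof -
        have "t * t powr q = t powr (q + 1)" using t0 by (simp add: powr_add)
        also have "\<dots> = real m powr (- (r / Q) * (q + 1))" by (simp add: t_def powr_powr)
        also have "- (r / Q) * (q + 1) = - \<alpha>" by (simp add: \<alpha>_eq mult.commute)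
        finally show ?thesis .
      qed
      then have "16 * \<theta> * t powr q = 16 * c * real m powr (- \<alpha>)" by (simp add: \<theta>_def mult.assoc)
      also have "\<dots> \<le> 8 * real m powr (- \<alpha>)" using c by (intro mult_right_mono) auto
      finally show ?thesis .
    qed
    have est: "4 * (V + ln (1 / \<delta>)) / (\<theta> * real m) \<le> 4 / c * (C2 + 1) * (M * L)"
    proof -
      have tm: "1 / (t * real m) = real m powr (r / Q - 1)"
        using m0 by (simp add: t_def powr_minus powr_diff inverse_eq_divide)
      have 1: "V * real m powr (r / Q - 1) = C2 * M"
      proof -
        have "V * real m powr (r / Q - 1) = C2 * (real m powr (s * real d) * real m powr \<nu> * real m powr (r / Q - 1))"
          by (simp add: V_def \<sigma>d)
        also have "real m powr (s * real d) * real m powr \<nu> * real m powr (r / Q - 1) = real m powr (s * real d + \<nu> + (r / Q - 1))"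
          by (simp only: powr_add)
        also have "s * real d + \<nu> + (r / Q - 1) = - \<alpha> + \<nu>" using Qd by linarith
        finally show ?thesis by (simp add: M_def)
      qed
      have 2: "real m powr (r / Q - 1) \<le> M"
      proof -
        have "0 \<le> s * real d" using s0 by simp
        then have "real m powr (r / Q - 1) \<le> real m powr (- \<alpha>)"
          using m1 Qd by (intro powr_mono) auto
        then show ?thesis using M\<alpha> by linarith
      qed
      have ln1: "ln (1 / \<delta>) \<le> L" "0 \<le> ln (1 / \<delta>)" using \<delta> by (auto simp: L_def ln_div)
      have "4 * (V + ln (1 / \<delta>)) / (\<theta> * real m) = 4 / c * ((V + ln (1 / \<delta>)) * (1 / (t * real m)))"
        by (simp add: \<theta>_def)
      also have "\<dots> = 4 / c * (C2 * M + ln (1 / \<delta>) * real m powr (r / Q - 1))"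
        unfolding tm by (simp only: distrib_right 1)
      also have "\<dots> \<le> 4 / c * (C2 * (M * L) + M * L)"
      proof (intro mult_left_mono add_mono)
        show "M \<le> M * L" using M0 L1 by simp
        have "ln (1 / \<delta>) * real m powr (r / Q - 1) \<le> L * M"
          using ln1 2 L1 by (intro mult_mono) auto
        then show "ln (1 / \<delta>) * real m powr (r / Q - 1) \<le> M * L" by (simp add: mult.commute)
      qed (use c C2 in auto)
      also have "\<dots> = 4 / c * (C2 + 1) * (M * L)" by (simp add: algebra_simps add_divide_distrib)
      finally show ?thesis .
    qed
    have rate: "real m powr (- \<alpha>) \<le> M * L"
      using M\<alpha> mult_left_mono[OF L1, of M] M0 by linarith
    show "\<exists>E \<in> sets (PiM {..<m} (\<lambda>_. \<rho>)).
              measure (PiM {..<m} (\<lambda>_. \<rho>)) E \<ge> 1 - \<delta> \<and>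
              (\<forall>D\<in>E. risk \<rho> (sign_clf (svm_sol (real m powr (- (q + 1) / ((q + 2) * r + (q + 1) * real CARD('d)))) (1 / real m) m D)) - risk \<rho> fs
                 \<le> C * real m powr (- ((q + 1) * r / ((q + 2) * r + (q + 1) * real CARD('d))) + \<nu>)
                     * ln (4 / \<delta>))"
      unfolding \<sigma>_stmt
    proof (intro bexI[OF _ E(1)] conjI E(2) ballI)
      fix D assume "D \<in> E"
      have "risk \<rho> (sign_clf (svm_sol \<sigma> (1 / real m) m D)) - risk \<rho> fs \<le>
          3 * (C1 * C3 * real m powr (- \<alpha>)) + 2 * C1 * real m powr (- \<alpha>) + 18 * real m powr (- \<alpha>)
            + 8 * real m powr (- \<alpha>) + 4 / c * (C2 + 1) * (M * L)"
        using E(3)[OF \<open>D \<in> E\<close>] exc nrm inv bias est by linarith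
      also have "\<dots> = (3 * (C1 * C3) + 2 * C1 + 18 + 8) * real m powr (- \<alpha>) + 4 / c * (C2 + 1) * (M * L)"
        by (simp add: algebra_simps)
      also have "\<dots> \<le> (3 * (C1 * C3) + 2 * C1 + 18 + 8) * (M * L) + 4 / c * (C2 + 1) * (M * L)"
        using rate C1 C3 by (intro add_right_mono mult_left_mono) auto
      also have "\<dots> = C * M * L" by (simp add: C_def algebra_simps)
      finally show "risk \<rho> (sign_clf (svm_sol \<sigma> (1 / real m) m D)) - risk \<rho> fs
          \<le> C * real m powr (- ((q + 1) * r / ((q + 2) * r + (q + 1) * real CARD('d))) + \<nu>) * ln (4 / \<delta>)"
        by (simp add: M_def L_def \<alpha>_eq Q_def d_def)
    qed
  qed
qed

end
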